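(* Let $G$ be a Coxeter group with Coxeter generating set $\{g_1,\dots,g_n\}$, and let $T=\{1_G,g_1,\dots,g_n\}$. Suppose $G$ is finite of type either $I$ (dihedral group), or $A$, or $B$, or $D$. If for two finite dimensional complex linear representations $\rho_1$ and $\rho_2$ of $G$ we have $$D(T,\rho_1)=D(T,\rho_2)$$ as subschemes of $\mathbb{C}\mathbb{P}^n$, then the representations $\rho_1$ and $\rho_2$ are equivalent.
   Context: A Coxeter group with Coxeter generating set $\{g_1,\dots,g_n\}$ is a group presented by generators $g_1,\dots,g_n$ and relations $(g_ig_j)^{m_{ij}}=1$, with $m_{ii}=1$, $m_{ij}=m_{ji}\in\mathbb{N}\cup\{\infty\}$, $m_{ij}\ge2$ for $i\neq j$ (no relation if $m_{ij}=\infty$). The type refers to the Coxeter diagram of the given generating set. The types are (all pairs $i\ne j$ not mentioned have $m_{ij}=2$): - $A_k$: generators $g_1,\dots,g_k$, $m_{i,i+1}=3$ for $1\le i\le k-1$. - $B_k$ ($k\ge2$): generators $g_1,\dots,g_k$, $m_{i,i+1}=3$ for $1\le i\le k-2$, $m_{k-1,k}=4$. - $D_{k+1}$ ($k\ge2$): generators $g_1,\dots,g_{k+1}$, $m_{i,i+1}=3$ for $1\le i\le k-1$, $m_{k-1,k+1}=3$, and $m_{k,k+1}=2$. - $I(k)$ (finite dihedral, $2\le k<\infty$): generators $g_1,g_2$ with $m_{12}=k$. For linear operators $A_0,\dots,A_n$ on a finite dimensional complex vector space, $\sigma(A_0,\dots,A_n)$ is the closed subscheme of $\mathbb{C}\mathbb{P}^n$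 defined by the homogeneous polynomial $\det(x_0A_0+\dots+x_nA_n)$; two such are equal as subschemes iff the defining polynomials agree up to a nonzero scalar. For a finite dimensional representation $\rho:G\to GL(V)$ one sets $D(T,\rho)=\sigma(\rho(1_G),\rho(g_1),\dots,\rho(g_n))$. Representations $\rho_1:G\to GL(V_1)$ and $\rho_2:G\to GL(V_2)$ are equivalent if there is a linear isomorphism $C:V_1\to V_2$ with $\rho_2(w)=C\rho_1(w)C^{-1}$ for all $w\in G$. *)

theory Defs
  imports
    "HOL-Library.Extended_Nat"
    "HOL-Library.Poly_Mapping"
    "HOL-Algebra.Generated_Groups"
    "Jordan_Normal_Form.Determinant"
begin

text \<open>A letter \<open>(i, True)\<close> stands for the generator \<open>i\<close>, and \<open>(i, False)\<close> for its formal inverse.\<close>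

type_synonym 'i gword = "('i \<times> bool) list"

definition word_val :: "('g, 'x) monoid_scheme \<Rightarrow> ('i \<Rightarrow> 'g) \<Rightarrow> 'i gword \<Rightarrow> 'g" where
  "word_val G g w =
     foldr (\<lambda>(i, b) a. (if b then g i else inv\<^bsub>G\<^esub> (g i)) \<otimes>\<^bsub>G\<^esub> a) w \<one>\<^bsub>G\<^esub>"

text \<open>Equality of words in the group with generators \<open>I\<close> and relators \<open>R\<close>: the words
  equivalent to \<open>[]\<close> represent the normal closure of \<open>R\<close> in the free group on \<open>I\<close>.\<close>

inductive pres_eq :: "'i set \<Rightarrow> 'i gword set \<Rightarrow> 'i gword \<Rightarrow> 'i gword \<Rightarrow> bool"
  for I :: "'i set" and R :: "'i gword set" where
  refl: "pres_eq I R w w"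
| sym: "pres_eq I R v w \<Longrightarrow> pres_eq I R w v"
| trans: "pres_eq I R u v \<Longrightarrow> pres_eq I R v w \<Longrightarrow> pres_eq I R u w"
| cancel: "i \<in> I \<Longrightarrow> pres_eq I R (u @ [(i, b), (i, \<not> b)] @ v) (u @ v)"
| relator: "r \<in> R \<Longrightarrow> pres_eq I R (u @ r @ v) (u @ v)"

definition presented_by ::
  "('g, 'x) monoid_scheme \<Rightarrow> 'i set \<Rightarrow> ('i \<Rightarrow> 'g) \<Rightarrow> 'i gword set \<Rightarrow> bool" where
  "presented_by G I g R \<longleftrightarrow>
     group G \<and> g ` I \<subseteq> carrier G \<and> generate G (g ` I) = carrier G \<and>
     (\<forall>w \<in> lists (I \<times> UNIV). word_val G g w = \<one>\<^bsub>G\<^esub> \<longleftrightarrow> pres_eq I R w [])"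

definition coxeter_matrix :: "nat \<Rightarrow> (nat \<Rightarrow> nat \<Rightarrow> enat) \<Rightarrow> bool" where
  "coxeter_matrix n m \<longleftrightarrow>
     (\<forall>i \<in> {1..n}. m i i = 1) \<and>
     (\<forall>i \<in> {1..n}. \<forall>j \<in> {1..n}. m i j = m j i) \<and>
     (\<forall>i \<in> {1..n}. \<forall>j \<in> {1..n}. i \<noteq> j \<longrightarrow> 2 \<le> m i j)"

definition coxeter_relators :: "nat \<Rightarrow> (nat \<Rightarrow> nat \<Rightarrow> enat) \<Rightarrow> nat gword set" where
  "coxeter_relators n m =
     {concat (replicate k [(i, True), (j, True)]) | i j k.
        i \<in> {1..n} \<and> j \<in> {1..n} \<and> m i j = enat k}"

definition coxeter_group ::
  "('g, 'x) monoid_scheme \<Rightarrow> nat \<Rightarrow> (nat \<Rightarrow> 'g) \<Rightarrow> (nat \<Rightarrow> nat \<Rightarrow> enat) \<Rightarrow> bool" where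
  "coxeter_group G n g m \<longleftrightarrow>
     coxeter_matrix n m \<and> presented_by G {1..n} g (coxeter_relators n m)"

definition A_matrix :: "nat \<Rightarrow> nat \<Rightarrow> enat" where
  "A_matrix i j = (if i = j then 1 else if j = i + 1 \<or> i = j + 1 then 3 else 2)"

definition B_matrix :: "nat \<Rightarrow> nat \<Rightarrow> nat \<Rightarrow> enat" where
  "B_matrix k i j =
     (if i = j then 1
      else if {i, j} = {k - 1, k} then 4
      else if j = i + 1 \<or> i = j + 1 then 3
      else 2)"

text \<open>Type \<open>D\<^bsub>k+1\<^esub>\<close>, on the \<open>k + 1\<close> generators \<open>1, \<dots>, k + 1\<close>.\<close>

definition D_matrix :: "nat \<Rightarrow> nat \<Rightarrow> nat \<Rightarrow> enat" where
  "D_matrix k i j =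
     (if i = j then 1
      else if {i, j} = {k - 1, k + 1} then 3
      else if {i, j} = {k, k + 1} then 2
      else if j = i + 1 \<or> i = j + 1 then 3
      else 2)"

definition I_matrix :: "nat \<Rightarrow> nat \<Rightarrow> nat \<Rightarrow> enat" where
  "I_matrix k i j = (if i = j then 1 else enat k)"

text \<open>The type is a property of the diagram, so the generators may be listed in any order.\<close>

definition has_diagram :: "nat \<Rightarrow> (nat \<Rightarrow> nat \<Rightarrow> enat) \<Rightarrow> (nat \<Rightarrow> nat \<Rightarrow> enat) \<Rightarrow> bool" where
  "has_diagram n m M \<longleftrightarrow>
     (\<exists>\<pi>. bij_betw \<pi> {1..n} {1..n} \<and>
          (\<forall>i \<in> {1..n}. \<forall>j \<in> {1..n}. m (\<pi> i) (\<pi> j) = M i j))"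

definition type_A :: "nat \<Rightarrow> (nat \<Rightarrow> nat \<Rightarrow> enat) \<Rightarrow> bool" where
  "type_A n m \<longleftrightarrow> 1 \<le> n \<and> has_diagram n m A_matrix"

definition type_B :: "nat \<Rightarrow> (nat \<Rightarrow> nat \<Rightarrow> enat) \<Rightarrow> bool" where
  "type_B n m \<longleftrightarrow> 2 \<le> n \<and> has_diagram n m (B_matrix n)"

definition type_D :: "nat \<Rightarrow> (nat \<Rightarrow> nat \<Rightarrow> enat) \<Rightarrow> bool" where
  "type_D n m \<longleftrightarrow> (\<exists>k \<ge> 2. n = k + 1 \<and> has_diagram n m (D_matrix k))"

definition type_I :: "nat \<Rightarrow> (nat \<Rightarrow> nat \<Rightarrow> enat) \<Rightarrow> bool" where
  "type_I n m \<longleftrightarrow> (\<exists>k \<ge> 2. n = 2 \<and> has_diagram n m (I_matrix k))"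

text \<open>A complex vector space is a type \<open>'v\<close> together with its scalar multiplication.\<close>

definition fin_dim_space :: "(complex \<Rightarrow> 'v \<Rightarrow> 'v::ab_group_add) \<Rightarrow> bool" where
  "fin_dim_space s \<longleftrightarrow> (\<exists>B. finite_dimensional_vector_space s B)"

definition GL :: "(complex \<Rightarrow> 'v \<Rightarrow> 'v::ab_group_add) \<Rightarrow> ('v \<Rightarrow> 'v) monoid" where
  "GL s = \<lparr>carrier = {f. Vector_Spaces.linear s s f \<and> bij f}, monoid.mult = (\<circ>), one = id\<rparr>"

definition fin_dim_rep ::
  "('g, 'x) monoid_scheme \<Rightarrow> (complex \<Rightarrow> 'v \<Rightarrow> 'v::ab_group_add) \<Rightarrow> ('g \<Rightarrow> 'v \<Rightarrow> 'v) \<Rightarrow> bool" where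
  "fin_dim_rep G s \<rho> \<longleftrightarrow> fin_dim_space s \<and> \<rho> \<in> hom G (GL s)"

definition equivalent_reps ::
  "('g, 'x) monoid_scheme \<Rightarrow>
   (complex \<Rightarrow> 'v \<Rightarrow> 'v::ab_group_add) \<Rightarrow> ('g \<Rightarrow> 'v \<Rightarrow> 'v) \<Rightarrow>
   (complex \<Rightarrow> 'w \<Rightarrow> 'w::ab_group_add) \<Rightarrow> ('g \<Rightarrow> 'w \<Rightarrow> 'w) \<Rightarrow> bool" where
  "equivalent_reps G s\<^sub>1 \<rho>\<^sub>1 s\<^sub>2 \<rho>\<^sub>2 \<longleftrightarrow>
     (\<exists>C. Vector_Spaces.linear s\<^sub>1 s\<^sub>2 C \<and> bij C \<and>
          (\<forall>w \<in> carrier G. \<rho>\<^sub>2 w = C \<circ> \<rho>\<^sub>1 w \<circ> inv_into UNIV C))"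

text \<open>Polynomials over \<open>complex\<close> in the variables \<open>x\<^sub>0, x\<^sub>1, \<dots>\<close>: finitely supported
  maps from monomials, i.e. exponent vectors, to coefficients.\<close>

type_synonym cpoly = "(nat \<Rightarrow>\<^sub>0 nat) \<Rightarrow>\<^sub>0 complex"

definition const_poly :: "complex \<Rightarrow> cpoly" where
  "const_poly c = Poly_Mapping.single 0 c"

definition var_poly :: "nat \<Rightarrow> cpoly" where
  "var_poly i = Poly_Mapping.single (Poly_Mapping.single i 1) 1"

definition ordered_basis :: "(complex \<Rightarrow> 'v \<Rightarrow> 'v::ab_group_add) \<Rightarrow> 'v list \<Rightarrow> bool" where
  "ordered_basis s bs \<longleftrightarrow>
     distinct bs \<and> \<not> module.dependent s (set bs) \<and> module.span s (set bs) = UNIV"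

definition matrix_wrt ::
  "(complex \<Rightarrow> 'v \<Rightarrow> 'v::ab_group_add) \<Rightarrow> 'v list \<Rightarrow> ('v \<Rightarrow> 'v) \<Rightarrow> complex mat" where
  "matrix_wrt s bs f =
     mat (length bs) (length bs)
       (\<lambda>(r, c). module.representation s (set bs) (f (bs ! c)) (bs ! r))"

text \<open>The polynomial \<open>det (x\<^sub>0 A\<^sub>0 + \<dots> + x\<^sub>n A\<^sub>n)\<close>; it does not depend on the
  choice of basis, since \<open>det\<close> is invariant under conjugation.\<close>

definition pencil_det ::
  "(complex \<Rightarrow> 'v \<Rightarrow> 'v::ab_group_add) \<Rightarrow> nat \<Rightarrow> (nat \<Rightarrow> 'v \<Rightarrow> 'v) \<Rightarrow> cpoly" where
  "pencil_det s n A =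
     (let bs = SOME bs. ordered_basis s bs; d = length bs
      in det (mat d d (\<lambda>(r, c).
           \<Sum>i \<le> n. var_poly i * const_poly (matrix_wrt s bs (A i) $$ (r, c)))))"

text \<open>Two hypersurfaces are the same subscheme of projective space iff their defining
  homogeneous polynomials agree up to a nonzero scalar.\<close>

definition same_hypersurface :: "cpoly \<Rightarrow> cpoly \<Rightarrow> bool" where
  "same_hypersurface p q \<longleftrightarrow> (\<exists>c. c \<noteq> 0 \<and> p = const_poly c * q)"

text \<open>The defining polynomial of \<open>D(T, \<rho>)\<close> for \<open>T = {1, g\<^sub>1, \<dots>, g\<^sub>n}\<close>.\<close>

definition D_poly ::
  "('g, 'x) monoid_scheme \<Rightarrow> nat \<Rightarrow> (nat \<Rightarrow> 'g) \<Rightarrow>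
   (complex \<Rightarrow> 'v \<Rightarrow> 'v::ab_group_add) \<Rightarrow> ('g \<Rightarrow> 'v \<Rightarrow> 'v) \<Rightarrow> cpoly" where
  "D_poly G n g s \<rho> = pencil_det s n (\<lambda>i. \<rho> (if i = 0 then \<one>\<^bsub>G\<^esub> else g i))"

end

theory Submission
  imports
    Defs
    "HOL-Algebra.Multiplicative_Group"
    "Jordan_Normal_Form.Schur_Decomposition"
    "Jordan_Normal_Form.Column_Operations"
begin

text \<open>Setting \<open>x\<^sub>0\<close> aside, the determinant is the characteristic polynomial of \<open>\<Sum> x\<^sub>i \<rho>(g\<^sub>i)\<close>, so it
  determines the traces of all powers of this operator and hence, for every multiset \<open>C\<close> of
  generators, the sum of the character over all words with content \<open>C\<close>. By reduction along double
  cosets of the chain of standard parabolic subgroups, every word in type \<open>B\<close> is conjugate to a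
  standard word of a signed composition whose content is no larger. The content determines the signed
  composition, so the system of equations for the difference of the two characters is triangular
  with positive diagonal, and the difference vanishes. Type \<open>A\<close> is the case in which the
  sign change \<open>s\<^sub>0\<close> is the identity, which is itself a letter of the pencil. In type \<open>D\<close> the part
  of the difference that is symmetric under the diagram automorphism is again a function on type-\<open>B\<close>
  words; the antisymmetric part vanishes on standard words with a negative block, which commutes with
  the whole word, and the other standard words are of type \<open>A\<close>. Finally, representations of a finite
  group with equal characters are equivalent: summing the squared absolute value of the character
  produces a nonzero intertwiner, whose image splits off from both representations.\<close>

section \<open>Reduction of words in type B\<close>

text \<open>A content sum mixes many conjugacy classes, and a braid move alters the content, so the
  linear system is not triangular by itself. The reduction is therefore directed: between
  \<open>q p q\<close> and \<open>p q p\<close> with \<open>q = p + 1\<close> it passes to the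
  second, which keeps the length and lowers a letter. This is why contents are compared by the
  numbers \<open>up i\<close> of letters at least \<open>i\<close>, and not letter by letter. The
  letter \<open>0\<close> is recorded only modulo 2. Its parity suffices to recover the sign of the
  lowest block, and no more is available in type D, where the content of a word fixes the number of
  zeros of a type-B word lying above it only up to parity. Distinct standard words may well be
  conjugate; this does no harm, because the equations are indexed by contents and not by classes.
  The reduction is carried out for functions on words with values in an arbitrary type, since in
  type D the values that are invariant under all type-B moves are unordered pairs of
  numbers.\<close>

definition up :: "nat \<Rightarrow> nat list \<Rightarrow> nat" where
  "up i w = length (filter (\<lambda>x. i \<le> x) w)"

lemma up_simps [simp]:
  "up i [] = 0" "up i (x # w) = (if i \<le> x then Suc (up i w) else up i w)"
  "up i (v @ w) = up i v + up i w"
  by (auto simp: up_def)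

lemma up_eq_size: "up i w = size (filter_mset (\<lambda>x. i \<le> x) (mset w))"
  by (induction w) auto

lemma count_list_conv_up: "count_list w i + up (Suc i) w = up i w"
  by (induction w) auto

definition lighter :: "nat list \<Rightarrow> nat list \<Rightarrow> bool" (infix "\<preceq>" 50) where
  "v \<preceq> w \<longleftrightarrow> (\<forall>i\<ge>1. up i v \<le> up i w) \<and> even (count_list v 0) = even (count_list w 0)"

lemma lighter_refl [simp]: "w \<preceq> w"
  by (simp add: lighter_def)

lemma lighter_trans [trans]: "u \<preceq> v \<Longrightarrow> v \<preceq> w \<Longrightarrow> u \<preceq> w"
  unfolding lighter_def using le_trans by fast

lemma lighter_append: "v \<preceq> w \<Longrightarrow> v' \<preceq> w' \<Longrightarrow> v @ v' \<preceq> w @ w'"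
  unfolding lighter_def by (simp add: add_mono)

lemma lighter_mset: "mset v = mset w \<Longrightarrow> v \<preceq> w"
  unfolding lighter_def up_eq_size count_mset[symmetric] by simp

text \<open>In the group of signed permutations, with coordinates counted from \<open>0\<close>,
  this word is the change of sign of coordinate \<open>q\<close> alone, obtained by conjugating the
  generator \<open>0\<close> upwards.\<close>

primrec flip :: "nat \<Rightarrow> nat list" where
  "flip 0 = [0]"
| "flip (Suc q) = Suc q # flip q @ [Suc q]"

lemma set_flip: "set (flip q) = {..q}"
  by (induction q) (auto simp: atMost_Suc)

lemma count_flip: "count_list (flip q) i = (if i = 0 then 1 else if i \<le> q then 2 else 0)"
  by (induction q) auto

section \<open>Functions on words that respect the type-B relations\<close>

locale braid_invariant =
  fixes n :: nat and F :: "nat list \<Rightarrow> 'a"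
  assumes square: "i < n \<Longrightarrow> F (u @ [i, i] @ v) = F (u @ v)"
    and far: "i + 2 \<le> j \<Longrightarrow> j < n \<Longrightarrow> F (u @ [i, j] @ v) = F (u @ [j, i] @ v)"
    and braid3: "1 \<le> i \<Longrightarrow> Suc i < n \<Longrightarrow>
      F (u @ [i, Suc i, i] @ v) = F (u @ [Suc i, i, Suc i] @ v)"
    and braid4: "1 < n \<Longrightarrow> F (u @ [0, 1, 0, 1] @ v) = F (u @ [1, 0, 1, 0] @ v)"
begin

text \<open>A congruence on words that takes the place of equality in the group: quantifying over
  both contexts allows a relation to be applied in the middle of a word although only values of
  \<open>F\<close> are known.\<close>

definition eqv :: "nat list \<Rightarrow> nat list \<Rightarrow> bool" (infix "\<approx>" 50) where
  "a \<approx> b \<longleftrightarrow> (\<forall>u v. F (u @ a @ v) = F (u @ b @ v))"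

lemma eqv_refl [simp]: "a \<approx> a"
  by (simp add: eqv_def)

lemma eqv_sym: "a \<approx> b \<Longrightarrow> b \<approx> a"
  by (simp add: eqv_def)

lemma eqv_trans [trans]: "a \<approx> b \<Longrightarrow> b \<approx> c \<Longrightarrow> a \<approx> c"
  by (simp add: eqv_def)

lemma eqv_ctx: "a \<approx> b \<Longrightarrow> u @ a @ v \<approx> u @ b @ v"
  unfolding eqv_def
proof (intro allI)
  fix x y
  assume "\<forall>u v. F (u @ a @ v) = F (u @ b @ v)"
  from this[rule_format, of "x @ u" "v @ y"]
  show "F (x @ (u @ a @ v) @ y) = F (x @ (u @ b @ v) @ y)" by simp
qed

lemma eqvD: "a \<approx> b \<Longrightarrow> F (u @ a @ v) = F (u @ b @ v)"
  by (simp add: eqv_def)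

lemma eqv_square: "i < n \<Longrightarrow> [i, i] \<approx> []"
  using square by (simp add: eqv_def)

lemma eqv_far: "i + 2 \<le> j \<Longrightarrow> j < n \<Longrightarrow> [i, j] \<approx> [j, i]"
  unfolding eqv_def by (intro allI far)

lemma eqv_braid3: "1 \<le> i \<Longrightarrow> Suc i < n \<Longrightarrow> [i, Suc i, i] \<approx> [Suc i, i, Suc i]"
  using braid3 by (simp add: eqv_def)

lemma eqv_braid4: "1 < n \<Longrightarrow> [0, 1, 0, 1] \<approx> [1, 0, 1, 0]"
  using braid4 by (simp add: eqv_def)

lemma eqv_commute_word:
  assumes "\<And>x. x \<in> set w \<Longrightarrow> [x] @ z \<approx> z @ [x]"
  shows "w @ z \<approx> z @ w"
  using assms
proof (induction w)
  case (Cons x w)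
  have "(x # w) @ z \<approx> [x] @ (z @ w)"
    using eqv_ctx[OF Cons.IH, of "[x]" "[]"] Cons.prems by simp
  also have "[x] @ (z @ w) \<approx> (z @ [x]) @ w"
    using eqv_ctx[OF Cons.prems[of x], of "[]" w] by simp
  finally show ?case by simp
qed simp

lemma eqv_commute_append:
  assumes "w @ y \<approx> y @ w" "w @ z \<approx> z @ w"
  shows "w @ (y @ z) \<approx> (y @ z) @ w"
proof -
  have "w @ (y @ z) \<approx> y @ w @ z" using eqv_ctx[OF assms(1), of "[]" z] by simp
  also have "\<dots> \<approx> y @ z @ w" using eqv_ctx[OF assms(2), of y "[]"] by simp
  finally show ?thesis by simp
qed

lemma eqv_far_word:
  assumes "\<And>x. x \<in> set w \<Longrightarrow> x + 2 \<le> q" "q < n"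
  shows "w @ [q] \<approx> [q] @ w"
  by (rule eqv_commute_word) (use assms eqv_far in auto)

text \<open>A sign change commutes with signed permutations of the lower coordinates. The real case
  is the letter just below the top one: with \<open>q = Suc p\<close>, the letters of
  \<open>flip p\<close> are at distance at least 2 from \<open>Suc q\<close>, so two 3-braid moves
  can be made on either side of it.\<close>

lemma flip_commute: "i < q \<Longrightarrow> q < n \<Longrightarrow> [i] @ flip q \<approx> flip q @ [i]"
proof (induction q arbitrary: i)
  case (Suc q)
  show ?case
  proof (cases "i = q")
    case False
    then have i: "i < q" using Suc.prems by simp
    have "[i] @ ([Suc q] @ flip q @ [Suc q]) \<approx> ([Suc q] @ flip q @ [Suc q]) @ [i]"
      by (intro eqv_commute_append Suc.IH) (use i Suc.prems eqv_far[of i "Suc q"] in auto)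
    then show ?thesis by simp
  next
    case True
    show ?thesis
    proof (cases q)
      case 0
      \<comment> \<open>Here \<open>flip 1 = [1, 0, 1]\<close>, and commuting it with
        \<open>0\<close> is the 4-braid relation itself.\<close>
      then show ?thesis using True Suc.prems eqv_braid4 by simp
    next
      case (Suc p)
      have *: "flip p @ [Suc q] \<approx> [Suc q] @ flip p"
        by (rule eqv_far_word) (use Suc.prems Suc in \<open>auto simp: set_flip\<close>)
      have "[q] @ flip (Suc q) \<approx> [q, Suc q, q] @ flip p @ [q, Suc q]"
        using Suc by simp
      also have "\<dots> \<approx> [Suc q, q, Suc q] @ flip p @ [q, Suc q]"
        using eqv_ctx[OF eqv_braid3[of q], of "[]" "flip p @ [q, Suc q]"] Suc Suc.prems by simp
      also have "\<dots> \<approx> [Suc q, q] @ flip p @ [Suc q, q, Suc q]"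
        using eqv_ctx[OF eqv_sym[OF *], of "[Suc q, q]" "[q, Suc q]"] by simp
      also have "\<dots> \<approx> [Suc q, q] @ flip p @ [q, Suc q, q]"
        using eqv_ctx[OF eqv_sym[OF eqv_braid3[of q]], of "[Suc q, q] @ flip p" "[]"] Suc Suc.prems
        by simp
      also have "\<dots> = flip (Suc q) @ [q]" using Suc by simp
      finally show ?thesis using True by simp
    qed
  qed
qed simp

lemma flip_commute_word: "set w \<subseteq> {..<q} \<Longrightarrow> q < n \<Longrightarrow> w @ flip q \<approx> flip q @ w"
  by (rule eqv_commute_word, rule flip_commute) auto

text \<open>The three double cosets of \<open>\<langle>s\<^sub>0, \<dots>, s\<^bsub>q-1\<^esub>\<rangle>\<close> in \<open>\<langle>s\<^sub>0, \<dots>, s\<^sub>q\<rangle>\<close>.\<close>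

definition coset_form :: "nat \<Rightarrow> nat list \<Rightarrow> bool" where
  "coset_form q w \<longleftrightarrow> set w \<subseteq> {..<q}
     \<or> 1 \<le> q \<and> (\<exists>a b. set a \<subseteq> {..<q} \<and> set b \<subseteq> {..<q} \<and> w = a @ [q] @ b)
     \<or> (\<exists>a. set a \<subseteq> {..<q} \<and> w = a @ flip q)"

lemma zero_word: "set w \<subseteq> {0} \<Longrightarrow> 0 < n \<Longrightarrow> \<exists>w'. w \<approx> w' \<and> w' \<preceq> w \<and> (w' = [] \<or> w' = [0])"
proof (induction w rule: length_induct)
  case (1 w)
  consider "w = []" | "w = [0]" | v where "w = 0 # 0 # v"
    using 1(2) by (cases w; cases "tl w") auto
  then show ?case
  proof cases
    case 3
    then have "length v < length w" "set v \<subseteq> {0}" using 1(2) by simp_all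
    then obtain w' where w': "v \<approx> w'" "w' \<preceq> v" "w' = [] \<or> w' = [0]"
      using 1(1) 1(3) by blast
    have "w \<approx> v" using eqv_ctx[OF eqv_square[of 0], of "[]" v] 3 1(3) by simp
    then have "w \<approx> w'" using w' eqv_trans by blast
    moreover have "v \<preceq> w" using 3 by (simp add: lighter_def)
    then have "w' \<preceq> w" using w' lighter_trans by blast
    ultimately show ?thesis using w' by blast
  qed (auto intro!: exI[of _ w])
qed

lemma set_below: "(q::nat) \<notin> set a \<Longrightarrow> set a \<subseteq> {..q} \<Longrightarrow> set a \<subseteq> {..<q}"
proof
  fix x
  assume "q \<notin> set a" "set a \<subseteq> {..q}" "x \<in> set a"
  then have "x \<le> q" "x \<noteq> q" by auto
  then show "x \<in> {..<q}" by simp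
qed

lemma split_first:
  assumes "(q::nat) \<in> set w" "set w \<subseteq> {..q}"
  obtains a d where "w = a @ [q] @ d" "set a \<subseteq> {..<q}" "set d \<subseteq> {..q}"
proof -
  obtain a d where *: "w = a @ q # d" "q \<notin> set a" using split_list_first[OF assms(1)] by blast
  have sub: "set a \<subseteq> {..q}" "set d \<subseteq> {..q}" using assms(2) unfolding *(1) by auto
  show ?thesis by (rule that[of a d]) (use *(1) set_below[OF *(2) sub(1)] sub(2) in auto)
qed

text \<open>Two consecutive occurrences of the top letter \<open>q = Suc p\<close> enclose a word in
  letters up to \<open>p\<close>. Its double coset one level lower tells which relation applies to
  the two occurrences, whence the outer induction on the level and the inner one on the number of
  top letters.\<close>

lemma double_coset: "set w \<subseteq> {..q} \<Longrightarrow> q < n \<Longrightarrow> \<exists>w'. w \<approx> w' \<and> w' \<preceq> w \<and> coset_form q w'"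
proof (induction q arbitrary: w)
  case 0
  then obtain w' where "w \<approx> w'" "w' \<preceq> w" "w' = [] \<or> w' = [0]"
    using zero_word[of w] by auto
  then show ?case unfolding coset_form_def by (intro exI[of _ w']) auto
next
  case (Suc p)
  define q where "q = Suc p"
  have q: "q < n" "1 \<le> q" "p < q" "p < n" using Suc.prems by (auto simp: q_def)
  have "\<exists>w'. w \<approx> w' \<and> w' \<preceq> w \<and> coset_form q w'" if "set w \<subseteq> {..q}" for w
    using that
  proof (induction "count_list w q" arbitrary: w rule: less_induct)
    case less
    have step: ?case if "w \<approx> v" "v \<preceq> w" "set v \<subseteq> {..q}" "count_list v q < count_list w q" for v
      using less.hyps[OF that(4,3)] that(1,2) eqv_trans lighter_trans by blast
    show ?case
    proof (cases "q \<in> set w")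
      case False
      have "set w \<subseteq> {..<q}" by (rule set_below[OF False less.prems])
      then show ?thesis unfolding coset_form_def by (intro exI[of _ w]) auto
    next
      case True
      then obtain a d' where w: "w = a @ [q] @ d'" and a: "set a \<subseteq> {..<q}" and d': "set d' \<subseteq> {..q}"
        using split_first less.prems by blast
      show ?thesis
      proof (cases "q \<in> set d'")
        case False
        have "set d' \<subseteq> {..<q}" by (rule set_below[OF False d'])
        then show ?thesis using w a q unfolding coset_form_def by (intro exI[of _ w]) auto
      next
        case True
        then obtain b d where d: "d' = b @ [q] @ d" "set b \<subseteq> {..<q}" "set d \<subseteq> {..q}"
          using split_first d' by blast
        have ca: "count_list a q = 0" "count_list b q = 0"
          using a d by (auto simp: count_list_0_iff)
        have "set b \<subseteq> {..p}" using d by (auto simp: q_def)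
        then obtain b' where b': "b \<approx> b'" "b' \<preceq> b" "coset_form p b'"
          using Suc.IH q by blast
        have w1: "w \<approx> a @ [q] @ b' @ [q] @ d"
          using eqv_ctx[OF b'(1), of "a @ [q]" "[q] @ d"] w d by simp
        have l1: "a @ [q] @ b' @ [q] @ d \<preceq> w"
          unfolding w d by (intro lighter_append lighter_refl b')
        from b'(3) consider (1) "set b' \<subseteq> {..<p}"
          | (2) b1 b2 where "1 \<le> p" "set b1 \<subseteq> {..<p}" "set b2 \<subseteq> {..<p}" "b' = b1 @ [p] @ b2"
          | (3) b1 where "set b1 \<subseteq> {..<p}" "b' = b1 @ flip p"
          unfolding coset_form_def by blast
        then show ?thesis
        proof cases
          case 1
          have c: "b' @ [q] \<approx> [q] @ b'" by (rule eqv_far_word) (use 1 q in \<open>auto simp: q_def\<close>)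
          have "a @ [q] @ b' @ [q] @ d \<approx> a @ [q, q] @ b' @ d"
            using eqv_ctx[OF c, of "a @ [q]" d] by simp
          also have "\<dots> \<approx> a @ b' @ d" using eqv_ctx[OF eqv_square[OF q(1)], of a "b' @ d"] by simp
          finally have e: "w \<approx> a @ b' @ d" using w1 eqv_trans by blast
          have l: "a @ b' @ d \<preceq> a @ [q] @ b' @ [q] @ d" using q by (auto simp: lighter_def)
          have cb: "count_list b' q = 0" using 1 q by (auto simp: count_list_0_iff)
          show ?thesis
            by (rule step[OF e lighter_trans[OF l l1]])
              (use 1 q a d w ca cb in \<open>auto simp: less_imp_le\<close>)
        next
          \<comment> \<open>After \<open>q\<close> has passed \<open>b1\<close> and
            \<open>b2\<close>, the factor \<open>q p q\<close> becomes \<open>p q p\<close>. One top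
            letter drops to \<open>p\<close> at equal length, which \<open>\<preceq>\<close> permits
            because it compares tail counts.\<close>
          case 2
          have c1: "b1 @ [q] \<approx> [q] @ b1" by (rule eqv_far_word) (use 2 q in \<open>auto simp: q_def\<close>)
          have c2: "b2 @ [q] \<approx> [q] @ b2" by (rule eqv_far_word) (use 2 q in \<open>auto simp: q_def\<close>)
          have "a @ [q] @ b' @ [q] @ d \<approx> a @ [q] @ b1 @ [p] @ ([q] @ b2) @ d"
            using eqv_ctx[OF c2, of "a @ [q] @ b1 @ [p]" d] 2 by simp
          also have "\<dots> \<approx> a @ (b1 @ [q]) @ [p] @ ([q] @ b2) @ d"
            using eqv_ctx[OF eqv_sym[OF c1], of a "[p] @ ([q] @ b2) @ d"] by simp
          also have "\<dots> \<approx> a @ b1 @ [p, q, p] @ b2 @ d"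
            using eqv_ctx[OF eqv_sym[OF eqv_braid3[of p]], of "a @ b1" "b2 @ d"] 2 q
            by (simp add: q_def)
          finally have e: "w \<approx> a @ b1 @ [p, q, p] @ b2 @ d" using w1 eqv_trans by blast
          have l: "a @ b1 @ [p, q, p] @ b2 @ d \<preceq> a @ [q] @ b' @ [q] @ d"
            using q 2 by (auto simp: lighter_def q_def)
          have cb: "count_list b1 q = 0" "count_list b2 q = 0"
            using 2 q by (auto simp: count_list_0_iff)
          show ?thesis
            by (rule step[OF e lighter_trans[OF l l1]])
              (use 2 q a d w ca cb in \<open>auto simp: less_imp_le\<close>)
        next
          \<comment> \<open>The two top letters close up around \<open>flip p\<close> to
            \<open>flip q\<close>, so nothing is gained yet. If no further \<open>q\<close> follows,
            this is already the third form; otherwise \<open>flip q @ [q]\<close> cancels to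
            \<open>[q] @ flip p\<close>.\<close>
          case 3
          have c1: "b1 @ [q] \<approx> [q] @ b1" by (rule eqv_far_word) (use 3 q in \<open>auto simp: q_def\<close>)
          have "a @ [q] @ b' @ [q] @ d \<approx> a @ b1 @ flip q @ d"
            using eqv_ctx[OF eqv_sym[OF c1], of a "flip p @ [q] @ d"] 3 by (simp add: q_def)
          then have e: "w \<approx> a @ b1 @ flip q @ d" using w1 eqv_trans by blast
          have l: "a @ b1 @ flip q @ d \<preceq> a @ [q] @ b' @ [q] @ d"
            using q 3 by (auto simp: lighter_def q_def)
          have cb: "count_list b1 q = 0" using 3 q by (auto simp: count_list_0_iff)
          have a': "set (a @ b1) \<subseteq> {..<q}" using a 3 by (auto simp: q_def)
          show ?thesis
          proof (cases "q \<in> set d")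
            case False
            have d0: "set d \<subseteq> {..<q}" by (rule set_below[OF False d(3)])
            have e2: "a @ b1 @ flip q @ d \<approx> a @ b1 @ d @ flip q"
              using eqv_ctx[OF eqv_sym[OF flip_commute_word[OF d0 q(1)]], of "a @ b1" "[]"] by simp
            have l2: "a @ b1 @ d @ flip q \<preceq> a @ b1 @ flip q @ d"
              by (rule lighter_mset) simp
            have "coset_form q (a @ b1 @ d @ flip q)"
              unfolding coset_form_def using a' d0
              by (intro disjI2 exI[of _ "a @ b1 @ d"]) auto
            moreover have "w \<approx> a @ b1 @ d @ flip q" using e e2 eqv_trans by blast
            moreover have "a @ b1 @ d @ flip q \<preceq> w" using l l1 l2 lighter_trans by blast
            ultimately show ?thesis by blast
          next
            case True
            then obtain d1 d2 where dd: "d = d1 @ [q] @ d2" "set d1 \<subseteq> {..<q}" "set d2 \<subseteq> {..q}"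
              using split_first d by blast
            have "a @ b1 @ flip q @ d \<approx> a @ b1 @ d1 @ flip q @ [q] @ d2"
              using eqv_ctx[OF eqv_sym[OF flip_commute_word[OF dd(2) q(1)]], of "a @ b1" "[q] @ d2"]
                dd by simp
            also have "\<dots> \<approx> a @ b1 @ d1 @ [q] @ flip p @ d2"
              using eqv_ctx[OF eqv_square[OF q(1)], of "a @ b1 @ d1 @ [q] @ flip p" d2]
              by (simp add: q_def)
            finally have e3: "w \<approx> a @ b1 @ d1 @ [q] @ flip p @ d2" using e eqv_trans by blast
            have l3: "a @ b1 @ d1 @ [q] @ flip p @ d2 \<preceq> a @ b1 @ flip q @ d"
              unfolding dd by (auto simp: lighter_def q_def)
            have cd: "count_list d1 q = 0" "count_list (flip p) q = 0"
              using dd by (auto simp: count_list_0_iff set_flip q_def)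
            show ?thesis
              by (rule step[OF e3 lighter_trans[OF l3 lighter_trans[OF l l1]]])
                (use 3 q a d dd w ca cb cd in \<open>auto simp: less_imp_le set_flip\<close>)
          qed
        qed
      qed
    qed
  qed
  then show ?case using Suc.prems by (simp add: q_def)
qed

end

text \<open>A signed composition is a list of blocks (size, is negative), the topmost block first.\<close>

definition total :: "(nat \<times> bool) list \<Rightarrow> nat" where
  "total \<kappa> = sum_list (map fst \<kappa>)"

lemma total_simps [simp]: "total [] = 0" "total ((l, e) # \<kappa>) = l + total \<kappa>"
  by (simp_all add: total_def)

definition composition :: "nat \<Rightarrow> (nat \<times> bool) list \<Rightarrow> bool" where
  "composition m \<kappa> \<longleftrightarrow> (\<forall>(l, e) \<in> set \<kappa>. 1 \<le> l) \<and> total \<kappa> = m"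

text \<open>As a signed permutation, a single cycle on the coordinates from \<open>q\<close> to
  \<open>q + l - 1\<close>, negative precisely when \<open>e\<close> holds.\<close>

definition block :: "nat \<Rightarrow> nat \<Rightarrow> bool \<Rightarrow> nat list" where
  "block q l e = (if e then flip q else []) @ [Suc q..<q + l]"

fun normal_word :: "(nat \<times> bool) list \<Rightarrow> nat list" where
  "normal_word [] = []"
| "normal_word ((l, e) # \<kappa>) = normal_word \<kappa> @ block (total \<kappa>) l e"

lemma composition_Nil [simp]: "composition m [] \<longleftrightarrow> m = 0"
  by (auto simp: composition_def)

lemma composition_Cons:
  "composition m ((l, e) # \<kappa>) \<longleftrightarrow> 1 \<le> l \<and> l \<le> m \<and> composition (m - l) \<kappa>"
  by (auto simp: composition_def)

lemma composition_total: "composition m \<kappa> \<Longrightarrow> total \<kappa> = m"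
  by (simp add: composition_def)

lemma set_normal_word: "composition m \<kappa> \<Longrightarrow> set (normal_word \<kappa>) \<subseteq> {..<m}"
proof (induction \<kappa> arbitrary: m rule: normal_word.induct)
  case (2 l e \<kappa>)
  then have "set (normal_word \<kappa>) \<subseteq> {..<m - l}" "1 \<le> l" "l \<le> m" "total \<kappa> = m - l"
    by (auto simp: composition_Cons composition_total)
  then show ?case by (auto simp: block_def set_flip)
qed simp

lemma count_list_upt: "count_list [a..<b] i = (if a \<le> i \<and> i < b then 1 else 0)"
  by (induction b) auto

lemma count_block:
  "count_list (block q l e) i =
     (if e then if i = 0 then 1 else if i \<le> q then 2 else 0 else 0) + (if q < i \<and> i < q + l then 1 else 0)"
  by (auto simp: block_def count_flip count_list_upt)

text \<open>The composition is read off from the top. Letters inside the top block occur exactly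
  once, since the lower blocks use smaller letters; the boundary letter \<open>m - l\<close> occurs
  twice below a negative block and never below a positive one. So the first letter from above with a
  multiplicity other than 1 gives size and sign. Only for \<open>m - l = 0\<close> does the sign
  have to come from the parity of the zeros.\<close>

lemma normal_word_inj:
  assumes "composition m \<kappa>" "composition m \<kappa>'"
    and "\<And>i. 1 \<le> i \<Longrightarrow> count_list (normal_word \<kappa>) i = count_list (normal_word \<kappa>') i"
    and "even (count_list (normal_word \<kappa>) 0) = even (count_list (normal_word \<kappa>') 0)"
  shows "\<kappa> = \<kappa>'"
  using assms
proof (induction \<kappa> arbitrary: m \<kappa>' rule: normal_word.induct)
  case 1
  then show ?case by (cases \<kappa>') (auto simp: composition_Cons)
next
  case (2 l e \<kappa>)
  then obtain l' e' \<kappa>0 where k': "\<kappa>' = (l', e') # \<kappa>0" by (cases \<kappa>') (auto simp: composition_Cons)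
  have c: "1 \<le> l" "l \<le> m" "composition (m - l) \<kappa>"
    and c': "1 \<le> l'" "l' \<le> m" "composition (m - l') \<kappa>0"
    using 2(2,3) k' by (auto simp: composition_Cons)
  have t: "total \<kappa> = m - l" "total \<kappa>0 = m - l'" using c c' composition_total by auto
  have z: "count_list (normal_word \<kappa>) i = 0" if "m - l \<le> i" for i
    using set_normal_word[OF c(3)] that by (auto simp: count_list_0_iff)
  have z': "count_list (normal_word \<kappa>0) i = 0" if "m - l' \<le> i" for i
    using set_normal_word[OF c'(3)] that by (auto simp: count_list_0_iff)
  have eq: "count_list (normal_word \<kappa>) i + count_list (block (m - l) l e) i =
    count_list (normal_word \<kappa>0) i + count_list (block (m - l') l' e') i" if "1 \<le> i" for i
    using 2(4)[OF that] k' t by simp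
  have "\<not> m - l < m - l'"
  proof
    assume a: "m - l < m - l'"
    then have "count_list (block (m - l) l e) (m - l') = count_list (block (m - l') l' e') (m - l')"
      using eq[of "m - l'"] z[of "m - l'"] z'[of "m - l'"] by simp
    then show False using a c c' by (auto simp: count_block split: if_splits)
  qed
  moreover have "\<not> m - l' < m - l"
  proof
    assume a: "m - l' < m - l"
    then have "count_list (block (m - l) l e) (m - l) = count_list (block (m - l') l' e') (m - l)"
      using eq[of "m - l"] z[of "m - l"] z'[of "m - l"] by simp
    then show False using a c c' by (auto simp: count_block split: if_splits)
  qed
  ultimately have l: "l = l'" using c(2) c'(2) by linarith
  have e: "e = e'"
  proof (cases "m - l = 0")
    case True
    then have "\<kappa> = []" "\<kappa>0 = []" using c c' l
      by (cases \<kappa>; cases \<kappa>0; auto simp: composition_Cons)+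
    then show ?thesis using 2(5) k' l by (auto simp: count_block split: if_splits)
  next
    case False
    then have "1 \<le> m - l" by simp
    then show ?thesis using eq[of "m - l"] z[of "m - l"] z'[of "m - l"] l False
      by (simp add: count_block split: if_splits)
  qed
  have "\<kappa> = \<kappa>0"
    by (rule "2.IH"[OF c(3)]) (use c' l e eq 2(5) k' t in auto)
  then show ?case using k' l e by simp
qed

section \<open>Conjugation to standard words\<close>

locale braid_trace = braid_invariant +
  assumes cyclic: "F (u @ v) = F (v @ u)"
begin

text \<open>The suffix \<open>z\<close> carries the blocks that are already split off. It commutes
  with all letters still in play, so that a rotation of the whole word acts as a conjugation of
  \<open>w\<close> alone.\<close>

lemma conjugate_normal_word:
  assumes "set w \<subseteq> {..<m}" "m \<le> n" "\<And>i. i < m \<Longrightarrow> [i] @ z \<approx> z @ [i]"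
  shows "\<exists>\<kappa>. composition m \<kappa> \<and> F (w @ z) = F (normal_word \<kappa> @ z) \<and> normal_word \<kappa> \<preceq> w"
  using assms
proof (induction m arbitrary: w z rule: less_induct)
  case (less m)
  \<comment> \<open>The top block grows downwards: \<open>[Suc q..<m]\<close> is the part found so
    far. The double coset of the remaining word decides whether the block ends here as a positive
    one, absorbs the letter \<open>q\<close>, or ends as a negative one.\<close>
  have *: "\<exists>\<kappa>. composition m \<kappa> \<and> F (w @ [Suc q..<m] @ z) = F (normal_word \<kappa> @ z)
      \<and> normal_word \<kappa> \<preceq> w @ [Suc q..<m]" if "set w \<subseteq> {..q}" "q < m" for w q
    using that
  proof (induction q arbitrary: w rule: less_induct)
    case q: (less q)
    let ?Y = "[Suc q..<m]"
    have qn: "q < n" using q.prems less.prems by simp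
    obtain w' where w': "w \<approx> w'" "w' \<preceq> w" "coset_form q w'"
      using double_coset[OF q.prems(1) qn] by blast
    have Fw: "F (w @ ?Y @ z) = F (w' @ ?Y @ z)" using eqvD[OF w'(1), of "[]"] by simp
    have Yz: "[i] @ ?Y @ z \<approx> (?Y @ z) @ [i]" if "i < q" for i
    proof (rule eqv_commute_append)
      show "[i] @ ?Y \<approx> ?Y @ [i]"
        by (rule eqv_sym, rule eqv_commute_word, rule eqv_sym)
          (use that less.prems(2) eqv_far in auto)
      show "[i] @ z \<approx> z @ [i]" using less.prems(3) that q.prems by simp
    qed
    from w'(3) consider (1) "set w' \<subseteq> {..<q}"
      | (2) a b where "1 \<le> q" "set a \<subseteq> {..<q}" "set b \<subseteq> {..<q}" "w' = a @ [q] @ b"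
      | (3) a where "set a \<subseteq> {..<q}" "w' = a @ flip q"
      unfolding coset_form_def by blast
    then show ?case
    proof cases
      case 1
      obtain \<kappa> where k: "composition q \<kappa>" "F (w' @ ?Y @ z) = F (normal_word \<kappa> @ ?Y @ z)"
        "normal_word \<kappa> \<preceq> w'"
        using less.IH[OF q.prems(2) 1, of "?Y @ z"] Yz less.prems(2) q.prems by auto
      have nw: "normal_word ((m - q, False) # \<kappa>) = normal_word \<kappa> @ ?Y"
        using composition_total[OF k(1)] q.prems by (simp add: block_def)
      have "normal_word \<kappa> @ ?Y \<preceq> w @ ?Y"
        using k(3) w'(2) lighter_trans lighter_append lighter_refl by blast
      then show ?thesis using k q.prems Fw
        by (intro exI[of _ "(m - q, False) # \<kappa>"]) (simp add: nw composition_Cons del: normal_word.simps)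
    next
      case 2
      have bz: "b @ ?Y @ z \<approx> (?Y @ z) @ b"
        by (rule eqv_commute_word) (use 2 Yz in auto)
      have Y: "[q..<m] = q # ?Y" using q.prems by (simp add: upt_conv_Cons)
      \<comment> \<open>\<open>b\<close> passes the suffix and is rotated to the front. This merges
        both sides of \<open>q\<close> into \<open>b @ a\<close>, one level lower, and attaches
        \<open>q\<close> to the block.\<close>
      have "F (w' @ ?Y @ z) = F (a @ [q] @ (?Y @ z) @ b)"
        using eqvD[OF bz, of "a @ [q]" "[]"] 2 by simp
      also have "\<dots> = F ((b @ a) @ [Suc (q - 1)..<m] @ z)"
        using cyclic[of "a @ [q] @ ?Y @ z" b] 2(1) Y by simp
      finally have e: "F (w' @ ?Y @ z) = F ((b @ a) @ [Suc (q - 1)..<m] @ z)" .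
      have "set (b @ a) \<subseteq> {..q - 1}" using 2 by auto
      then obtain \<kappa> where k: "composition m \<kappa>"
        "F ((b @ a) @ [Suc (q - 1)..<m] @ z) = F (normal_word \<kappa> @ z)"
        "normal_word \<kappa> \<preceq> (b @ a) @ [Suc (q - 1)..<m]"
        using q.IH[of "q - 1" "b @ a"] 2(1) q.prems by (metis diff_less less_imp_diff_less less_one nat_less_le not_one_le_zero zero_less_iff_neq_zero)
      have "(b @ a) @ [Suc (q - 1)..<m] \<preceq> w' @ ?Y"
        using 2 Y by (intro lighter_mset) simp
      moreover have "w' @ ?Y \<preceq> w @ ?Y" using w'(2) by (intro lighter_append) auto
      ultimately have "normal_word \<kappa> \<preceq> w @ ?Y" using k(3) lighter_trans by blast
      then show ?thesis using k e Fw by auto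
    next
      case 3
      have comm: "[i] @ flip q @ ?Y @ z \<approx> (flip q @ ?Y @ z) @ [i]" if "i < q" for i
        by (rule eqv_commute_append) (use that qn flip_commute Yz in auto)
      obtain \<kappa> where k: "composition q \<kappa>"
        "F (a @ flip q @ ?Y @ z) = F (normal_word \<kappa> @ flip q @ ?Y @ z)" "normal_word \<kappa> \<preceq> a"
        using less.IH[OF q.prems(2) 3(1), of "flip q @ ?Y @ z"] comm less.prems(2) q.prems by auto
      have nw: "normal_word ((m - q, True) # \<kappa>) = normal_word \<kappa> @ flip q @ ?Y"
        using composition_total[OF k(1)] q.prems by (simp add: block_def)
      have "normal_word \<kappa> @ flip q @ ?Y \<preceq> w' @ ?Y"
        using lighter_append[OF k(3) lighter_refl, of "flip q @ ?Y"] 3 by simp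
      moreover have "w' @ ?Y \<preceq> w @ ?Y" using w'(2) by (intro lighter_append) auto
      ultimately have "normal_word \<kappa> @ flip q @ ?Y \<preceq> w @ ?Y" using lighter_trans by blast
      then show ?thesis using k q.prems Fw 3(2)
        by (intro exI[of _ "(m - q, True) # \<kappa>"]) (simp add: nw composition_Cons del: normal_word.simps)
    qed
  qed
  show ?case
  proof (cases m)
    case 0
    then show ?thesis using less.prems by (intro exI[of _ "[]"]) auto
  next
    case (Suc q)
    then show ?thesis using *[of w q] less.prems by (simp add: lessThan_Suc_atMost)
  qed
qed


end

section \<open>Triangular systems of content sums\<close>

lemma finite_words: "finite {w. set w \<subseteq> A \<and> mset w = C}"
  by (rule finite_subset[OF _ finite_lists_length_eq[of "set_mset C" "size C"]])
    (auto simp flip: size_mset)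

text \<open>In the equation for \<open>k\<close> each word contributes either
  \<open>\<phi> (r k)\<close> or a value already known to vanish. The coefficient left over counts
  words and includes \<open>r k\<close> itself, so it is a positive integer, nonzero in
  characteristic 0.\<close>

lemma triangular_vanish:
  fixes \<phi> :: "'w \<Rightarrow> 'c :: field_char_0" and \<mu> :: "'k \<Rightarrow> nat"
  assumes fin: "\<And>k. k \<in> K \<Longrightarrow> finite (S k)"
    and rep: "\<And>k. k \<in> K \<Longrightarrow> r k \<in> S k"
    and sum0: "\<And>k. k \<in> K \<Longrightarrow> (\<Sum>w\<in>S k. \<phi> w) = 0"
    and alt: "\<And>k w. k \<in> K \<Longrightarrow> w \<in> S k \<Longrightarrow>
      \<phi> w = \<phi> (r k) \<or> (\<exists>k'\<in>K. \<mu> k' < \<mu> k \<and> \<phi> w = \<phi> (r k'))"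
    and k: "k \<in> K"
  shows "\<phi> (r k) = 0"
  using k
proof (induction "\<mu> k" arbitrary: k rule: less_induct)
  case less
  have "\<phi> w = 0 \<or> \<phi> w = \<phi> (r k)" if "w \<in> S k" for w
    using alt[OF less.prems that] less.hyps by auto
  then have "(\<Sum>w\<in>S k. \<phi> w) = (\<Sum>w\<in>S k. if \<phi> w = \<phi> (r k) then \<phi> (r k) else 0)"
    by (intro sum.cong) auto
  also have "\<dots> = of_nat (card {w\<in>S k. \<phi> w = \<phi> (r k)}) * \<phi> (r k)"
    using fin[OF less.prems] by (simp flip: sum.inter_filter)
  finally have "of_nat (card {w\<in>S k. \<phi> w = \<phi> (r k)}) * \<phi> (r k) = 0"
    using sum0[OF less.prems] by simp
  moreover have "card {w\<in>S k. \<phi> w = \<phi> (r k)} \<noteq> 0"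
    using rep[OF less.prems] fin[OF less.prems] by auto
  ultimately show ?case by simp
qed

definition weight :: "nat \<Rightarrow> nat list \<Rightarrow> nat" where
  "weight n w = (\<Sum>i=1..n. up i w)"

text \<open>The weight adds up all tail counts that can be nonzero. A lighter standard word of no
  smaller weight thus has the same tail counts, hence the same multiplicities of nonzero letters and
  the same parity of zeros, and these determine the composition.\<close>

lemma lighter_normal_word:
  assumes "composition n \<kappa>" "composition n \<kappa>'" "normal_word \<kappa>' \<preceq> w"
    and "\<And>i. 1 \<le> i \<Longrightarrow> up i w = up i (normal_word \<kappa>)"
    and "even (count_list w 0) = even (count_list (normal_word \<kappa>) 0)"
  shows "\<kappa>' = \<kappa> \<or> weight n (normal_word \<kappa>') < weight n (normal_word \<kappa>)"
proof (rule disjCI)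
  assume not_less: "\<not> weight n (normal_word \<kappa>') < weight n (normal_word \<kappa>)"
  have le: "up i (normal_word \<kappa>') \<le> up i (normal_word \<kappa>)" if "1 \<le> i" for i
    using assms(3,4) that by (auto simp: lighter_def)
  have big: "up i (normal_word \<kappa>) = 0" "up i (normal_word \<kappa>') = 0" if "n < i" for i
    using set_normal_word[OF assms(1)] set_normal_word[OF assms(2)] that
    by (auto simp: up_def filter_empty_conv subset_iff not_le)
  have "up i (normal_word \<kappa>') = up i (normal_word \<kappa>)" if i: "1 \<le> i" for i
  proof (rule ccontr)
    assume ne: "up i (normal_word \<kappa>') \<noteq> up i (normal_word \<kappa>)"
    then have "i \<le> n" using big[of i] by force
    then have "weight n (normal_word \<kappa>') < weight n (normal_word \<kappa>)"
      unfolding weight_def using le i ne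
      by (intro sum_strict_mono_ex1) (auto intro!: bexI[of _ i] simp: order.strict_iff_order)
    then show False using not_less by simp
  qed
  then have "count_list (normal_word \<kappa>') i = count_list (normal_word \<kappa>) i" if "1 \<le> i" for i
    using count_list_conv_up[of _ i] that by (metis add_right_cancel le_SucI)
  moreover have "even (count_list (normal_word \<kappa>') 0) = even (count_list (normal_word \<kappa>) 0)"
    using assms(3,5) by (auto simp: lighter_def)
  ultimately show "\<kappa>' = \<kappa>" using normal_word_inj assms(1,2) by blast
qed

lemma braid_trace_vanish:
  fixes F :: "nat list \<Rightarrow> complex"
  assumes "braid_trace n F"
    and sum0: "\<And>C. (\<Sum>w | set w \<subseteq> {..<n} \<and> mset w = C. F w) = 0"
    and w: "set w \<subseteq> {..<n}"
  shows "F w = 0"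
proof -
  interpret braid_trace n F by fact
  have conj: "\<exists>\<kappa>. composition n \<kappa> \<and> F v = F (normal_word \<kappa>) \<and> normal_word \<kappa> \<preceq> v"
    if "set v \<subseteq> {..<n}" for v
    using conjugate_normal_word[OF that, of "[]"] by simp
  have zero: "F (normal_word \<kappa>) = 0" if "\<kappa> \<in> Collect (composition n)" for \<kappa>
  proof (rule triangular_vanish[where K = "Collect (composition n)" and r = normal_word
        and S = "\<lambda>\<kappa>. {w. set w \<subseteq> {..<n} \<and> mset w = mset (normal_word \<kappa>)}"
        and \<mu> = "\<lambda>\<kappa>. weight n (normal_word \<kappa>)", OF finite_words])
    fix \<kappa> v
    assume k: "\<kappa> \<in> Collect (composition n)"
      and v: "v \<in> {w. set w \<subseteq> {..<n} \<and> mset w = mset (normal_word \<kappa>)}"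
    then obtain \<kappa>' where k': "composition n \<kappa>'" "F v = F (normal_word \<kappa>')" "normal_word \<kappa>' \<preceq> v"
      using conj by blast
    have "\<kappa>' = \<kappa> \<or> weight n (normal_word \<kappa>') < weight n (normal_word \<kappa>)"
      by (rule lighter_normal_word[OF _ k'(1,3)])
        (use k v in \<open>auto simp: up_eq_size simp flip: count_mset\<close>)
    then show "F v = F (normal_word \<kappa>) \<or> (\<exists>k'\<in>Collect (composition n).
        weight n (normal_word k') < weight n (normal_word \<kappa>) \<and> F v = F (normal_word k'))"
      using k' by auto
  qed (use that set_normal_word sum0 in auto)
  then show ?thesis using conj[OF w] by auto
qed

section \<open>Commuting factors of standard words\<close>

context braid_invariant begin

lemma block_commute:
  assumes "set w \<subseteq> {..<q}" "q + l \<le> n" "1 \<le> l"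
  shows "w @ block q l e \<approx> block q l e @ w"
proof (rule eqv_commute_word)
  fix x assume "x \<in> set w"
  then have x: "x < q" using assms by auto
  have "[x] @ [Suc q..<q + l] \<approx> [Suc q..<q + l] @ [x]"
    by (rule eqv_sym, rule eqv_commute_word, rule eqv_sym) (use x assms eqv_far in auto)
  moreover have "[x] @ (if e then flip q else []) \<approx> (if e then flip q else []) @ [x]"
    using flip_commute[OF x] assms by simp
  ultimately show "[x] @ block q l e \<approx> block q l e @ [x]"
    unfolding block_def using eqv_commute_append by blast
qed

text \<open>The factor \<open>x\<close> is the topmost negative block. It commutes with the blocks
  below it as a signed cycle on other coordinates, and with the positive blocks above it because
  their letters are at distance at least 2. The letter \<open>0\<close> occurs in it exactly
  once.\<close>

lemma odd_factor:
  assumes "composition m \<kappa>" "m \<le> n" "\<exists>l. (l, True) \<in> set \<kappa>"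
  shows "\<exists>x y. set x \<subseteq> {..<m} \<and> set y \<subseteq> {..<m} \<and> normal_word \<kappa> \<approx> x @ y \<and> x @ y \<approx> y @ x
    \<and> odd (count_list x 0) \<and> count_list (normal_word \<kappa>) 0 = count_list (x @ y) 0"
  using assms
proof (induction \<kappa> arbitrary: m rule: normal_word.induct)
  case (2 l e \<kappa>)
  define q where "q = total \<kappa>"
  have c: "composition q \<kappa>" "1 \<le> l" "q + l = m"
    using 2(2) by (auto simp: composition_Cons composition_total q_def)
  have nw: "set (normal_word \<kappa>) \<subseteq> {..<q}" by (rule set_normal_word[OF c(1)])
  have setB: "set (block q l e) \<subseteq> {..<m}" using c by (auto simp: block_def set_flip)
  show ?case
  proof (cases e)
    case True
    have comm: "normal_word \<kappa> @ block q l e \<approx> block q l e @ normal_word \<kappa>"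
      by (rule block_commute) (use nw c 2(3) in auto)
    show ?thesis
      by (rule exI[of _ "block q l e"], rule exI[of _ "normal_word \<kappa>"])
        (use True comm eqv_sym[OF comm] setB nw c in
          \<open>auto simp: count_block simp flip: q_def\<close>)
  next
    case False
    then have "\<exists>l. (l, True) \<in> set \<kappa>" using 2(4) by auto
    then obtain x y where xy: "set x \<subseteq> {..<q}" "set y \<subseteq> {..<q}" "normal_word \<kappa> \<approx> x @ y"
      "x @ y \<approx> y @ x" "odd (count_list x 0)" "count_list (normal_word \<kappa>) 0 = count_list (x @ y) 0"
      using 2(1)[OF c(1)] c 2(3) by auto
    have xB: "x @ block q l e \<approx> block q l e @ x"
      by (rule block_commute) (use xy c 2(3) in auto)
    have 1: "normal_word ((l, e) # \<kappa>) \<approx> x @ (y @ block q l e)"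
      using eqv_ctx[OF xy(3), of "[]" "block q l e"] by (simp add: q_def)
    have 2: "x @ (y @ block q l e) \<approx> (y @ block q l e) @ x"
      by (rule eqv_commute_append[OF xy(4) xB])
    show ?thesis
      by (rule exI[of _ x], rule exI[of _ "y @ block q l e"])
        (use 1 2 xy setB c in \<open>auto simp flip: q_def\<close>)
  qed
qed simp

end

section \<open>Words in type D\<close>

text \<open>Type \<open>D\<close> as the even subsystem of type \<open>B\<close>: the letter \<open>0\<close> of a type-\<open>D\<close> word is
  the fork generator \<open>s\<^sub>0 s\<^sub>1 s\<^sub>0\<close>, and conjugation by \<open>s\<^sub>0\<close> exchanges the letters \<open>0\<close> and \<open>1\<close>.\<close>

definition swap01 :: "nat \<Rightarrow> nat" where
  "swap01 i = (if i = 0 then 1 else if i = 1 then 0 else i)"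

lemma swap01_simps [simp]: "swap01 0 = 1" "swap01 (Suc 0) = 0" "2 \<le> i \<Longrightarrow> swap01 i = i"
  "swap01 (swap01 i) = i"
  by (auto simp: swap01_def)

lemma swap01_comp [simp]: "swap01 \<circ> swap01 = id"
  by (simp add: fun_eq_iff)

lemma map_swap01_inverse [simp]: "map swap01 (map swap01 w) = w"
  by simp

text \<open>Moving every \<open>s\<^sub>0\<close> to the right end by
  \<open>s\<^sub>0 w = (s\<^sub>0 w s\<^sub>0) s\<^sub>0\<close>, a type-B word becomes the type-D
  word \<open>untwist w\<close> followed by a power of \<open>s\<^sub>0\<close>, which is dropped.
  On even words this is the identification with elements of the type-D subgroup, and
  \<open>lift\<close> goes back.\<close>

fun untwist :: "nat list \<Rightarrow> nat list" where
  "untwist [] = []"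
| "untwist (0 # w) = map swap01 (untwist w)"
| "untwist (Suc i # w) = Suc i # untwist w"

fun lift :: "nat list \<Rightarrow> nat list" where
  "lift [] = []"
| "lift (0 # w) = 0 # 1 # 0 # lift w"
| "lift (Suc i # w) = Suc i # lift w"

lemma untwist_lift [simp]: "untwist (lift w) = w"
  by (induction w rule: lift.induct) auto

lemma even_lift [simp]: "even (count_list (lift w) 0)"
  by (induction w rule: lift.induct) auto

lemma set_lift: "1 < n \<Longrightarrow> set w \<subseteq> {..<n} \<Longrightarrow> set (lift w) \<subseteq> {..<n}"
  by (induction w rule: lift.induct) auto

lemma set_swap01: "1 < n \<Longrightarrow> set w \<subseteq> {..<n} \<Longrightarrow> set (map swap01 w) \<subseteq> {..<n}"
  by (auto simp: swap01_def)

lemma set_untwist: "1 < n \<Longrightarrow> set w \<subseteq> {..<n} \<Longrightarrow> set (untwist w) \<subseteq> {..<n}"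
proof (induction w rule: untwist.induct)
  case (2 w)
  then have "set (untwist w) \<subseteq> {..<n}" by simp
  then show ?case using set_swap01[OF 2(2)] by simp
qed auto

lemma untwist_append:
  "untwist (u @ v) = untwist u @ (if even (count_list u 0) then untwist v else map swap01 (untwist v))"
  by (induction u rule: untwist.induct) auto

lemma untwist_no_zero: "0 \<notin> set w \<Longrightarrow> untwist w = w"
  by (induction w rule: untwist.induct) auto

lemma up_map_swap01: "2 \<le> i \<Longrightarrow> up i (map swap01 w) = up i w"
  by (induction w) (auto simp: swap01_def)

lemma up_untwist: "2 \<le> i \<Longrightarrow> up i (untwist w) = up i w"
  by (induction w rule: untwist.induct) (auto simp: up_map_swap01)

lemma up_one_untwist: "up (Suc 0) w = length (untwist w)"
  by (induction w rule: untwist.induct) auto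

text \<open>\<open>untwist\<close> loses the zeros and may exchange \<open>0\<close> and
  \<open>1\<close> among the letters it keeps. Thus its length is the number of nonzero letters of
  the type-B word, and letters from 2 on keep their multiplicities; the number of zeros is not
  recoverable.\<close>

lemma up_lift:
  assumes "mset w = mset (untwist v)" "1 \<le> i"
  shows "up i (lift w) = up i v"
proof (cases "i = 1")
  case True
  then show ?thesis using up_one_untwist[of "lift w"] up_one_untwist[of v] mset_eq_length[OF assms(1)]
    by simp
next
  case False
  then have i: "2 \<le> i" using assms by simp
  have "up i (lift w) = up i w" using up_untwist[OF i, of "lift w"] by simp
  also have "\<dots> = up i (untwist v)" by (simp add: up_eq_size assms)
  finally show ?thesis using up_untwist[OF i] by simp
qed

section \<open>Class functions in type D as functions on type-B words\<close>

locale fork_trace =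
  fixes n :: nat and F :: "nat list \<Rightarrow> complex"
  assumes n: "2 < n"
    and square: "i < n \<Longrightarrow> F (u @ [i, i] @ v) = F (u @ v)"
    and far: "1 \<le> i \<Longrightarrow> i + 2 \<le> j \<Longrightarrow> j < n \<Longrightarrow> F (u @ [i, j] @ v) = F (u @ [j, i] @ v)"
    and braid: "1 \<le> i \<Longrightarrow> Suc i < n \<Longrightarrow>
      F (u @ [i, Suc i, i] @ v) = F (u @ [Suc i, i, Suc i] @ v)"
    and far0: "3 \<le> j \<Longrightarrow> j < n \<Longrightarrow> F (u @ [0, j] @ v) = F (u @ [j, 0] @ v)"
    and far01: "F (u @ [0, 1] @ v) = F (u @ [1, 0] @ v)"
    and braid02: "F (u @ [0, 2, 0] @ v) = F (u @ [2, 0, 2] @ v)"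
    and cyclic: "F (u @ v) = F (v @ u)"
begin

text \<open>A prefix with an odd number of zeros applies \<open>swap01\<close> to all that follows.
  Invariance under a relation in every context therefore concerns both values at once, and the
  ordered pair satisfies all type-B relations.\<close>

definition twins :: "nat list \<Rightarrow> complex \<times> complex" where
  "twins w = (F (untwist w), F (map swap01 (untwist w)))"

text \<open>Conjugation by an odd word exchanges the two values, so only the unordered pair survives
  rotation. Odd words lie outside the type-D subgroup and receive a constant.\<close>

definition twin_mset :: "nat list \<Rightarrow> complex multiset" where
  "twin_mset w = (if even (count_list w 0)
     then {# F (untwist w), F (map swap01 (untwist w)) #} else {#})"

lemma twins_transport:
  assumes "even (count_list r 0) = even (count_list r' 0)"
    and "\<And>u v. F (u @ untwist r @ v) = F (u @ untwist r' @ v)"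
    and "\<And>u v. F (u @ map swap01 (untwist r) @ v) = F (u @ map swap01 (untwist r') @ v)"
  shows "twins (u @ r @ v) = twins (u @ r' @ v)"
  unfolding twins_def untwist_append using assms by simp

sublocale twins: braid_invariant n twins
proof
  fix i j :: nat and u v
  show "twins (u @ [i, i] @ v) = twins (u @ v)" if "i < n"
  proof -
    have "twins (u @ [i, i] @ v) = twins (u @ [] @ v)"
    proof (rule twins_transport)
      show "F (u @ map swap01 (untwist [i, i]) @ v) = F (u @ map swap01 (untwist []) @ v)" for u v
        using square[of "swap01 i" u v] that n by (cases i) (auto simp: swap01_def split: if_splits)
      show "F (u @ untwist [i, i] @ v) = F (u @ untwist [] @ v)" for u v
        using square[OF that, of u v] by (cases i) auto
    qed auto
    then show ?thesis by simp
  qed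
  show "twins (u @ [i, j] @ v) = twins (u @ [j, i] @ v)" if ij: "i + 2 \<le> j" "j < n"
  proof (rule twins_transport)
    obtain j' where j': "j = Suc (Suc j')" using ij by (metis add_2_eq_Suc' less_eqE plus_nat.simps(2))
    have cs: "i = 0 \<or> i = 1 \<or> (\<exists>i'. i = Suc (Suc i'))" by (metis One_nat_def not0_implies_Suc)
    show "F (u @ untwist [i, j] @ v) = F (u @ untwist [j, i] @ v)" for u v
      using far[of i j u v] ij j' by (cases i) (auto simp: swap01_def)
    show "F (u @ map swap01 (untwist [i, j]) @ v) = F (u @ map swap01 (untwist [j, i]) @ v)" for u v
      using cs far[of i j u v] far0[of j u v] ij j' by (elim disjE exE) (auto simp: swap01_def)
  qed auto
  show "twins (u @ [i, Suc i, i] @ v) = twins (u @ [Suc i, i, Suc i] @ v)" if i: "1 \<le> i" "Suc i < n"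
  proof (rule twins_transport)
    show "F (u @ untwist [i, Suc i, i] @ v) = F (u @ untwist [Suc i, i, Suc i] @ v)" for u v
      using braid[of i u v] i by (cases i) auto
    show "F (u @ map swap01 (untwist [i, Suc i, i]) @ v) = F (u @ map swap01 (untwist [Suc i, i, Suc i]) @ v)"
      for u v
      using braid[of i u v] braid02[of u v] i
      by (cases i; cases "i = 1") (auto simp: swap01_def numeral_2_eq_2)
  qed (use i in auto)
  show "twins (u @ [0, 1, 0, 1] @ v) = twins (u @ [1, 0, 1, 0] @ v)"
    by (rule twins_transport) (use far01 in \<open>auto simp: swap01_def\<close>)
qed

lemma twin_mset_twins: "even (count_list v 0) = even (count_list w 0) \<Longrightarrow> twins v = twins w \<Longrightarrow>
    twin_mset v = twin_mset w"
  by (auto simp: twin_mset_def twins_def)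

sublocale twin: braid_trace n twin_mset
proof
  fix i j :: nat and u v
  show "twin_mset (u @ [i, i] @ v) = twin_mset (u @ v)" if "i < n"
    by (rule twin_mset_twins[OF _ twins.square[OF that]]) auto
  show "twin_mset (u @ [i, j] @ v) = twin_mset (u @ [j, i] @ v)" if "i + 2 \<le> j" "j < n"
    by (rule twin_mset_twins[OF _ twins.far[OF that]]) auto
  show "twin_mset (u @ [i, Suc i, i] @ v) = twin_mset (u @ [Suc i, i, Suc i] @ v)"
    if "1 \<le> i" "Suc i < n"
    by (rule twin_mset_twins[OF _ twins.braid3[OF that]]) (use that in auto)
  show "twin_mset (u @ [0, 1, 0, 1] @ v) = twin_mset (u @ [1, 0, 1, 0] @ v)" if "1 < n"
    by (rule twin_mset_twins[OF _ twins.braid4[OF that]]) auto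
  show "twin_mset (u @ v) = twin_mset (v @ u)"
  proof (cases "even (count_list u 0)")
    case True
    then show ?thesis using cyclic[of "untwist u" "untwist v"]
        cyclic[of "map swap01 (untwist u)" "map swap01 (untwist v)"]
      by (simp add: twin_mset_def untwist_append)
  next
    case False
    then show ?thesis using cyclic[of "untwist u" "map swap01 (untwist v)"]
        cyclic[of "map swap01 (untwist u)" "untwist v"]
      by (simp add: twin_mset_def untwist_append)
  qed
qed

text \<open>Both commuting factors are odd. Rotating \<open>x @ y\<close> into \<open>y @ x\<close>
  exchanges the two values, whereas commuting the factors preserves each of them.\<close>

lemma twins_odd_eq:
  assumes c: "composition n \<kappa>" and e: "even (count_list (normal_word \<kappa>) 0)"
    and "\<exists>l. (l, True) \<in> set \<kappa>"
  shows "F (untwist (normal_word \<kappa>)) = F (map swap01 (untwist (normal_word \<kappa>)))"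
proof -
  obtain x y where xy: "twins.eqv (normal_word \<kappa>) (x @ y)" "twins.eqv (x @ y) (y @ x)"
    "odd (count_list x 0)" "count_list (normal_word \<kappa>) 0 = count_list (x @ y) 0"
    using twins.odd_factor[OF c _ assms(3)] by auto
  have y: "odd (count_list y 0)" using xy e by simp
  have t: "twins (normal_word \<kappa>) = twins (x @ y)" "twins (x @ y) = twins (y @ x)"
    using twins.eqvD[OF xy(1), of "[]" "[]"] twins.eqvD[OF xy(2), of "[]" "[]"] by auto
  have "F (untwist (y @ x)) = F (map swap01 (untwist (x @ y)))"
    using cyclic[of "untwist y" "map swap01 (untwist x)"] xy(3) y by (simp add: untwist_append)
  then show ?thesis using t by (simp add: twins_def)
qed

lemma normal_word_unsigned:
  "\<nexists>l. (l, True) \<in> set \<kappa> \<Longrightarrow> 0 \<notin> set (normal_word \<kappa>)"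
  by (induction \<kappa> rule: normal_word.induct) (auto simp: block_def)

theorem vanish:
  assumes sum0: "\<And>C. (\<Sum>w | set w \<subseteq> {..<n} \<and> mset w = C. F w) = 0"
    and tail: "\<And>w. set w \<subseteq> {1..<n} \<Longrightarrow> F w = 0"
    and w: "set w \<subseteq> {..<n}"
  shows "F w = 0"
proof -
  define \<phi> where "\<phi> w = F w + F (map swap01 w)" for w
  \<comment> \<open>The zeros of a standard word are as many as the negative blocks, so these are
    the compositions whose standard words lie in the type-D subgroup.\<close>
  define K where "K = {\<kappa>. composition n \<kappa> \<and> even (count_list (normal_word \<kappa>) 0)}"
  define r where "r \<kappa> = untwist (normal_word \<kappa>)" for \<kappa>
  define S where "S \<kappa> = {w. set w \<subseteq> {..<n} \<and> mset w = mset (r \<kappa>)}" for \<kappa>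
  have n1: "1 < n" using n by simp
  have conj: "\<exists>\<kappa>\<in>K. normal_word \<kappa> \<preceq> lift v \<and>
      {# F v, F (map swap01 v) #} = {# F (r \<kappa>), F (map swap01 (r \<kappa>)) #}"
    if v: "set v \<subseteq> {..<n}" for v
  proof -
    obtain \<kappa> where k: "composition n \<kappa>" "twin_mset (lift v) = twin_mset (normal_word \<kappa>)"
      "normal_word \<kappa> \<preceq> lift v"
      using twin.conjugate_normal_word[OF set_lift[OF n1 v], of "[]"] by auto
    then have "even (count_list (normal_word \<kappa>) 0)" by (simp add: lighter_def)
    then show ?thesis using k by (intro bexI[of _ \<kappa>]) (simp_all add: K_def r_def twin_mset_def)
  qed
  have \<phi>_mset: "\<phi> v = \<phi> v'"
    if "{# F v, F (map swap01 v) #} = {# F v', F (map swap01 v') #}" for v v'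
    using arg_cong[OF that, of sum_mset] by (simp add: \<phi>_def)
  have zero: "\<phi> (r \<kappa>) = 0" if "\<kappa> \<in> K" for \<kappa>
  proof (rule triangular_vanish[where K = K and r = r and S = S
        and \<mu> = "\<lambda>\<kappa>. weight n (normal_word \<kappa>)", OF _ _ _ _ that])
    fix \<kappa> assume k: "\<kappa> \<in> K"
    show "finite (S \<kappa>)" unfolding S_def by (rule finite_words)
    show "r \<kappa> \<in> S \<kappa>" using k set_untwist[OF n1 set_normal_word] by (auto simp: S_def r_def K_def)
    \<comment> \<open>Relabelling by \<open>swap01\<close> carries the words of one content onto
      those of another, so the second summand of \<open>\<phi>\<close> has vanishing content sums
      too.\<close>
    have "(\<Sum>w\<in>S \<kappa>. F (map swap01 w)) =
        (\<Sum>w | set w \<subseteq> {..<n} \<and> mset w = mset (map swap01 (r \<kappa>)). F w)"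
    proof (rule sum.reindex_bij_witness[where i = "map swap01" and j = "map swap01"])
      fix w
      show "map swap01 w \<in> {w. set w \<subseteq> {..<n} \<and> mset w = mset (map swap01 (r \<kappa>))}"
        if "w \<in> S \<kappa>" using that set_swap01[OF n1, of w] by (simp add: S_def)
      assume w: "w \<in> {w. set w \<subseteq> {..<n} \<and> mset w = mset (map swap01 (r \<kappa>))}"
      then have "mset (map swap01 w) = mset (map swap01 (map swap01 (r \<kappa>)))"
        unfolding mset_map by simp
      then show "map swap01 w \<in> S \<kappa>" using w set_swap01[OF n1, of w]
        by (simp only: map_swap01_inverse S_def mem_Collect_eq)
    qed simp_all
    then show "(\<Sum>w\<in>S \<kappa>. \<phi> w) = 0"
      using sum0 by (simp add: \<phi>_def sum.distrib S_def)
    fix v assume v: "v \<in> S \<kappa>"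
    then have "set v \<subseteq> {..<n}" by (simp add: S_def)
    from conj[OF this] obtain \<kappa>' where k': "\<kappa>' \<in> K" "normal_word \<kappa>' \<preceq> lift v"
      and "{# F v, F (map swap01 v) #} = {# F (r \<kappa>'), F (map swap01 (r \<kappa>')) #}" by blast
    from \<phi>_mset[OF this(3)] have \<phi>v: "\<phi> v = \<phi> (r \<kappa>')" .
    have "\<kappa>' = \<kappa> \<or> weight n (normal_word \<kappa>') < weight n (normal_word \<kappa>)"
      by (rule lighter_normal_word[OF _ _ k'(2)])
        (use k k' v up_lift in \<open>auto simp: K_def S_def r_def\<close>)
    then show "\<phi> v = \<phi> (r \<kappa>) \<or>
        (\<exists>k'\<in>K. weight n (normal_word k') < weight n (normal_word \<kappa>) \<and> \<phi> v = \<phi> (r k'))"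
      using k'(1) \<phi>v by blast
  qed
  have "F (r \<kappa>) = 0 \<and> F (map swap01 (r \<kappa>)) = 0" if k: "\<kappa> \<in> K" for \<kappa>
  proof (cases "\<exists>l. (l, True) \<in> set \<kappa>")
    case True
    then have "F (r \<kappa>) = F (map swap01 (r \<kappa>))"
      using twins_odd_eq k by (auto simp: K_def r_def)
    then show ?thesis using zero[OF k] by (simp add: \<phi>_def)
  next
    case False
    \<comment> \<open>Without zeros \<open>untwist\<close> changes nothing and the word uses only
      the chain of letters from 1 on, where \<open>tail\<close> applies. The swapped word need not
      be of this kind; its value vanishes because the symmetric sum does.\<close>
    then have no0: "0 \<notin> set (normal_word \<kappa>)" by (rule normal_word_unsigned)
    then have "set (r \<kappa>) \<subseteq> {1..<n}"
      using set_normal_word[of n \<kappa>] k no0 unfolding r_def untwist_no_zero[OF no0]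
      by (auto simp: K_def Suc_le_eq intro!: gr0I)
    then show ?thesis using tail zero[OF k] by (simp add: \<phi>_def)
  qed
  moreover obtain \<kappa> where "\<kappa> \<in> K"
    and "{# F w, F (map swap01 w) #} = {# F (r \<kappa>), F (map swap01 (r \<kappa>)) #}"
    using conj[OF w] by blast
  ultimately show ?thesis by (auto simp: add_eq_conv_ex)
qed

end

section \<open>Dihedral type\<close>

lemma alternating_word:
  assumes "set w \<subseteq> {a, b}" "\<nexists>u x v. w = u @ [x, x] @ v"
  shows "\<exists>k x y. {x, y} = {a, b} \<and>
    (w = concat (replicate k [x, y]) \<or> w = x # concat (replicate k [y, x]))"
  using assms
proof (induction w)
  case Nil
  show ?case by (intro exI[of _ 0] exI[of _ a] exI[of _ b]) simp
next
  case (Cons c w)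
  have "\<nexists>u x v. w = u @ [x, x] @ v" using Cons.prems(2) by (metis append_Cons)
  then obtain k x y where *: "{x, y} = {a, b}"
    "w = concat (replicate k [x, y]) \<or> w = x # concat (replicate k [y, x])"
    using Cons by auto
  have c: "c \<in> {x, y}" using Cons.prems(1) * by auto
  have ne: "\<nexists>v. w = c # v" using Cons.prems(2) by (metis append_Cons append_Nil)
  show ?case
  proof (cases "w = []")
    case True
    then show ?thesis using c *(1) by (intro exI[of _ 0]) (auto simp: doubleton_eq_iff)
  next
    case False
    have "hd w = x" using * False by (cases k) auto
    then have "c \<noteq> x" using ne False by (cases w) auto
    then have cy: "c = y" using c by auto
    show ?thesis
    proof (cases "w = concat (replicate k [x, y])")
      case True
      then show ?thesis using * cy
        by (intro exI[of _ k] exI[of _ y] exI[of _ x]) (auto simp: insert_commute)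
    next
      case False
      then have "c # w = concat (replicate (Suc k) [y, x])" using * cy by simp
      then show ?thesis using *(1) by (metis insert_commute)
    qed
  qed
qed

lemma concat_replicate_rotate: "x # concat (replicate k [y, x]) = concat (replicate k [x, y]) @ [x]"
  by (induction k) auto

text \<open>Up to squares and rotation a word is a single letter or a power of
  \<open>[0, 1]\<close>: an alternating word of odd length at least 3 starts and ends with the same
  letter, and rotation brings the two together to cancel. These representatives have pairwise
  different contents, and every proper reduction shortens the word.\<close>

lemma dihedral_vanish:
  fixes F :: "nat list \<Rightarrow> complex"
  assumes cyclic: "\<And>u v. F (u @ v) = F (v @ u)"
    and square: "\<And>i u v. i < 2 \<Longrightarrow> F (u @ [i, i] @ v) = F (u @ v)"
    and sum0: "\<And>C. (\<Sum>w | set w \<subseteq> {..<2} \<and> mset w = C. F w) = 0"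
    and w: "set w \<subseteq> {..<2}"
  shows "F w = 0"
proof -
  define K where "K = insert [0] (insert [1] (range (\<lambda>k. concat (replicate k [0, 1::nat]))))"
  have mset_rep: "mset (concat (replicate k [0, 1::nat])) = replicate_mset k 0 + replicate_mset k 1" for k
    by (induction k) auto
  have inj: "v = v'" if "v \<in> K" "v' \<in> K" "mset v = mset v'" for v v'
  proof -
    have c: "count_list v i = count_list v' i" for i using that(3) by (metis count_mset)
    have "count_list (concat (replicate k [0, 1::nat])) 0 = k"
      "count_list (concat (replicate k [0, 1::nat])) 1 = k" for k
      using mset_rep[of k] by (simp_all flip: count_mset)
    then show ?thesis using that(1,2) c[of 0] c[of 1] unfolding K_def by auto
  qed
  have set_K: "set v \<subseteq> {..<2}" if "v \<in> K" for v
    using that by (auto simp: K_def split: if_splits)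
  have conj: "\<exists>v'\<in>K. F v = F v' \<and> mset v' \<subseteq># mset v" if "set v \<subseteq> {..<2}" for v
    using that
  proof (induction v rule: length_induct)
    case (1 v)
    have step: ?case if v': "set v' \<subseteq> {..<2}" "F v = F v'" "mset v' \<subset># mset v" for v'
    proof -
      have "length v' < length v" using mset_subset_size[OF v'(3)] by simp
      then obtain v'' where v'': "v'' \<in> K" "F v' = F v''" "mset v'' \<subseteq># mset v'"
        using 1(1) v'(1) by blast
      then have "mset v'' \<subseteq># mset v"
        using v'(3) subset_mset.order_trans subset_mset.less_imp_le by blast
      then show ?thesis using v''(1,2) v'(2) by auto
    qed
    show ?case
    proof (cases "\<exists>u x u'. v = u @ [x, x] @ u'")
      case True
      then obtain u x u' where v: "v = u @ [x, x] @ u'" by blast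
      show ?thesis
        by (rule step[of "u @ u'"]) (use v 1(2) square[of x u u'] in \<open>auto simp: subset_mset_def\<close>)
    next
      case False
      have two: "{..<2} = {0, 1::nat}" by auto
      obtain k x y where xy: "{x, y} = {0, 1}"
        and *: "v = concat (replicate k [x, y]) \<or> v = x # concat (replicate k [y, x])"
        using alternating_word[OF 1(2)[unfolded two] False] by blast
      from xy have xy': "x = 0 \<and> y = 1 \<or> x = 1 \<and> y = 0" by (auto simp: doubleton_eq_iff)
      from * show ?thesis
      proof
        assume v: "v = concat (replicate k [x, y])"
        show ?thesis
        proof (cases "x = 0")
          case True
          then show ?thesis using v xy' by (intro bexI[of _ v]) (auto simp: K_def)
        next
          case False
          then have xy: "x = 1" "y = 0" using xy' by auto
          show ?thesis
          proof (cases k)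
            case 0
            then show ?thesis using v by (intro bexI[of _ v]) (auto simp: K_def intro: rev_image_eqI[of 0])
          next
            case (Suc j)
            have "v = [1] @ (0 # concat (replicate j [1, 0]))" using v xy Suc by simp
            then have "F v = F ((0 # concat (replicate j [1, 0])) @ [1])"
              using cyclic by metis
            also have "(0 # concat (replicate j [1, 0])) @ [1] = concat (replicate k [0, 1::nat])"
              using Suc concat_replicate_rotate[of "1::nat" j 0] by simp
            finally have "F v = F (concat (replicate k [0, 1]))" .
            moreover have "mset v = mset (concat (replicate k [0, 1::nat]))"
              using v xy by (induction k arbitrary: v) auto
            ultimately show ?thesis
              by (intro bexI[of _ "concat (replicate k [0, 1])"]) (auto simp: K_def)
          qed
        qed
      next
        assume v: "v = x # concat (replicate k [y, x])"
        show ?thesis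
        proof (cases k)
          case 0
          then show ?thesis using v xy' by (intro bexI[of _ v]) (auto simp: K_def)
        next
          case (Suc j)
          have v': "v = [x] @ (y # concat (replicate j [x, y])) @ [x]"
            using v Suc concat_replicate_rotate[of x j y] by simp
          have "F v = F ((y # concat (replicate j [x, y])) @ [x] @ [x])"
            unfolding v' using cyclic[of "[x]"] by simp
          also have "\<dots> = F (y # concat (replicate j [x, y]))"
            using square[of x "y # concat (replicate j [x, y])" "[]"] xy' by auto
          finally show ?thesis
            by (intro step[of "y # concat (replicate j [x, y])"])
              (use v' 1(2) in \<open>auto simp: subset_mset_def\<close>)
        qed
      qed
    qed
  qed
  have zero: "F (id v) = 0" if "v \<in> K" for v
  proof (rule triangular_vanish[where K = K and r = id and \<mu> = length
        and S = "\<lambda>v. {w. set w \<subseteq> {..<2} \<and> mset w = mset v}", OF finite_words _ _ _ that])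
    fix v u
    assume v: "v \<in> K" and u: "u \<in> {w. set w \<subseteq> {..<2} \<and> mset w = mset v}"
    obtain v' where v': "v' \<in> K" "F u = F v'" "mset v' \<subseteq># mset v"
      using conj[of u] u by auto
    have "mset v' = mset v \<or> length v' < length v"
      using v'(3) mset_subset_size[of "mset v'" "mset v"] by (auto simp: subset_mset.le_less)
    then show "F u = F (id v) \<or> (\<exists>v'\<in>K. length v' < length v \<and> F u = F (id v'))"
      using v' inj[OF v'(1) v] by auto
  qed (use set_K sum0 in auto)
  then show ?thesis using conj[OF w] by auto
qed

section \<open>Traces and rank normal form\<close>

definition mtrace :: "'a :: comm_semiring_1 mat \<Rightarrow> 'a" where
  "mtrace A = (\<Sum>i<dim_row A. A $$ (i, i))"

lemma mult_mat_index:
  assumes "A \<in> carrier_mat n m" "B \<in> carrier_mat m k" "i < n" "j < k"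
  shows "(A * B) $$ (i, j) = (\<Sum>p<m. A $$ (i, p) * B $$ (p, j))"
  using assms by (auto simp: scalar_prod_def lessThan_atLeast0 intro!: sum.cong)

lemma mtrace_mult_comm:
  assumes "A \<in> carrier_mat n m" "B \<in> carrier_mat m n"
  shows "mtrace (A * B) = mtrace (B * A)"
proof -
  have "mtrace (A * B) = (\<Sum>i<n. \<Sum>p<m. A $$ (i, p) * B $$ (p, i))"
    using assms unfolding mtrace_def by (intro sum.cong) (auto simp: mult_mat_index[OF assms] simp del: index_mult_mat(1))
  also have "\<dots> = (\<Sum>p<m. \<Sum>i<n. B $$ (p, i) * A $$ (i, p))"
    by (subst sum.swap) (simp add: mult.commute)
  also have "\<dots> = mtrace (B * A)"
    using assms unfolding mtrace_def
    by (intro sum.cong) (auto simp: mult_mat_index[OF assms(2,1)] simp del: index_mult_mat(1))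
  finally show ?thesis .
qed

lemma mtrace_similar:
  assumes "similar_mat_wit A B P Q"
  shows "mtrace A = mtrace B"
proof -
  define n where "n = dim_row A"
  note w = similar_mat_witD[OF n_def assms]
  have "mtrace A = mtrace (P * (B * Q))" using w by (simp add: assoc_mult_mat[of P n n B n Q n])
  also have "\<dots> = mtrace ((B * Q) * P)" by (rule mtrace_mult_comm) (use w in auto)
  also have "(B * Q) * P = B" using w by (simp add: assoc_mult_mat[of B n n Q n P n])
  finally show ?thesis .
qed

lemma upper_triangular_mult:
  fixes A B :: "'a :: comm_ring_1 mat"
  assumes A: "A \<in> carrier_mat n n" "upper_triangular A" and B: "B \<in> carrier_mat n n" "upper_triangular B"
  shows "upper_triangular (A * B)" "i < n \<Longrightarrow> (A * B) $$ (i, i) = A $$ (i, i) * B $$ (i, i)"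
proof -
  have z: "A $$ (i, p) * B $$ (p, j) = 0" if "i < n" "p < n" "j \<le> i" "p \<noteq> i \<or> j < i" for i j p
  proof (cases "p < i")
    case True
    then show ?thesis using upper_triangularD[OF A(2), of p i] that A(1) by simp
  next
    case False
    then have "j < p" using that by auto
    then show ?thesis using upper_triangularD[OF B(2), of j p] that B(1) by simp
  qed
  show "upper_triangular (A * B)"
  proof (rule upper_triangularI)
    fix i j assume "j < i" "i < dim_row (A * B)"
    then show "(A * B) $$ (i, j) = 0"
      using A(1) B(1) z by (subst mult_mat_index[OF A(1) B(1)]) (auto intro!: sum.neutral)
  qed
  assume i: "i < n"
  have "(A * B) $$ (i, i) = (\<Sum>p<n. if p = i then A $$ (i, i) * B $$ (i, i) else 0)"
    unfolding mult_mat_index[OF A(1) B(1) i i] using z[OF i, of _ i] by (intro sum.cong) auto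
  then show "(A * B) $$ (i, i) = A $$ (i, i) * B $$ (i, i)" using i by simp
qed

lemma upper_triangular_pow:
  fixes B :: "'a :: comm_ring_1 mat"
  assumes B: "B \<in> carrier_mat n n" "upper_triangular B"
  shows "upper_triangular (B ^\<^sub>m k) \<and> (\<forall>i<n. (B ^\<^sub>m k) $$ (i, i) = (B $$ (i, i)) ^ k)"
proof (induction k)
  case (Suc k)
  then show ?case
    using upper_triangular_mult[OF pow_carrier_mat[OF B(1)] _ B] by (simp add: mult.commute)
qed (use B in auto)

lemma char_poly_triangular:
  fixes A :: "complex mat"
  assumes A: "A \<in> carrier_mat n n" and c: "char_poly A = (\<Prod>e\<leftarrow>es. [:- e, 1:])"
  obtains B P Q where "similar_mat_wit A B P Q" "upper_triangular B" "diag_mat B = es"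
    "B \<in> carrier_mat n n"
proof -
  obtain B P Q where "schur_decomposition A es = (B, P, Q)" by (cases "schur_decomposition A es") auto
  then have "similar_mat_wit A B P Q \<and> upper_triangular B \<and> diag_mat B = es"
    by (rule schur_decomposition[OF A c])
  then show ?thesis using that similar_mat_witD2[OF A] by blast
qed

text \<open>In triangular form the diagonal of a power consists of the powers of the diagonal
  entries. It is through this formula that the characteristic polynomial determines the traces of
  all powers.\<close>

lemma mtrace_pow:
  fixes A :: "complex mat"
  assumes A: "A \<in> carrier_mat n n" and c: "char_poly A = (\<Prod>e\<leftarrow>es. [:- e, 1:])"
  shows "mtrace (A ^\<^sub>m k) = (\<Sum>e\<leftarrow>es. e ^ k)"
proof -
  obtain B P Q where B: "similar_mat_wit A B P Q" "upper_triangular B" "diag_mat B = es"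
    "B \<in> carrier_mat n n"
    by (rule char_poly_triangular[OF A c])
  have "mtrace (A ^\<^sub>m k) = mtrace (B ^\<^sub>m k)"
    by (rule mtrace_similar[OF similar_mat_wit_pow[OF B(1)]])
  also have "\<dots> = (\<Sum>i<n. (B $$ (i, i)) ^ k)"
    unfolding mtrace_def using upper_triangular_pow[OF B(4,2), of k] B(4) by simp
  also have "\<dots> = (\<Sum>e\<leftarrow>es. e ^ k)"
    unfolding B(3)[symmetric] diag_mat_def using B(4)
    by (simp add: comp_def sum_list_distinct_conv_sum_set lessThan_atLeast0)
  finally show ?thesis .
qed

lemma root_of_unity_eigenvalues:
  fixes A :: "complex mat"
  assumes A: "A \<in> carrier_mat n n" and c: "char_poly A = (\<Prod>e\<leftarrow>es. [:- e, 1:])"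
    and pow: "A ^\<^sub>m k = 1\<^sub>m n" and e: "e \<in> set es"
  shows "e ^ k = 1"
proof -
  obtain B P Q where B: "similar_mat_wit A B P Q" "upper_triangular B" "diag_mat B = es"
    "B \<in> carrier_mat n n"
    by (rule char_poly_triangular[OF A c])
  note w = similar_mat_witD2[OF A B(1)]
  have "B ^\<^sub>m k = Q * A ^\<^sub>m k * P" by (rule similar_mat_wit_pow_id[OF similar_mat_wit_sym[OF B(1)]])
  then have "B ^\<^sub>m k = 1\<^sub>m n" using w pow by simp
  moreover obtain i where "i < n" "e = B $$ (i, i)" using e B by (auto simp: diag_mat_def)
  ultimately show ?thesis using upper_triangular_pow[OF B(4,2), of k] by simp
qed

text \<open>\<open>A ^\<^sub>m k\<close> is the inverse of \<open>A\<close>, and the eigenvalues are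
  roots of unity, whose inverses are their conjugates. This stands in for an invariant inner
  product.\<close>

lemma mtrace_inverse_cnj:
  fixes A :: "complex mat"
  assumes A: "A \<in> carrier_mat n n" and pow: "A ^\<^sub>m Suc k = 1\<^sub>m n"
  shows "mtrace (A ^\<^sub>m k) = cnj (mtrace A)"
proof -
  obtain es where c: "char_poly A = (\<Prod>e\<leftarrow>es. [:- e, 1:])" using char_poly_factorized[OF A] by blast
  have "e ^ k = cnj (e ^ 1)" if "e \<in> set es" for e
  proof -
    have e: "e ^ Suc k = 1" by (rule root_of_unity_eigenvalues[OF A c pow that])
    then have "cmod e ^ Suc k = 1" by (metis norm_one norm_power)
    then have "cmod e = 1" using power_eq_1_iff[of "cmod e" "Suc k"] by simp
    then have ee: "e * cnj e = 1" by (simp add: complex_norm_square[symmetric])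
    have "e ^ k = (e * cnj e) * e ^ k" using ee by simp
    also have "\<dots> = cnj e * e ^ Suc k" by simp
    also have "\<dots> = cnj e" unfolding e by simp
    finally show ?thesis by simp
  qed
  then have "mtrace (A ^\<^sub>m k) = (\<Sum>e\<leftarrow>es. cnj (e ^ 1))"
    unfolding mtrace_pow[OF A c] by (intro arg_cong[of _ _ sum_list] map_cong) auto
  also have "\<dots> = cnj (mtrace (A ^\<^sub>m 1))"
    unfolding mtrace_pow[OF A c] by (induction es) auto
  finally show ?thesis using A by simp
qed

section \<open>Entrywise sums of matrices over a set\<close>

definition msum :: "nat \<Rightarrow> nat \<Rightarrow> ('g \<Rightarrow> 'a :: comm_ring_1 mat) \<Rightarrow> 'g set \<Rightarrow> 'a mat" where
  "msum r c f S = mat r c (\<lambda>(i, j). \<Sum>g\<in>S. f g $$ (i, j))"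

lemma msum_carrier [simp]: "msum r c f S \<in> carrier_mat r c"
  by (simp add: msum_def)

lemma msum_cong: "(\<And>g. g \<in> S \<Longrightarrow> f g = f' g) \<Longrightarrow> msum r c f S = msum r c f' S"
  unfolding msum_def by (intro eq_matI) (auto intro!: sum.cong)

lemma mult_msum:
  assumes "A \<in> carrier_mat l r" "\<And>g. g \<in> S \<Longrightarrow> f g \<in> carrier_mat r c"
  shows "A * msum r c f S = msum l c (\<lambda>g. A * f g) S"
proof (rule eq_matI)
  fix i j assume "i < dim_row (msum l c (\<lambda>g. A * f g) S)" "j < dim_col (msum l c (\<lambda>g. A * f g) S)"
  then have ij: "i < l" "j < c" by (auto simp: msum_def)
  have "(A * msum r c f S) $$ (i, j) = (\<Sum>p<r. \<Sum>g\<in>S. A $$ (i, p) * f g $$ (p, j))"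
    using ij by (subst mult_mat_index[OF assms(1) msum_carrier]) (auto simp: msum_def sum_distrib_left)
  also have "\<dots> = (\<Sum>g\<in>S. (A * f g) $$ (i, j))"
    by (subst sum.swap) (simp add: mult_mat_index[OF assms(1,2) ij] del: index_mult_mat(1))
  finally show "(A * msum r c f S) $$ (i, j) = msum l c (\<lambda>g. A * f g) S $$ (i, j)"
    using ij by (simp add: msum_def)
qed (use assms in \<open>auto simp: msum_def\<close>)

lemma msum_mult:
  assumes "A \<in> carrier_mat c l" "\<And>g. g \<in> S \<Longrightarrow> f g \<in> carrier_mat r c"
  shows "msum r c f S * A = msum r l (\<lambda>g. f g * A) S"
proof (rule eq_matI)
  fix i j assume "i < dim_row (msum r l (\<lambda>g. f g * A) S)" "j < dim_col (msum r l (\<lambda>g. f g * A) S)"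
  then have ij: "i < r" "j < l" by (auto simp: msum_def)
  have "(msum r c f S * A) $$ (i, j) = (\<Sum>p<c. \<Sum>g\<in>S. f g $$ (i, p) * A $$ (p, j))"
    using ij by (subst mult_mat_index[OF msum_carrier assms(1)]) (auto simp: msum_def sum_distrib_right)
  also have "\<dots> = (\<Sum>g\<in>S. (f g * A) $$ (i, j))"
    by (subst sum.swap) (simp add: mult_mat_index[OF assms(2,1) ij] del: index_mult_mat(1))
  finally show "(msum r c f S * A) $$ (i, j) = msum r l (\<lambda>g. f g * A) S $$ (i, j)"
    using ij by (simp add: msum_def)
qed (use assms in \<open>auto simp: msum_def\<close>)

lemma msum_reindex: "bij_betw h S S' \<Longrightarrow> msum r c (\<lambda>g. f (h g)) S = msum r c f S'"
  unfolding msum_def by (intro eq_matI) (auto intro!: sum.reindex_bij_betw[of h S S' "\<lambda>g. f g $$ ij" for ij])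

section \<open>Invertible matrices and Gaussian elimination\<close>

definition inv_pair :: "nat \<Rightarrow> 'a :: comm_ring_1 mat \<Rightarrow> 'a mat \<Rightarrow> bool" where
  "inv_pair n P P' \<longleftrightarrow> P \<in> carrier_mat n n \<and> P' \<in> carrier_mat n n \<and> P * P' = 1\<^sub>m n \<and> P' * P = 1\<^sub>m n"

lemma inv_pair_one: "inv_pair n (1\<^sub>m n) (1\<^sub>m n)"
  by (simp add: inv_pair_def)

lemma inv_pair_mult:
  assumes "inv_pair n P P'" "inv_pair n R R'"
  shows "inv_pair n (P * R) (R' * P')"
proof -
  have c: "P \<in> carrier_mat n n" "P' \<in> carrier_mat n n" "R \<in> carrier_mat n n" "R' \<in> carrier_mat n n"
    and e: "P * P' = 1\<^sub>m n" "P' * P = 1\<^sub>m n" "R * R' = 1\<^sub>m n" "R' * R = 1\<^sub>m n"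
    using assms by (auto simp: inv_pair_def)
  note [simp] = assoc_mult_mat[of _ n n _ n _ n]
  have "P * R * (R' * P') = P * (R * R') * P'" using c by simp
  moreover have "R' * P' * (P * R) = R' * (P' * P) * R" using c by simp
  ultimately show ?thesis using c unfolding inv_pair_def e by (simp add: e)
qed

lemma inv_pair_swap: "k < n \<Longrightarrow> l < n \<Longrightarrow> inv_pair n (swaprows_mat n k l) (swaprows_mat n k l)"
  by (simp add: inv_pair_def swaprows_mat_inv)

definition rank_mat :: "nat \<Rightarrow> nat \<Rightarrow> nat \<Rightarrow> 'a :: zero_neq_one mat" where
  "rank_mat m n k = mat m n (\<lambda>(i, j). if i = j \<and> i < k then 1 else 0)"

lemma rank_mat_carrier [simp]: "rank_mat m n k \<in> carrier_mat m n"
  "dim_row (rank_mat m n k) = m" "dim_col (rank_mat m n k) = n"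
  by (simp_all add: rank_mat_def)

lemma four_block_inject:
  assumes "four_block_mat A B C D = four_block_mat A' B' C' D'"
    and "A \<in> carrier_mat r1 c1" "B \<in> carrier_mat r1 c2" "C \<in> carrier_mat r2 c1" "D \<in> carrier_mat r2 c2"
    and "A' \<in> carrier_mat r1 c1" "B' \<in> carrier_mat r1 c2" "C' \<in> carrier_mat r2 c1" "D' \<in> carrier_mat r2 c2"
  shows "A = A'" "B = B'" "C = C'" "D = D'"
proof -
  have eq: "four_block_mat A B C D $$ (i, j) = four_block_mat A' B' C' D' $$ (i, j)" for i j
    using assms(1) by simp
  show "A = A'"
  proof (rule eq_matI)
    fix i j assume "i < dim_row A'" "j < dim_col A'"
    then show "A $$ (i, j) = A' $$ (i, j)" using eq[of i j] assms(2-9) by simp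
  qed (use assms in auto)
  show "B = B'"
  proof (rule eq_matI)
    fix i j assume "i < dim_row B'" "j < dim_col B'"
    then show "B $$ (i, j) = B' $$ (i, j)" using eq[of i "j + c1"] assms(2-9) by simp
  qed (use assms in auto)
  show "C = C'"
  proof (rule eq_matI)
    fix i j assume "i < dim_row C'" "j < dim_col C'"
    then show "C $$ (i, j) = C' $$ (i, j)" using eq[of "i + r1" j] assms(2-9) by simp
  qed (use assms in auto)
  show "D = D'"
  proof (rule eq_matI)
    fix i j assume "i < dim_row D'" "j < dim_col D'"
    then show "D $$ (i, j) = D' $$ (i, j)" using eq[of "i + r1" "j + c1"] assms(2-9) by simp
  qed (use assms in auto)
qed

lemma mult_block_diag:
  assumes "A \<in> carrier_mat a b" "A' \<in> carrier_mat b c" "D \<in> carrier_mat d e" "D' \<in> carrier_mat e f"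
  shows "four_block_mat A (0\<^sub>m a e) (0\<^sub>m d b) D * four_block_mat A' (0\<^sub>m b f) (0\<^sub>m e c) D'
    = four_block_mat (A * A') (0\<^sub>m a f) (0\<^sub>m d c) (D * D')"
  using assms by (subst mult_four_block_mat[of _ a b _ e _ d _ _ c _ f]) auto

lemma inv_pair_block_diag:
  assumes "inv_pair k P P'" "inv_pair l R R'"
  shows "inv_pair (k + l) (four_block_mat P (0\<^sub>m k l) (0\<^sub>m l k) R) (four_block_mat P' (0\<^sub>m k l) (0\<^sub>m l k) R')"
  using assms unfolding inv_pair_def by (auto simp: mult_block_diag[of _ k k _ k _ l l _ l])

lemma add_uminus_mat: "(A :: 'a :: ring mat) \<in> carrier_mat m n \<Longrightarrow> A + - A = 0\<^sub>m m n"
  by (rule eq_matI) auto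

lemma uminus_zero_mat: "- (0\<^sub>m m n :: 'a :: ring mat) = 0\<^sub>m m n"
  by (rule eq_matI) auto

lemma inv_pair_lower:
  fixes X :: "'a :: comm_ring_1 mat"
  assumes X: "X \<in> carrier_mat l k"
  shows "inv_pair (k + l) (four_block_mat (1\<^sub>m k) (0\<^sub>m k l) X (1\<^sub>m l))
    (four_block_mat (1\<^sub>m k) (0\<^sub>m k l) (- X) (1\<^sub>m l))"
  unfolding inv_pair_def using X
  by (simp add: mult_four_block_mat[of _ k k _ l _ l _ _ k _ l] uminus_zero_mat add_uminus_mat[OF X] uminus_l_inv_mat[OF X])

lemma inv_pair_upper:
  fixes Y :: "'a :: comm_ring_1 mat"
  assumes Y: "Y \<in> carrier_mat k l"
  shows "inv_pair (k + l) (four_block_mat (1\<^sub>m k) Y (0\<^sub>m l k) (1\<^sub>m l))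
    (four_block_mat (1\<^sub>m k) (- Y) (0\<^sub>m l k) (1\<^sub>m l))"
  unfolding inv_pair_def using Y
  by (simp add: mult_four_block_mat[of _ k k _ l _ l _ _ k _ l] uminus_zero_mat add_uminus_mat[OF Y] uminus_l_inv_mat[OF Y])

lemma mult_mat_sandwich:
  fixes J :: "'a :: semiring_1 mat"
  assumes "U \<in> carrier_mat a a" "P \<in> carrier_mat a a" "J \<in> carrier_mat a b" "Q \<in> carrier_mat b b"
    "V \<in> carrier_mat b b"
  shows "U * (P * J * Q) * V = (U * P) * J * (Q * V)"
  using assms
  by (simp add: assoc_mult_mat[of P a a J b Q b] assoc_mult_mat[of U a a "P * (J * Q)" b V b]
      assoc_mult_mat[of P a a "J * Q" b V b] assoc_mult_mat[of J a b Q b V b]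
      assoc_mult_mat[of U a a P a J b] assoc_mult_mat[of U a a "P * J" b "Q * V" b]
      assoc_mult_mat[of P a a J b "Q * V" b])

text \<open>One pivot at a time: a nonzero entry \<open>c\<close> is moved to the corner,
  \<open>L\<close> and \<open>R\<close> clear its column and row, and the Schur complement
  \<open>D\<close> of the pivot is handled by induction. The pivot itself is absorbed into the left
  factor as \<open>C1\<close>, so that the corner of the rank matrix is 1.\<close>

lemma rank_normal_form:
  fixes T :: "'a :: field mat"
  assumes "T \<in> carrier_mat m n"
  shows "\<exists>P P' Q Q' k. inv_pair m P P' \<and> inv_pair n Q Q' \<and> k \<le> m \<and> k \<le> n \<and> T = P * rank_mat m n k * Q"
  using assms
proof (induction m arbitrary: n T)
  case 0
  have "T = 1\<^sub>m 0 * rank_mat 0 n 0 * 1\<^sub>m n" using 0 by (intro eq_matI) auto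
  then show ?case using inv_pair_one by blast
next
  case (Suc m)
  show ?case
  proof (cases "T = 0\<^sub>m (Suc m) n")
    case True
    have "rank_mat (Suc m) n 0 = (0\<^sub>m (Suc m) n :: 'a mat)" by (rule eq_matI) (auto simp: rank_mat_def)
    then have "T = 1\<^sub>m (Suc m) * rank_mat (Suc m) n 0 * 1\<^sub>m n"
      unfolding True by (simp add: left_mult_one_mat[of _ "Suc m" n])
    then show ?thesis using inv_pair_one by blast
  next
    case False
    have "\<exists>i j. i < Suc m \<and> j < n \<and> T $$ (i, j) \<noteq> 0"
    proof (rule ccontr)
      assume "\<not> ?thesis"
      then have "T = 0\<^sub>m (Suc m) n" using Suc.prems by (intro eq_matI) auto
      then show False using False by contradiction
    qed
    then obtain i j where ij: "i < Suc m" "j < n" "T $$ (i, j) \<noteq> 0" by blast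
    then obtain n' where n: "n = Suc n'" by (cases n) auto
    define T1 where "T1 = swaprows 0 i (swapcols 0 j T)"
    define c where "c = T1 $$ (0, 0)"
    have T1: "T1 \<in> carrier_mat (Suc m) n" using Suc.prems by (auto simp: T1_def)
    have c: "c \<noteq> 0" using ij Suc.prems by (auto simp: c_def T1_def)
    define Sr where "Sr = (swaprows_mat (Suc m) 0 i :: 'a mat)"
    define Sc where "Sc = (swaprows_mat n 0 j :: 'a mat)"
    have S: "inv_pair (Suc m) Sr Sr" "inv_pair n Sc Sc"
      using ij inv_pair_swap[of 0 "Suc m" i] inv_pair_swap[of 0 n j] by (auto simp: Sr_def Sc_def)
    have cs: "Sr \<in> carrier_mat (Suc m) (Suc m)" "Sc \<in> carrier_mat n n"
      "Sr * Sr = 1\<^sub>m (Suc m)" "Sc * Sc = 1\<^sub>m n" using S by (auto simp: inv_pair_def)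
    have "swapcols 0 j T \<in> carrier_mat (Suc m) n" using Suc.prems by auto
    then have "T1 = Sr * swapcols 0 j T"
      unfolding T1_def Sr_def by (rule swaprows_mat) (use ij in auto)
    also have "swapcols 0 j T = T * Sc"
      unfolding Sc_def by (rule swapcols_mat[OF Suc.prems]) (use ij in auto)
    finally have "Sr * T1 = (Sr * Sr) * (T * Sc)"
      using cs(1,2) Suc.prems by (simp add: assoc_mult_mat[of Sr "Suc m" "Suc m" Sr "Suc m" _ n])
    then have "Sr * T1 * Sc = T * (Sc * Sc)"
      using cs(1,2) Suc.prems unfolding cs(3) by (simp add: assoc_mult_mat[of T "Suc m" n Sc n Sc n])
    then have T: "T = Sr * T1 * Sc" using cs(4) Suc.prems by simp
    define C1 where "C1 = mat 1 1 (\<lambda>_. c)"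
    define C2 where "C2 = mat 1 1 (\<lambda>_. 1 / c)"
    define r where "r = mat 1 n' (\<lambda>(_, j). T1 $$ (0, Suc j) / c)"
    define s where "s = mat m 1 (\<lambda>(i, _). T1 $$ (Suc i, 0) / c)"
    define D where "D = mat m n' (\<lambda>(i, j). T1 $$ (Suc i, Suc j) - T1 $$ (Suc i, 0) * T1 $$ (0, Suc j) / c)"
    have carr: "C1 \<in> carrier_mat 1 1" "C2 \<in> carrier_mat 1 1" "r \<in> carrier_mat 1 n'" "s \<in> carrier_mat m 1"
      "D \<in> carrier_mat m n'" by (auto simp: C1_def C2_def r_def s_def D_def)
    have C12: "inv_pair 1 C1 C2"
      unfolding inv_pair_def C1_def C2_def using c
      by (auto intro!: eq_matI simp: scalar_prod_def)
    obtain P P' Q Q' k where IH: "inv_pair m P P'" "inv_pair n' Q Q'" "k \<le> m" "k \<le> n'"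
      "D = P * rank_mat m n' k * Q"
      using Suc.IH[OF carr(5)] by blast
    define L where "L = four_block_mat (1\<^sub>m 1) (0\<^sub>m 1 m) s (1\<^sub>m m)"
    define R where "R = four_block_mat (1\<^sub>m 1) r (0\<^sub>m n' 1) (1\<^sub>m n')"
    define PP where "PP = four_block_mat C1 (0\<^sub>m 1 m) (0\<^sub>m m 1) P"
    define QQ where "QQ = four_block_mat (1\<^sub>m 1) (0\<^sub>m 1 n') (0\<^sub>m n' 1) Q"
    have pq: "P \<in> carrier_mat m m" "Q \<in> carrier_mat n' n'" using IH by (auto simp: inv_pair_def)
    have J: "rank_mat (Suc m) n (Suc k) = four_block_mat (1\<^sub>m 1) (0\<^sub>m 1 n') (0\<^sub>m m 1) (rank_mat m n' k :: 'a mat)"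
      by (rule eq_matI) (auto simp: rank_mat_def n)
    have e1: "PP * rank_mat (Suc m) n (Suc k) = four_block_mat C1 (0\<^sub>m 1 n') (0\<^sub>m m 1) (P * rank_mat m n' k)"
      unfolding PP_def J using carr pq by (subst mult_block_diag[of _ 1 1 _ 1 _ m m _ n']) auto
    have "PP * rank_mat (Suc m) n (Suc k) * QQ = four_block_mat C1 (0\<^sub>m 1 n') (0\<^sub>m m 1) D"
      unfolding e1 QQ_def IH(5) using carr pq by (subst mult_block_diag[of _ 1 1 _ 1 _ m n' _ n']) auto
    moreover have "L * four_block_mat C1 (0\<^sub>m 1 n') (0\<^sub>m m 1) D * R = four_block_mat C1 (C1 * r) (s * C1) (s * C1 * r + D)"
      unfolding L_def R_def using carr
      by (simp add: mult_four_block_mat[of _ 1 1 _ m _ m _ _ 1 _ n'] mult_four_block_mat[of _ 1 1 _ n' _ m _ _ 1 _ n'])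
    moreover have "four_block_mat C1 (C1 * r) (s * C1) (s * C1 * r + D) = T1"
    proof (rule eq_matI)
      fix a b assume "a < dim_row T1" "b < dim_col T1"
      then have ab: "a < Suc m" "b < Suc n'" using T1 n by auto
      show "four_block_mat C1 (C1 * r) (s * C1) (s * C1 * r + D) $$ (a, b) = T1 $$ (a, b)"
        using ab c carr
        by (cases a; cases b) (auto simp: C1_def r_def s_def D_def scalar_prod_def c_def[symmetric])
    qed (use T1 n carr in auto)
    ultimately have T1': "T1 = L * (PP * rank_mat (Suc m) n (Suc k) * QQ) * R" by simp
    have iL: "inv_pair (Suc m) L (four_block_mat (1\<^sub>m 1) (0\<^sub>m 1 m) (- s) (1\<^sub>m m))"
      unfolding L_def using inv_pair_lower[OF carr(4)] by simp
    have iR: "inv_pair n R (four_block_mat (1\<^sub>m 1) (- r) (0\<^sub>m n' 1) (1\<^sub>m n'))"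
      unfolding R_def n using inv_pair_upper[OF carr(3)] by simp
    have iP: "inv_pair (Suc m) PP (four_block_mat C2 (0\<^sub>m 1 m) (0\<^sub>m m 1) P')"
      unfolding PP_def using inv_pair_block_diag[OF C12 IH(1)] by simp
    have iQ: "inv_pair n QQ (four_block_mat (1\<^sub>m 1) (0\<^sub>m 1 n') (0\<^sub>m n' 1) Q')"
      unfolding QQ_def n using inv_pair_block_diag[OF inv_pair_one IH(2), of 1] by simp
    have cs': "Sr \<in> carrier_mat (Suc m) (Suc m)" "L \<in> carrier_mat (Suc m) (Suc m)" "PP \<in> carrier_mat (Suc m) (Suc m)"
      "Sc \<in> carrier_mat n n" "R \<in> carrier_mat n n" "QQ \<in> carrier_mat n n"
      using S iL iR iP iQ by (auto simp: inv_pair_def)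
    have Xc: "PP * rank_mat (Suc m) n (Suc k) * QQ \<in> carrier_mat (Suc m) n"
      using cs' by (meson mult_carrier_mat rank_mat_carrier(1))
    have "T = (Sr * L * PP) * rank_mat (Suc m) n (Suc k) * (QQ * (R * Sc))"
      unfolding T T1' mult_mat_sandwich[OF cs'(1,2) Xc cs'(5,4)]
      by (rule mult_mat_sandwich) (use cs' in auto)
    moreover have "\<exists>X. inv_pair (Suc m) (Sr * L * PP) X" "\<exists>X. inv_pair n (QQ * (R * Sc)) X"
      using inv_pair_mult[OF inv_pair_mult[OF S(1) iL] iP] inv_pair_mult[OF iQ inv_pair_mult[OF iR S(2)]] by auto
    moreover have "Suc k \<le> Suc m" "Suc k \<le> n" using IH n by auto
    ultimately show ?thesis by blast
  qed
qed

section \<open>Characters determine representations\<close>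

definition mat_rep :: "('g, 'x) monoid_scheme \<Rightarrow> nat \<Rightarrow> ('g \<Rightarrow> complex mat) \<Rightarrow> bool" where
  "mat_rep G d M \<longleftrightarrow> (\<forall>g\<in>carrier G. M g \<in> carrier_mat d d) \<and> M \<one>\<^bsub>G\<^esub> = 1\<^sub>m d \<and>
     (\<forall>g\<in>carrier G. \<forall>h\<in>carrier G. M (g \<otimes>\<^bsub>G\<^esub> h) = M g * M h)"

lemma mat_repD:
  assumes "mat_rep G d M"
  shows "g \<in> carrier G \<Longrightarrow> M g \<in> carrier_mat d d" "M \<one>\<^bsub>G\<^esub> = 1\<^sub>m d"
    "g \<in> carrier G \<Longrightarrow> h \<in> carrier G \<Longrightarrow> M (g \<otimes>\<^bsub>G\<^esub> h) = M g * M h"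
  using assms by (auto simp: mat_rep_def)

lemma mat_rep_conj:
  assumes "mat_rep G d M" "inv_pair d P P'"
  shows "mat_rep G d (\<lambda>g. P * M g * P')"
proof -
  note r = mat_repD[OF assms(1)]
  have c: "P \<in> carrier_mat d d" "P' \<in> carrier_mat d d" "P * P' = 1\<^sub>m d" "P' * P = 1\<^sub>m d"
    using assms(2) by (auto simp: inv_pair_def)
  note [simp] = assoc_mult_mat[of _ d d _ d _ d]
  have "P * (M g * M h) * P' = P * M g * P' * (P * M h * P')" if "g \<in> carrier G" "h \<in> carrier G" for g h
  proof -
    have m: "M g \<in> carrier_mat d d" "M h \<in> carrier_mat d d" using r(1) that by auto
    have "P * M g * P' * (P * M h * P') = P * M g * (P' * P) * M h * P'"
      using c(1,2) m by simp
    also have "\<dots> = P * (M g * M h) * P'" unfolding c(4) using c(1,2) m by simp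
    finally show ?thesis by simp
  qed
  then show ?thesis using c r unfolding mat_rep_def by auto
qed

lemma inv_pair_similar:
  assumes "inv_pair d P P'" "A \<in> carrier_mat d d"
  shows "similar_mat_wit (P * A * P') A P P'"
  using assms by (intro similar_mat_witI) (auto simp: inv_pair_def)

context group
begin

lemma bij_betw_mult_left: "h \<in> carrier G \<Longrightarrow> bij_betw (\<lambda>g. h \<otimes> g) (carrier G) (carrier G)"
  by (rule bij_betw_byWitness[where f' = "\<lambda>g. inv h \<otimes> g"]) (auto simp: m_assoc[symmetric])

lemma mat_rep_pow:
  assumes "mat_rep G d M" "g \<in> carrier G"
  shows "M (g [^] k) = M g ^\<^sub>m k"
proof (induction k)
  case 0
  have "dim_row (M g) = d" using mat_repD(1)[OF assms] by simp
  then show ?case using mat_repD(2)[OF assms(1)] by simp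
next
  case (Suc k)
  then show ?case using mat_repD(3)[OF assms(1), of "g [^] k" g] assms(2) by simp
qed

lemma character_inverse:
  assumes fin: "finite (carrier G)" and M: "mat_rep G d M" and g: "g \<in> carrier G"
  shows "mtrace (M (inv g)) = cnj (mtrace (M g))"
proof -
  obtain k where k: "Coset.order G = Suc k" using fin by (metis order_gt_0_iff_finite gr0_implies_Suc)
  have p: "g [^] Suc k = \<one>" using pow_order_eq_1[OF g] k by simp
  then have "g [^] k \<otimes> g = \<one>" by simp
  then have "inv g = g [^] k" using g by (intro inv_equality) auto
  moreover have "M g ^\<^sub>m Suc k = 1\<^sub>m d"
    using mat_rep_pow[OF M g, of "Suc k"] p mat_repD(2)[OF M] by simp
  ultimately show ?thesis
    using mtrace_inverse_cnj[OF mat_repD(1)[OF M g]] mat_rep_pow[OF M g, of k] by simp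
qed

lemma mtrace_one: "mtrace (1\<^sub>m d :: complex mat) = of_nat d"
  by (simp add: mtrace_def)

text \<open>As the characters agree, the sum of \<open>mtrace (N g) * mtrace (M (inv g))\<close> is
  a sum of squared absolute values. Expanded into diagonal entries it must contain indices
  \<open>a\<close>, \<open>b\<close> with nonzero sum, and this sum is an entry of an averaged
  matrix unit.\<close>

lemma nonzero_intertwiner:
  assumes fin: "finite (carrier G)" and M: "mat_rep G d M" and N: "mat_rep G d N" and d: "0 < d"
    and ch: "\<And>g. g \<in> carrier G \<Longrightarrow> mtrace (M g) = mtrace (N g)"
  shows "\<exists>T \<in> carrier_mat d d. T \<noteq> 0\<^sub>m d d \<and> (\<forall>h\<in>carrier G. N h * T = T * M h)"
proof -
  have "mtrace (N g) * mtrace (M (inv g)) = of_real ((cmod (mtrace (N g)))\<^sup>2)"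
    if g: "g \<in> carrier G" for g
    using complex_norm_square[of "mtrace (N g)"] character_inverse[OF fin M g] ch[OF g] by simp
  then have "(\<Sum>g\<in>carrier G. mtrace (N g) * mtrace (M (inv g))) = of_real (\<Sum>g\<in>carrier G. (cmod (mtrace (N g)))\<^sup>2)"
    unfolding of_real_sum by (intro sum.cong) auto
  moreover have "(\<Sum>g\<in>carrier G. (cmod (mtrace (N g)))\<^sup>2) > 0"
  proof (rule sum_pos2[OF fin])
    show "\<one> \<in> carrier G" by simp
    \<comment> \<open>The term at the identity is the square of the dimension, which makes the whole
      sum positive.\<close>
    show "0 < (cmod (mtrace (N \<one>)))\<^sup>2" using d by (simp add: mat_repD(2)[OF N] mtrace_one)
  qed auto
  ultimately have "(\<Sum>g\<in>carrier G. mtrace (N g) * mtrace (M (inv g))) \<noteq> 0"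
    by (simp only: of_real_eq_0_iff less_imp_neq[symmetric] not_False_eq_True)
  also have "(\<Sum>g\<in>carrier G. mtrace (N g) * mtrace (M (inv g))) =
      (\<Sum>g\<in>carrier G. \<Sum>a<d. \<Sum>b<d. N g $$ (a, a) * M (inv g) $$ (b, b))"
    unfolding mtrace_def sum_product
    using carrier_matD(1)[OF mat_repD(1)[OF N]] carrier_matD(1)[OF mat_repD(1)[OF M]]
    by (intro sum.cong HOL.refl) simp_all
  also have "\<dots> = (\<Sum>a<d. \<Sum>b<d. \<Sum>g\<in>carrier G. N g $$ (a, a) * M (inv g) $$ (b, b))"
    by (subst sum.swap) (intro sum.cong HOL.refl sum.swap)
  finally obtain a b where ab: "a < d" "b < d" "(\<Sum>g\<in>carrier G. N g $$ (a, a) * M (inv g) $$ (b, b)) \<noteq> 0"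
    by (metis (no_types, lifting) sum.neutral lessThan_iff)
  \<comment> \<open>For this matrix unit, the entry of \<open>N g * E * M (inv g)\<close> at
    \<open>(a, b)\<close> is the product of the two diagonal entries found above.\<close>
  define E where "E = mat d d (\<lambda>(i, j). if i = a \<and> j = b then 1 else 0 :: complex)"
  have E: "E \<in> carrier_mat d d" by (simp add: E_def)
  define f where "f g = N g * E * M (inv g)" for g
  have f: "f g \<in> carrier_mat d d" if "g \<in> carrier G" for g
    using mat_repD(1)[OF N that] mat_repD(1)[OF M inv_closed[OF that]] E by (simp add: f_def)
  have fab: "f g $$ (a, b) = N g $$ (a, a) * M (inv g) $$ (b, b)" if g: "g \<in> carrier G" for g
  proof -
    have c: "N g \<in> carrier_mat d d" "M (inv g) \<in> carrier_mat d d"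
      using mat_repD(1)[OF N g] mat_repD(1)[OF M inv_closed[OF g]] .
    have NE: "(N g * E) $$ (a, p) = (if p = b then N g $$ (a, a) else 0)" if p: "p < d" for p
    proof -
      have "(N g * E) $$ (a, p) = (\<Sum>q<d. if q = a then (if p = b then N g $$ (a, a) else 0) else 0)"
        unfolding mult_mat_index[OF c(1) E ab(1) p] using p by (intro sum.cong) (auto simp: E_def ab)
      then show ?thesis using ab by simp
    qed
    have "f g $$ (a, b) = (\<Sum>p<d. if p = b then N g $$ (a, a) * M (inv g) $$ (b, b) else 0)"
      unfolding f_def mult_mat_index[OF mult_carrier_mat[OF c(1) E] c(2) ab(1,2)]
      by (intro sum.cong) (auto simp: NE simp del: index_mult_mat(1))
    then show ?thesis using ab by simp
  qed
  define T where "T = msum d d f (carrier G)"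
  have "T $$ (a, b) \<noteq> 0" using ab by (simp add: T_def msum_def fab)
  then have "T \<noteq> 0\<^sub>m d d" using ab by auto
  moreover have "N h * T = T * M h" if h: "h \<in> carrier G" for h
  proof -
    note cs = mat_repD(1)[OF N] mat_repD(1)[OF M] E
    have "N h * T = msum d d (\<lambda>g. N h * f g) (carrier G)"
      unfolding T_def by (rule mult_msum) (use f cs h in auto)
    also have "\<dots> = msum d d (\<lambda>g. f (h \<otimes> g) * M h) (carrier G)"
    proof (rule msum_cong)
      fix g assume g: "g \<in> carrier G"
      have c: "N g \<in> carrier_mat d d" "N h \<in> carrier_mat d d" "M (inv g) \<in> carrier_mat d d"
        "M (inv (h \<otimes> g)) \<in> carrier_mat d d" "M h \<in> carrier_mat d d" using cs g h by auto
      have "M (inv (h \<otimes> g)) * M h = M (inv (h \<otimes> g) \<otimes> h)"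
        using mat_repD(3)[OF M] g h by simp
      also have "inv (h \<otimes> g) \<otimes> h = inv g" using g h by (simp add: inv_mult_group m_assoc)
      finally have e: "M (inv (h \<otimes> g)) * M h = M (inv g)" .
      have "f (h \<otimes> g) * M h = N (h \<otimes> g) * E * (M (inv (h \<otimes> g)) * M h)"
        unfolding f_def by (rule assoc_mult_mat[OF mult_carrier_mat[OF cs(1)[OF m_closed[OF h g]] E] c(4,5)])
      also have "\<dots> = N h * N g * E * M (inv g)" unfolding e using mat_repD(3)[OF N h g] by simp
      also have "\<dots> = N h * f g" unfolding f_def using c E
        by (simp add: assoc_mult_mat[of _ d d _ d _ d])
      finally show "N h * f g = f (h \<otimes> g) * M h" by simp
    qed
    also have "\<dots> = msum d d (\<lambda>g. f g * M h) (carrier G)"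
      by (rule msum_reindex[OF bij_betw_mult_left[OF h], of d d "\<lambda>g. f g * M h"])
    also have "\<dots> = T * M h"
      unfolding T_def by (rule msum_mult[symmetric]) (use f cs h in auto)
    finally show ?thesis .
  qed
  ultimately show ?thesis using msum_carrier unfolding T_def by blast
qed

text \<open>Maschke's theorem in cocycle form: averaging over \<open>G\<close> splits every extension.\<close>

lemma cocycle_splits:
  assumes fin: "finite (carrier G)" and A: "mat_rep G k A" and D: "mat_rep G l D"
    and C: "\<And>g. g \<in> carrier G \<Longrightarrow> C g \<in> carrier_mat l k"
    and coc: "\<And>g h. g \<in> carrier G \<Longrightarrow> h \<in> carrier G \<Longrightarrow> C (g \<otimes> h) = C g * A h + D g * C h"
  shows "\<exists>X \<in> carrier_mat l k. \<forall>h\<in>carrier G. C h = X * A h - D h * X"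
proof -
  define f where "f g = C g * A (inv g)" for g
  define c where "c = (1 / of_nat (card (carrier G)) :: complex)"
  define S where "S = msum l k f (carrier G)"
  note cs = mat_repD(1)[OF A] mat_repD(1)[OF D] C
  have f: "f g \<in> carrier_mat l k" if "g \<in> carrier G" for g
    unfolding f_def by (rule mult_carrier_mat[OF C[OF that] mat_repD(1)[OF A inv_closed[OF that]]])
  have Sc: "S \<in> carrier_mat l k" by (simp add: S_def)
  have card: "of_nat (card (carrier G)) \<noteq> (0 :: complex)"
    using fin by (metis card_0_eq of_nat_eq_0_iff one_closed empty_iff)
  have "C h = (c \<cdot>\<^sub>m S) * A h - D h * (c \<cdot>\<^sub>m S)" if h: "h \<in> carrier G" for h
  proof -
    \<comment> \<open>The cocycle identity gives
      \<open>f (h \<otimes> g) * A h = C h + D h * f g\<close>. On summing over \<open>g\<close>,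
      the left side reindexes to \<open>S * A h\<close> and \<open>C h\<close> is collected once for
      each group element.\<close>
    have "D h * S = msum l k (\<lambda>g. D h * f g) (carrier G)"
      unfolding S_def by (rule mult_msum) (use f cs h in auto)
    also have "\<dots> = msum l k (\<lambda>g. f (h \<otimes> g) * A h - C h) (carrier G)"
    proof (rule msum_cong)
      fix g assume g: "g \<in> carrier G"
      have c: "C g \<in> carrier_mat l k" "C h \<in> carrier_mat l k" "C (h \<otimes> g) \<in> carrier_mat l k"
        "D h \<in> carrier_mat l l" "A g \<in> carrier_mat k k" "A h \<in> carrier_mat k k" "A (inv g) \<in> carrier_mat k k"
        "A (inv (h \<otimes> g)) \<in> carrier_mat k k" using cs g h by auto
      have "A (inv (h \<otimes> g)) * A h = A (inv (h \<otimes> g) \<otimes> h)" using mat_repD(3)[OF A] g h by simp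
      also have "inv (h \<otimes> g) \<otimes> h = inv g" using g h by (simp add: inv_mult_group m_assoc)
      finally have e: "A (inv (h \<otimes> g)) * A h = A (inv g)" .
      have e2: "A g * A (inv g) = 1\<^sub>m k"
        using mat_repD(3)[OF A g inv_closed[OF g]] mat_repD(2)[OF A] g by simp
      have "f (h \<otimes> g) * A h = C (h \<otimes> g) * A (inv g)"
        unfolding f_def using c e by (simp add: assoc_mult_mat[of _ l k _ k _ k])
      also have "\<dots> = C h * A g * A (inv g) + D h * C g * A (inv g)"
        unfolding coc[OF h g] using c by (intro add_mult_distrib_mat[of _ l k _ _ k]) auto
      also have "C h * A g * A (inv g) = C h" using c e2 by (simp add: assoc_mult_mat[of _ l k _ k _ k])
      also have "D h * C g * A (inv g) = D h * f g"
        unfolding f_def using c by (simp add: assoc_mult_mat[of _ l l _ k _ k])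
      finally show "D h * f g = f (h \<otimes> g) * A h - C h"
        using f[OF g] c by (intro eq_matI) (auto simp: f_def simp del: index_mult_mat(1))
    qed
    also have "\<dots> = msum l k (\<lambda>g. f (h \<otimes> g) * A h) (carrier G) - of_nat (card (carrier G)) \<cdot>\<^sub>m C h"
      using C[OF h] unfolding msum_def
      by (intro eq_matI) (auto simp: sum_subtractf cs f simp del: index_mult_mat(1))
    also have "msum l k (\<lambda>g. f (h \<otimes> g) * A h) (carrier G) = msum l k (\<lambda>g. f g * A h) (carrier G)"
      by (rule msum_reindex[OF bij_betw_mult_left[OF h], of l k "\<lambda>g. f g * A h"])
    also have "\<dots> = S * A h"
      unfolding S_def by (rule msum_mult[symmetric]) (use f cs h in auto)
    finally have DS: "D h * S = S * A h - of_nat (card (carrier G)) \<cdot>\<^sub>m C h" .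
    have "(c \<cdot>\<^sub>m S) * A h - D h * (c \<cdot>\<^sub>m S) = c \<cdot>\<^sub>m (S * A h) - c \<cdot>\<^sub>m (D h * S)"
      using Sc cs h by (simp add: mult_smult_assoc_mat[of _ l k _ k] mult_smult_distrib[of _ l l _ k])
    also have "\<dots> = C h"
    proof -
      define W where "W = S * A h"
      have W: "W \<in> carrier_mat l k" unfolding W_def using mult_carrier_mat[OF Sc cs(1)[OF h]] .
      show ?thesis
        unfolding DS W_def[symmetric] using W C[OF h] card
        by (intro eq_matI) (auto simp: c_def field_simps)
    qed
    finally show ?thesis by simp
  qed
  then show ?thesis using Sc by (intro bexI[of _ "c \<cdot>\<^sub>m S"]) auto
qed

end

section \<open>Block triangular representations\<close>

lemma similar_lower_block:
  fixes A :: "'a :: comm_ring_1 mat"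
  assumes A: "A \<in> carrier_mat k k" and D: "D \<in> carrier_mat l l" and X: "X \<in> carrier_mat l k"
  shows "similar_mat_wit (four_block_mat A (0\<^sub>m k l) (X * A - D * X) D)
    (four_block_mat A (0\<^sub>m k l) (0\<^sub>m l k) D)
    (four_block_mat (1\<^sub>m k) (0\<^sub>m k l) X (1\<^sub>m l)) (four_block_mat (1\<^sub>m k) (0\<^sub>m k l) (- X) (1\<^sub>m l))"
proof -
  let ?U = "four_block_mat (1\<^sub>m k) (0\<^sub>m k l) X (1\<^sub>m l)"
  let ?V = "four_block_mat (1\<^sub>m k) (0\<^sub>m k l) (- X) (1\<^sub>m l)"
  let ?B = "four_block_mat A (0\<^sub>m k l) (0\<^sub>m l k) D"
  have XA: "X * A \<in> carrier_mat l k" "D * X \<in> carrier_mat l k" using A D X by (auto intro: mult_carrier_mat)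
  have 1: "?U * ?B = four_block_mat A (0\<^sub>m k l) (X * A) D"
    using A D X XA by (subst mult_four_block_mat[of _ k k _ l _ l _ _ k _ l]) auto
  have "?U * ?B * ?V = four_block_mat A (0\<^sub>m k l) (X * A + D * - X) D"
    unfolding 1 using A D X XA by (subst mult_four_block_mat[of _ k k _ l _ l _ _ k _ l]) auto
  also have "X * A + D * - X = X * A - D * X"
    using XA X D by (simp add: minus_add_uminus_mat[OF XA])
  finally show ?thesis
    using inv_pair_similar[OF inv_pair_lower[OF X], of ?B] A D by simp
qed

lemma similar_upper_block:
  fixes A :: "'a :: comm_ring_1 mat"
  assumes A: "A \<in> carrier_mat k k" and D: "D \<in> carrier_mat l l" and Y: "Y \<in> carrier_mat k l"
  shows "similar_mat_wit (four_block_mat A (Y * D - A * Y) (0\<^sub>m l k) D)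
    (four_block_mat A (0\<^sub>m k l) (0\<^sub>m l k) D)
    (four_block_mat (1\<^sub>m k) Y (0\<^sub>m l k) (1\<^sub>m l)) (four_block_mat (1\<^sub>m k) (- Y) (0\<^sub>m l k) (1\<^sub>m l))"
proof -
  let ?U = "four_block_mat (1\<^sub>m k) Y (0\<^sub>m l k) (1\<^sub>m l)"
  let ?V = "four_block_mat (1\<^sub>m k) (- Y) (0\<^sub>m l k) (1\<^sub>m l)"
  let ?B = "four_block_mat A (0\<^sub>m k l) (0\<^sub>m l k) D"
  have YD: "Y * D \<in> carrier_mat k l" "A * Y \<in> carrier_mat k l" using A D Y by (auto intro: mult_carrier_mat)
  have 1: "?U * ?B = four_block_mat A (Y * D) (0\<^sub>m l k) D"
    using A D Y YD by (subst mult_four_block_mat[of _ k k _ l _ l _ _ k _ l]) auto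
  have "?U * ?B * ?V = four_block_mat A (A * - Y + Y * D) (0\<^sub>m l k) D"
    unfolding 1 using A D Y YD by (subst mult_four_block_mat[of _ k k _ l _ l _ _ k _ l]) auto
  also have "A * - Y + Y * D = Y * D - A * Y"
    using YD A Y by (simp add: minus_add_uminus_mat[OF YD] comm_add_mat[of _ k l])
  finally show ?thesis
    using inv_pair_similar[OF inv_pair_upper[OF Y], of ?B] A D by simp
qed

context group
begin

lemma mat_rep_lower_block:
  assumes N: "mat_rep G (k + l) (\<lambda>g. four_block_mat (A g) (0\<^sub>m k l) (C g) (D g))"
    and c: "\<And>g. A g \<in> carrier_mat k k" "\<And>g. C g \<in> carrier_mat l k" "\<And>g. D g \<in> carrier_mat l l"
  shows "mat_rep G k A" "mat_rep G l D"
    "\<And>g h. g \<in> carrier G \<Longrightarrow> h \<in> carrier G \<Longrightarrow> C (g \<otimes> h) = C g * A h + D g * C h"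
proof -
  have mult: "A (g \<otimes> h) = A g * A h" "C (g \<otimes> h) = C g * A h + D g * C h" "D (g \<otimes> h) = D g * D h"
    if "g \<in> carrier G" "h \<in> carrier G" for g h
  proof -
    have e: "four_block_mat (A (g \<otimes> h)) (0\<^sub>m k l) (C (g \<otimes> h)) (D (g \<otimes> h)) =
        four_block_mat (A g * A h) (0\<^sub>m k l) (C g * A h + D g * C h) (D g * D h)"
      unfolding mat_repD(3)[OF N that]
      using c[of g] c[of h] by (subst mult_four_block_mat[of _ k k _ l _ l _ _ k _ l]) auto
    have cc: "A g * A h \<in> carrier_mat k k" "C g * A h + D g * C h \<in> carrier_mat l k" "D g * D h \<in> carrier_mat l l"
      using c by (auto intro!: mult_carrier_mat add_carrier_mat)
    note inj = four_block_inject[OF e c(1) zero_carrier_mat c(2,3) cc(1) zero_carrier_mat cc(2,3)]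
    from inj show "A (g \<otimes> h) = A g * A h" "C (g \<otimes> h) = C g * A h + D g * C h" "D (g \<otimes> h) = D g * D h"
      by simp_all
  qed
  have e: "four_block_mat (A \<one>) (0\<^sub>m k l) (C \<one>) (D \<one>) =
      four_block_mat (1\<^sub>m k) (0\<^sub>m k l) (0\<^sub>m l k) (1\<^sub>m l)"
    using mat_repD(2)[OF N] by simp
  note inj = four_block_inject[OF e c(1) zero_carrier_mat c(2,3) one_carrier_mat zero_carrier_mat
      zero_carrier_mat one_carrier_mat]
  show "mat_rep G k A" "mat_rep G l D" using inj mult c by (auto simp: mat_rep_def)
  show "\<And>g h. g \<in> carrier G \<Longrightarrow> h \<in> carrier G \<Longrightarrow> C (g \<otimes> h) = C g * A h + D g * C h"
    using mult by simp
qed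

lemma mat_rep_upper_block:
  assumes N: "mat_rep G (k + l) (\<lambda>g. four_block_mat (A g) (B g) (0\<^sub>m l k) (D g))"
    and c: "\<And>g. A g \<in> carrier_mat k k" "\<And>g. B g \<in> carrier_mat k l" "\<And>g. D g \<in> carrier_mat l l"
  shows "mat_rep G k A" "mat_rep G l D"
    "\<And>g h. g \<in> carrier G \<Longrightarrow> h \<in> carrier G \<Longrightarrow> B (g \<otimes> h) = B g * D h + A g * B h"
proof -
  have mult: "A (g \<otimes> h) = A g * A h" "B (g \<otimes> h) = A g * B h + B g * D h" "D (g \<otimes> h) = D g * D h"
    if "g \<in> carrier G" "h \<in> carrier G" for g h
  proof -
    have e: "four_block_mat (A (g \<otimes> h)) (B (g \<otimes> h)) (0\<^sub>m l k) (D (g \<otimes> h)) =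
        four_block_mat (A g * A h) (A g * B h + B g * D h) (0\<^sub>m l k) (D g * D h)"
      unfolding mat_repD(3)[OF N that]
      using c[of g] c[of h] by (subst mult_four_block_mat[of _ k k _ l _ l _ _ k _ l]) auto
    have cc: "A g * A h \<in> carrier_mat k k" "A g * B h + B g * D h \<in> carrier_mat k l" "D g * D h \<in> carrier_mat l l"
      using c by (auto intro!: mult_carrier_mat add_carrier_mat)
    note inj = four_block_inject[OF e c(1,2) zero_carrier_mat c(3) cc(1,2) zero_carrier_mat cc(3)]
    from inj show "A (g \<otimes> h) = A g * A h" "B (g \<otimes> h) = A g * B h + B g * D h" "D (g \<otimes> h) = D g * D h"
      by simp_all
  qed
  have e: "four_block_mat (A \<one>) (B \<one>) (0\<^sub>m l k) (D \<one>) =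
      four_block_mat (1\<^sub>m k) (0\<^sub>m k l) (0\<^sub>m l k) (1\<^sub>m l)"
    using mat_repD(2)[OF N] by simp
  note inj = four_block_inject[OF e c(1,2) zero_carrier_mat c(3) one_carrier_mat zero_carrier_mat
      zero_carrier_mat one_carrier_mat]
  show "mat_rep G k A" "mat_rep G l D" using inj mult c by (auto simp: mat_rep_def)
  show "B (g \<otimes> h) = B g * D h + A g * B h" if "g \<in> carrier G" "h \<in> carrier G" for g h
    unfolding mult(2)[OF that] by (rule comm_add_mat[of _ k l]) (use c in \<open>auto intro: mult_carrier_mat\<close>)
qed

lemma mtrace_four_block:
  assumes "A \<in> carrier_mat k k" "D \<in> carrier_mat l l"
  shows "mtrace (four_block_mat A B C D) = mtrace A + (mtrace D :: 'z :: comm_semiring_1)"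
proof -
  have "mtrace (four_block_mat A B C D) = (\<Sum>i<k + l. four_block_mat A B C D $$ (i, i))"
    using assms by (simp add: mtrace_def)
  also have "\<dots> = (\<Sum>i<k. four_block_mat A B C D $$ (i, i)) + (\<Sum>i<l. four_block_mat A B C D $$ (i + k, i + k))"
    by (induction l) (simp_all add: add_ac)
  also have "\<dots> = (\<Sum>i<k. A $$ (i, i)) + (\<Sum>i<l. D $$ (i, i))"
    using assms by (intro arg_cong2[of _ _ _ _ "(+)"] sum.cong) auto
  finally show ?thesis using assms by (simp add: mtrace_def)
qed

text \<open>The intertwiner need not be invertible, and no decomposition into irreducibles is made.
  In bases adapted to its rank \<open>k\<close>, \<open>M\<close> is block lower and
  \<open>N\<close> block upper triangular with the same corner \<open>A\<close>. Both triangular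
  forms split, the common corner cancels from the characters, and the remaining blocks have the
  smaller size \<open>d - k\<close>.\<close>

theorem equal_characters_similar:
  assumes fin: "finite (carrier G)"
  shows "mat_rep G d M \<Longrightarrow> mat_rep G d N \<Longrightarrow>
    (\<And>g. g \<in> carrier G \<Longrightarrow> mtrace (M g) = mtrace (N g)) \<Longrightarrow>
    \<exists>P Q. \<forall>g\<in>carrier G. similar_mat_wit (N g) (M g) P Q"
proof (induction d arbitrary: M N rule: less_induct)
  case (less d)
  note M = less.prems(1) and N = less.prems(2) and ch = less.prems(3)
  show ?case
  proof (cases "d = 0")
    case True
    have "similar_mat_wit (N g) (M g) (1\<^sub>m 0) (1\<^sub>m 0)" if g: "g \<in> carrier G" for g
    proof -
      have "N g \<in> carrier_mat 0 0" "M g \<in> carrier_mat 0 0"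
        using mat_repD(1)[OF N g] mat_repD(1)[OF M g] True by auto
      moreover from this have "N g = M g" by (intro eq_matI) auto
      ultimately show ?thesis using similar_mat_wit_refl[of "M g" 0] by simp
    qed
    then show ?thesis by blast
  next
    case False
    then obtain T where T: "T \<in> carrier_mat d d" "T \<noteq> 0\<^sub>m d d"
      and TM: "\<And>h. h \<in> carrier G \<Longrightarrow> N h * T = T * M h"
      using nonzero_intertwiner[OF fin M N _ ch] by auto
    obtain P P' Q Q' k where P: "inv_pair d P P'" and Q: "inv_pair d Q Q'" and k: "k \<le> d"
      and TJ: "T = P * rank_mat d d k * Q"
      using rank_normal_form[OF T(1)] by blast
    define J where "J = (rank_mat d d k :: complex mat)"
    define l where "l = d - k"
    have d: "d = k + l" using k by (simp add: l_def)
    have Pc: "P \<in> carrier_mat d d" "P' \<in> carrier_mat d d" "P' * P = 1\<^sub>m d" "P * P' = 1\<^sub>m d"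
      and Qc: "Q \<in> carrier_mat d d" "Q' \<in> carrier_mat d d" "Q * Q' = 1\<^sub>m d" "Q' * Q = 1\<^sub>m d"
      using P Q by (auto simp: inv_pair_def)
    have Jc: "J \<in> carrier_mat d d" by (simp add: J_def)
    have "k \<noteq> 0"
    proof
      assume "k = 0"
      then have "J = 0\<^sub>m d d" by (intro eq_matI) (auto simp: J_def rank_mat_def)
      then show False using T(2) Pc Qc unfolding TJ J_def[symmetric] by simp
    qed
    then have ld: "l < d" using k by (simp add: l_def)
    have P'inv: "inv_pair d P' P" using P by (auto simp: inv_pair_def)
    define M1 where "M1 g = Q * M g * Q'" for g
    define N1 where "N1 g = P' * N g * P" for g
    have M1: "mat_rep G d M1" unfolding M1_def by (rule mat_rep_conj[OF M Q])
    have N1: "mat_rep G d N1" unfolding N1_def by (rule mat_rep_conj[OF N P'inv])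
    have simM: "similar_mat_wit (M1 g) (M g) Q Q'" if "g \<in> carrier G" for g
      unfolding M1_def by (rule inv_pair_similar[OF Q mat_repD(1)[OF M that]])
    have simN: "similar_mat_wit (N1 g) (N g) P' P" if "g \<in> carrier G" for g
      unfolding N1_def by (rule inv_pair_similar[OF P'inv mat_repD(1)[OF N that]])
    have inter: "N1 g * J = J * M1 g" if g: "g \<in> carrier G" for g
    proof -
      note Mg = mat_repD(1)[OF M g] and Ng = mat_repD(1)[OF N g]
      have T': "T = P * (J * Q)" unfolding TJ J_def[symmetric] using Pc Qc Jc by simp
      have "P' * (N g * T) * Q' = P' * (T * M g) * Q'" by (simp only: TM[OF g])
      moreover have "P' * (N g * T) * Q' = N1 g * J * (Q * Q')"
        unfolding T' N1_def using Pc(1,2) Qc(1,2) Jc Ng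
        by (simp add: assoc_mult_mat[of _ d d _ d _ d])
      moreover have "P' * (T * M g) * Q' = (P' * P) * (J * M1 g)"
        unfolding T' M1_def using Pc(1,2) Qc(1,2) Jc Mg
        by (simp add: assoc_mult_mat[of _ d d _ d _ d])
      ultimately show ?thesis
        unfolding Qc(3) Pc(3) using Jc mat_repD(1)[OF N1 g] mat_repD(1)[OF M1 g] by simp
    qed
    have NJ: "(N1 g * J) $$ (i, j) = (if j < k then N1 g $$ (i, j) else 0)"
      if "g \<in> carrier G" "i < d" "j < d" for g i j
    proof -
      have "(N1 g * J) $$ (i, j) = (\<Sum>p<d. if p = j then (if j < k then N1 g $$ (i, j) else 0) else 0)"
        unfolding mult_mat_index[OF mat_repD(1)[OF N1 that(1)] Jc that(2,3)]
        using that by (intro sum.cong) (auto simp: J_def rank_mat_def)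
      then show ?thesis using that by simp
    qed
    have JM: "(J * M1 g) $$ (i, j) = (if i < k then M1 g $$ (i, j) else 0)"
      if "g \<in> carrier G" "i < d" "j < d" for g i j
    proof -
      have "(J * M1 g) $$ (i, j) = (\<Sum>p<d. if p = i then (if i < k then M1 g $$ (i, j) else 0) else 0)"
        unfolding mult_mat_index[OF Jc mat_repD(1)[OF M1 that(1)] that(2,3)]
        using that by (intro sum.cong) (auto simp: J_def rank_mat_def)
      then show ?thesis using that by simp
    qed
    \<comment> \<open>Comparing both sides of \<open>N1 g * J = J * M1 g\<close> entry by entry: the
      upper left corners coincide, and the lower left corner of \<open>N1 g\<close> and the upper
      right corner of \<open>M1 g\<close> vanish.\<close>
    have entry: "(if j < k then N1 g $$ (i, j) else 0) = (if i < k then M1 g $$ (i, j) else 0)"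
      if "g \<in> carrier G" "i < d" "j < d" for g i j
      using NJ[OF that] JM[OF that] inter[OF that(1)] by simp
    define A where "A g = mat k k (\<lambda>(i, j). M1 g $$ (i, j))" for g
    define C where "C g = mat l k (\<lambda>(i, j). M1 g $$ (i + k, j))" for g
    define D where "D g = mat l l (\<lambda>(i, j). M1 g $$ (i + k, j + k))" for g
    define B where "B g = mat k l (\<lambda>(i, j). N1 g $$ (i, j + k))" for g
    define E where "E g = mat l l (\<lambda>(i, j). N1 g $$ (i + k, j + k))" for g
    have cs: "A g \<in> carrier_mat k k" "C g \<in> carrier_mat l k" "D g \<in> carrier_mat l l"
      "B g \<in> carrier_mat k l" "E g \<in> carrier_mat l l" for g
      by (simp_all add: A_def B_def C_def D_def E_def)
    have MB: "M1 g = four_block_mat (A g) (0\<^sub>m k l) (C g) (D g)" if g: "g \<in> carrier G" for g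
    proof (rule eq_matI)
      fix i j assume "i < dim_row (four_block_mat (A g) (0\<^sub>m k l) (C g) (D g))"
        "j < dim_col (four_block_mat (A g) (0\<^sub>m k l) (C g) (D g))"
      then have ij: "i < d" "j < d" using cs[of g] d by auto
      show "M1 g $$ (i, j) = four_block_mat (A g) (0\<^sub>m k l) (C g) (D g) $$ (i, j)"
        using ij d entry[OF g ij] cs[of g] by (auto simp: A_def C_def D_def)
    qed (use mat_repD(1)[OF M1 g] cs[of g] d in auto)
    have NB: "N1 g = four_block_mat (A g) (B g) (0\<^sub>m l k) (E g)" if g: "g \<in> carrier G" for g
    proof (rule eq_matI)
      fix i j assume "i < dim_row (four_block_mat (A g) (B g) (0\<^sub>m l k) (E g))"
        "j < dim_col (four_block_mat (A g) (B g) (0\<^sub>m l k) (E g))"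
      then have ij: "i < d" "j < d" using cs[of g] d by auto
      show "N1 g $$ (i, j) = four_block_mat (A g) (B g) (0\<^sub>m l k) (E g) $$ (i, j)"
        using ij d entry[OF g ij] cs[of g] by (auto simp: A_def B_def E_def split: if_splits)
    qed (use mat_repD(1)[OF N1 g] cs[of g] d in auto)
    have "mat_rep G (k + l) (\<lambda>g. four_block_mat (A g) (0\<^sub>m k l) (C g) (D g))"
      using M1 MB unfolding mat_rep_def d by simp
    note lower = mat_rep_lower_block[OF this cs(1,2,3)]
    have "mat_rep G (k + l) (\<lambda>g. four_block_mat (A g) (B g) (0\<^sub>m l k) (E g))"
      using N1 NB unfolding mat_rep_def d by simp
    note upper = mat_rep_upper_block[OF this cs(1,4,5)]
    obtain X where X: "X \<in> carrier_mat l k" "\<And>h. h \<in> carrier G \<Longrightarrow> C h = X * A h - D h * X"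
      using cocycle_splits[OF fin lower(1,2) cs(2) lower(3)] by auto
    obtain Y where Y: "Y \<in> carrier_mat k l" "\<And>h. h \<in> carrier G \<Longrightarrow> B h = Y * E h - A h * Y"
      using cocycle_splits[OF fin upper(2,1) cs(4) upper(3)] by auto
    have "mtrace (D g) = mtrace (E g)" if g: "g \<in> carrier G" for g
    proof -
      have "mtrace (A g) + mtrace (D g) = mtrace (M1 g)"
        unfolding MB[OF g] mtrace_four_block[OF cs(1,3)] ..
      also have "\<dots> = mtrace (N1 g)"
        using mtrace_similar[OF simM[OF g]] mtrace_similar[OF simN[OF g]] ch[OF g] by simp
      also have "\<dots> = mtrace (A g) + mtrace (E g)"
        unfolding NB[OF g] mtrace_four_block[OF cs(1,5)] ..
      finally show ?thesis by simp
    qed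
    then obtain R R' where R: "\<And>g. g \<in> carrier G \<Longrightarrow> similar_mat_wit (E g) (D g) R R'"
      using less.IH[OF ld lower(2) upper(2)] by blast
    define U where "U = four_block_mat (1\<^sub>m k) (0\<^sub>m k l) X (1\<^sub>m l)"
    define U' where "U' = four_block_mat (1\<^sub>m k) (0\<^sub>m k l) (- X) (1\<^sub>m l)"
    define V where "V = four_block_mat (1\<^sub>m k) Y (0\<^sub>m l k) (1\<^sub>m l)"
    define V' where "V' = four_block_mat (1\<^sub>m k) (- Y) (0\<^sub>m l k) (1\<^sub>m l)"
    define W where "W = four_block_mat (1\<^sub>m k) (0\<^sub>m k l) (0\<^sub>m l k) R"
    define W' where "W' = four_block_mat (1\<^sub>m k) (0\<^sub>m k l) (0\<^sub>m l k) R'"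
    \<comment> \<open>The chain runs from \<open>N g\<close> over \<open>N1 g\<close>, the diagonal
      blocks \<open>A g, E g\<close>, the diagonal blocks \<open>A g, D g\<close>, and
      \<open>M1 g\<close> to \<open>M g\<close>. None of the transition matrices depends on
      \<open>g\<close>, which is what equivalence demands beyond similarity of each single
      matrix.\<close>
    have "similar_mat_wit (N g) (M g) (P * (V * (W * (U' * Q)))) ((((Q' * U) * W') * V') * P')"
      if g: "g \<in> carrier G" for g
    proof -
      have 1: "similar_mat_wit (N g) (N1 g) P P'" by (rule similar_mat_wit_sym[OF simN[OF g]])
      have 2: "similar_mat_wit (N1 g) (four_block_mat (A g) (0\<^sub>m k l) (0\<^sub>m l k) (E g)) V V'"
        unfolding NB[OF g] V_def V'_def Y(2)[OF g] by (rule similar_upper_block[OF cs(1,5) Y(1)])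
      have "similar_mat_wit (M1 g) (four_block_mat (A g) (0\<^sub>m k l) (0\<^sub>m l k) (D g)) U U'"
        unfolding MB[OF g] U_def U'_def X(2)[OF g] by (rule similar_lower_block[OF cs(1,3) X(1)])
      from similar_mat_wit_sym[OF this]
      have 4: "similar_mat_wit (four_block_mat (A g) (0\<^sub>m k l) (0\<^sub>m l k) (D g)) (M1 g) U' U" .
      note Rw = similar_mat_witD2[OF cs(5) R[OF g]]
      have 3: "similar_mat_wit (four_block_mat (A g) (0\<^sub>m k l) (0\<^sub>m l k) (E g))
          (four_block_mat (A g) (0\<^sub>m k l) (0\<^sub>m l k) (D g)) W W'"
        unfolding W_def W'_def
        by (rule similar_mat_wit_four_block[OF similar_mat_wit_refl[OF cs(1)] R[OF g] _ _ cs(1,5)])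
          (use Rw in auto)
      show ?thesis
        using similar_mat_wit_trans[OF 1 similar_mat_wit_trans[OF 2 similar_mat_wit_trans[OF 3
              similar_mat_wit_trans[OF 4 simM[OF g]]]]] .
    qed
    then show ?thesis by blast
  qed
qed

end

section \<open>Traces of words from the determinant of the pencil\<close>

definition monom_eval :: "(nat \<Rightarrow> complex) \<Rightarrow> (nat \<Rightarrow>\<^sub>0 nat) \<Rightarrow> complex" where
  "monom_eval a m = (\<Prod>i\<in>Poly_Mapping.keys m. a i ^ Poly_Mapping.lookup m i)"

definition cpoly_eval :: "(nat \<Rightarrow> complex) \<Rightarrow> cpoly \<Rightarrow> complex" where
  "cpoly_eval a p = (\<Sum>m\<in>Poly_Mapping.keys p. Poly_Mapping.lookup p m * monom_eval a m)"

lemma monom_eval_superset: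
  "finite S \<Longrightarrow> Poly_Mapping.keys m \<subseteq> S \<Longrightarrow> monom_eval a m = (\<Prod>i\<in>S. a i ^ Poly_Mapping.lookup m i)"
  unfolding monom_eval_def by (intro prod.mono_neutral_left) (auto simp: in_keys_iff)

lemma monom_eval_add: "monom_eval a (m + m') = monom_eval a m * monom_eval a m'"
proof -
  let ?S = "Poly_Mapping.keys m \<union> Poly_Mapping.keys m'"
  have "monom_eval a (m + m') = (\<Prod>i\<in>?S. a i ^ Poly_Mapping.lookup (m + m') i)"
    by (rule monom_eval_superset) (use Poly_Mapping.keys_add[of m m'] in auto)
  moreover have "monom_eval a m = (\<Prod>i\<in>?S. a i ^ Poly_Mapping.lookup m i)"
    "monom_eval a m' = (\<Prod>i\<in>?S. a i ^ Poly_Mapping.lookup m' i)"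
    by (intro monom_eval_superset; auto)+
  ultimately show ?thesis by (simp add: lookup_add power_add prod.distrib)
qed

lemma cpoly_eval_superset:
  "finite S \<Longrightarrow> Poly_Mapping.keys p \<subseteq> S \<Longrightarrow>
    cpoly_eval a p = (\<Sum>m\<in>S. Poly_Mapping.lookup p m * monom_eval a m)"
  unfolding cpoly_eval_def by (intro sum.mono_neutral_left) (auto simp: in_keys_iff)

lemma cpoly_eval_add: "cpoly_eval a (p + q) = cpoly_eval a p + cpoly_eval a q"
proof -
  let ?S = "Poly_Mapping.keys p \<union> Poly_Mapping.keys q"
  have "cpoly_eval a (p + q) = (\<Sum>m\<in>?S. Poly_Mapping.lookup (p + q) m * monom_eval a m)"
    by (rule cpoly_eval_superset) (use Poly_Mapping.keys_add[of p q] in auto)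
  moreover have "cpoly_eval a p = (\<Sum>m\<in>?S. Poly_Mapping.lookup p m * monom_eval a m)"
    "cpoly_eval a q = (\<Sum>m\<in>?S. Poly_Mapping.lookup q m * monom_eval a m)"
    by (intro cpoly_eval_superset; auto)+
  ultimately show ?thesis by (simp add: lookup_add distrib_right sum.distrib)
qed

lemma cpoly_eval_zero [simp]: "cpoly_eval a 0 = 0"
  by (simp add: cpoly_eval_def)

lemma cpoly_eval_single: "cpoly_eval a (Poly_Mapping.single m c) = c * monom_eval a m"
  by (simp add: cpoly_eval_def)

lemma cpoly_eval_sum: "cpoly_eval a (sum f S) = (\<Sum>x\<in>S. cpoly_eval a (f x))"
  by (induction S rule: infinite_finite_induct) (auto simp: cpoly_eval_add)

lemma cpoly_eq_sum_singles:
  "(p :: cpoly) = (\<Sum>m\<in>Poly_Mapping.keys p. Poly_Mapping.single m (Poly_Mapping.lookup p m))"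
  by (rule poly_mapping_eqI)
    (auto simp: lookup_sum lookup_single when_def in_keys_iff)

lemma cpoly_eval_mult: "cpoly_eval a (p * q) = cpoly_eval a p * cpoly_eval a q"
proof -
  have "p * q = (\<Sum>m\<in>Poly_Mapping.keys p. \<Sum>m'\<in>Poly_Mapping.keys q.
      Poly_Mapping.single (m + m') (Poly_Mapping.lookup p m * Poly_Mapping.lookup q m'))"
    unfolding mult_single[symmetric] sum_product[symmetric]
    by (rule arg_cong2[where f = "(*)", OF cpoly_eq_sum_singles cpoly_eq_sum_singles])
  then show ?thesis
    by (simp add: cpoly_eval_sum cpoly_eval_single monom_eval_add cpoly_eval_def[of a p]
        cpoly_eval_def[of a q] sum_product mult_ac)
qed

lemma cpoly_eval_const [simp]: "cpoly_eval a (const_poly c) = c"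
  by (simp add: const_poly_def cpoly_eval_single monom_eval_def)

lemma cpoly_eval_var [simp]: "cpoly_eval a (var_poly i) = a i"
  by (simp add: var_poly_def cpoly_eval_single monom_eval_def)

lemma cpoly_eval_hom: "comm_ring_hom (cpoly_eval a)"
proof
  show "cpoly_eval a 1 = 1" using cpoly_eval_const[of a 1] unfolding const_poly_def by simp
qed (simp_all add: cpoly_eval_add cpoly_eval_mult)

definition lincomb_mat :: "nat \<Rightarrow> nat \<Rightarrow> (nat \<Rightarrow> complex mat) \<Rightarrow> (nat \<Rightarrow> complex) \<Rightarrow> complex mat" where
  "lincomb_mat d n A a = mat d d (\<lambda>(r, c). \<Sum>i\<le>n. a i * A i $$ (r, c))"

lemma lincomb_mat_carrier [simp]: "lincomb_mat d n A a \<in> carrier_mat d d"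
  by (simp add: lincomb_mat_def)

lemma cpoly_eval_pencil:
  "cpoly_eval a (det (mat d d (\<lambda>(r, c). \<Sum>i\<le>n. var_poly i * const_poly (A i $$ (r, c)))))
    = det (lincomb_mat d n A a)"
proof -
  interpret comm_ring_hom "cpoly_eval a" by (rule cpoly_eval_hom)
  show ?thesis
    unfolding hom_det[symmetric]
    by (intro arg_cong[of _ _ det] eq_matI)
      (auto simp: lincomb_mat_def cpoly_eval_sum cpoly_eval_mult)
qed

lemma sum_indicator_zero:
  "(\<Sum>i\<le>(n::nat). (if i = 0 then x else 0) * f i) = (x * f 0 :: 'a :: comm_semiring_1)"
  by (induction n) auto

text \<open>The identity matrix at index \<open>0\<close> lets the first variable absorb the
  spectral parameter. The coefficient \<open>a 0\<close> is kept all the same, so that the identity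
  remains a letter of the words below, as type A requires.\<close>

lemma poly_char_poly_lincomb:
  assumes "A 0 = 1\<^sub>m d"
  shows "poly (char_poly (lincomb_mat d n A a)) x = det (lincomb_mat d n A (\<lambda>i. (if i = 0 then x else 0) - a i))"
proof -
  have "poly (char_poly (lincomb_mat d n A a)) x =
      det (- char_matrix (lincomb_mat d n A a) x)"
    by (rule char_poly_matrix[OF lincomb_mat_carrier])
  also have "- char_matrix (lincomb_mat d n A a) x = lincomb_mat d n A (\<lambda>i. (if i = 0 then x else 0) - a i)"
    unfolding char_matrix_def
    by (rule eq_matI)
      (auto simp: lincomb_mat_def assms left_diff_distrib sum_subtractf sum_indicator_zero)
  finally show ?thesis .
qed

lemma det_lincomb_single:
  assumes "A 0 = 1\<^sub>m d"
  shows "det (lincomb_mat d n A (\<lambda>i. if i = 0 then x else 0)) = x ^ d"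
proof -
  have "lincomb_mat d n A (\<lambda>i. if i = 0 then x else 0) = x \<cdot>\<^sub>m 1\<^sub>m d"
    by (rule eq_matI) (auto simp: lincomb_mat_def assms sum_indicator_zero)
  then show ?thesis by (simp add: det_smult)
qed

text \<open>On the line where only the first coordinate is nonzero, the determinants are
  \<open>x ^ d\<close> and \<open>x ^ e\<close>. The value at 1 shows that the projective scalar is
  1, the value at 2 that the dimensions agree; then the characteristic polynomials coincide.\<close>

lemma pencils_agree:
  assumes A: "A 0 = 1\<^sub>m d" and B: "B 0 = 1\<^sub>m e" and c: "c \<noteq> 0"
    and eq: "\<And>a. det (lincomb_mat d n A a) = c * det (lincomb_mat e n B a)"
  shows "d = e" "\<And>a k. mtrace (lincomb_mat d n A a ^\<^sub>m k) = mtrace (lincomb_mat e n B a ^\<^sub>m k)"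
proof -
  have pow: "x ^ d = c * x ^ e" for x
    using eq[of "\<lambda>i. if i = 0 then x else 0"] by (simp add: det_lincomb_single A B)
  have c1: "c = 1" using pow[of 1] by simp
  have "(2 :: complex) ^ d = 2 ^ e" using pow[of 2] c1 by simp
  then have "of_nat (2 ^ d) = (of_nat (2 ^ e) :: complex)" by simp
  then have "(2 :: nat) ^ d = 2 ^ e" unfolding of_nat_eq_iff .
  then show "d = e" by simp
  fix a k
  have "poly (char_poly (lincomb_mat d n A a)) x = poly (char_poly (lincomb_mat e n B a)) x" for x
    unfolding poly_char_poly_lincomb[of A, OF A] poly_char_poly_lincomb[of B, OF B] eq c1 by simp
  then have cp: "char_poly (lincomb_mat d n A a) = char_poly (lincomb_mat e n B a)"
    using poly_eq_poly_eq_iff by blast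
  obtain es where es: "char_poly (lincomb_mat d n A a) = (\<Prod>e\<leftarrow>es. [:- e, 1:])"
    using char_poly_factorized[OF lincomb_mat_carrier] by blast
  show "mtrace (lincomb_mat d n A a ^\<^sub>m k) = mtrace (lincomb_mat e n B a ^\<^sub>m k)"
    using mtrace_pow[OF lincomb_mat_carrier es] mtrace_pow[OF lincomb_mat_carrier es[unfolded cp]] by simp
qed

section \<open>Powers of a linear combination as sums over words\<close>

primrec word_mat :: "nat \<Rightarrow> ('i \<Rightarrow> 'a :: comm_ring_1 mat) \<Rightarrow> 'i list \<Rightarrow> 'a mat" where
  "word_mat d A [] = 1\<^sub>m d"
| "word_mat d A (i # w) = A i * word_mat d A w"

lemma word_mat_carrier: "(\<And>i. i \<in> set w \<Longrightarrow> A i \<in> carrier_mat d d) \<Longrightarrow> word_mat d A w \<in> carrier_mat d d"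
  by (induction w) (auto intro: mult_carrier_mat)

lemma pow_mat_Suc_left: "A \<in> carrier_mat d d \<Longrightarrow> A ^\<^sub>m Suc k = A * A ^\<^sub>m k"
proof (induction k)
  case (Suc k)
  have "A ^\<^sub>m Suc (Suc k) = (A * A ^\<^sub>m k) * A" using Suc by simp
  also have "\<dots> = A * (A ^\<^sub>m k * A)"
    by (rule assoc_mult_mat[OF Suc.prems pow_carrier_mat[OF Suc.prems] Suc.prems])
  finally show ?case by simp
qed simp

lemma lincomb_mat_pow_index:
  assumes A: "\<And>i. i \<le> n \<Longrightarrow> A i \<in> carrier_mat d d" and r: "r < d" and c: "c < d"
  shows "(lincomb_mat d n A a ^\<^sub>m k) $$ (r, c) =
    (\<Sum>w | set w \<subseteq> {..n} \<and> length w = k. prod_list (map a w) * word_mat d A w $$ (r, c))"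
  using r
proof (induction k arbitrary: r)
  case 0
  have "{w. set w \<subseteq> {..n} \<and> length w = 0} = {[]}" by auto
  then show ?case using 0 c by (simp add: lincomb_mat_def)
next
  case (Suc k)
  let ?X = "lincomb_mat d n A a" and ?W = "\<lambda>k. {w. set w \<subseteq> {..n} \<and> length w = k}"
  have wc: "word_mat d A w \<in> carrier_mat d d" if "w \<in> ?W k" for w
    by (rule word_mat_carrier) (use that A in auto)
  have W: "?W (Suc k) = (\<lambda>(i, w). i # w) ` ({..n} \<times> ?W k)"
    by (auto simp: image_iff length_Suc_conv)
  have inj: "inj_on (\<lambda>(i, w). i # w) ({..n} \<times> ?W k)" by (auto simp: inj_on_def)
  have "(?X ^\<^sub>m Suc k) $$ (r, c) = (\<Sum>p<d. ?X $$ (r, p) * (?X ^\<^sub>m k) $$ (p, c))"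
    unfolding pow_mat_Suc_left[OF lincomb_mat_carrier]
    by (rule mult_mat_index[OF lincomb_mat_carrier pow_carrier_mat[OF lincomb_mat_carrier] Suc.prems c])
  also have "\<dots> = (\<Sum>p<d. \<Sum>i\<le>n. \<Sum>w\<in>?W k. a i * A i $$ (r, p) * (prod_list (map a w) * word_mat d A w $$ (p, c)))"
  proof (rule sum.cong[OF HOL.refl])
    fix p assume "p \<in> {..<d}"
    then have p: "p < d" by simp
    show "?X $$ (r, p) * (?X ^\<^sub>m k) $$ (p, c) =
        (\<Sum>i\<le>n. \<Sum>w\<in>?W k. a i * A i $$ (r, p) * (prod_list (map a w) * word_mat d A w $$ (p, c)))"
      unfolding Suc.IH[OF p] using p Suc.prems
      by (simp add: lincomb_mat_def sum_product)
  qed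
  also have "\<dots> = (\<Sum>i\<le>n. \<Sum>w\<in>?W k. \<Sum>p<d. a i * A i $$ (r, p) * (prod_list (map a w) * word_mat d A w $$ (p, c)))"
    by (subst sum.swap, rule sum.cong[OF HOL.refl], rule sum.swap)
  also have "\<dots> = (\<Sum>i\<le>n. \<Sum>w\<in>?W k. prod_list (map a (i # w)) * word_mat d A (i # w) $$ (r, c))"
  proof (rule sum.cong[OF HOL.refl], rule sum.cong[OF HOL.refl])
    fix i w assume iw: "i \<in> {..n}" "w \<in> ?W k"
    have "word_mat d A (i # w) $$ (r, c) = (\<Sum>p<d. A i $$ (r, p) * word_mat d A w $$ (p, c))"
      unfolding word_mat.simps
      by (rule mult_mat_index[OF A wc Suc.prems c]) (use iw in auto)
    then show "(\<Sum>p<d. a i * A i $$ (r, p) * (prod_list (map a w) * word_mat d A w $$ (p, c))) =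
        prod_list (map a (i # w)) * word_mat d A (i # w) $$ (r, c)"
      by (simp add: sum_distrib_left mult_ac del: word_mat.simps)
  qed
  also have "\<dots> = (\<Sum>(i, w)\<in>{..n} \<times> ?W k. prod_list (map a (i # w)) * word_mat d A (i # w) $$ (r, c))"
    by (rule sum.cartesian_product)
  also have "\<dots> = (\<Sum>w\<in>?W (Suc k). prod_list (map a w) * word_mat d A w $$ (r, c))"
    unfolding W by (subst sum.reindex[OF inj]) (simp add: case_prod_unfold comp_def del: word_mat.simps)
  finally show ?case .
qed

lemma mtrace_lincomb_pow:
  assumes A: "\<And>i. i \<le> n \<Longrightarrow> A i \<in> carrier_mat d d"
  shows "mtrace (lincomb_mat d n A a ^\<^sub>m k) =
    (\<Sum>w | set w \<subseteq> {..n} \<and> length w = k. prod_list (map a w) * mtrace (word_mat d A w))"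
proof -
  have "mtrace (lincomb_mat d n A a ^\<^sub>m k) =
      (\<Sum>r<d. \<Sum>w | set w \<subseteq> {..n} \<and> length w = k. prod_list (map a w) * word_mat d A w $$ (r, r))"
    unfolding mtrace_def using carrier_matD[OF lincomb_mat_carrier, of d n A a]
    by (intro sum.cong) (auto simp: lincomb_mat_pow_index[OF A])
  also have "\<dots> = (\<Sum>w | set w \<subseteq> {..n} \<and> length w = k. \<Sum>r<d. prod_list (map a w) * word_mat d A w $$ (r, r))"
    by (rule sum.swap)
  also have "\<dots> = (\<Sum>w | set w \<subseteq> {..n} \<and> length w = k. prod_list (map a w) * mtrace (word_mat d A w))"
  proof (rule sum.cong[OF HOL.refl])
    fix w assume "w \<in> {w. set w \<subseteq> {..n} \<and> length w = k}"
    then have "word_mat d A w \<in> carrier_mat d d" by (intro word_mat_carrier A) auto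
    then show "(\<Sum>r<d. prod_list (map a w) * word_mat d A w $$ (r, r)) = prod_list (map a w) * mtrace (word_mat d A w)"
      by (simp add: mtrace_def sum_distrib_left)
  qed
  finally show ?thesis .
qed

text \<open>The weight is a numeral in base \<open>b\<close> whose digits are the multiplicities of
  the letters. These are at most the length, hence below \<open>b\<close>, and no carry occurs. The
  induction strips the lowest digit and shifts the letters down.\<close>

lemma base_weight_inj:
  assumes "length v < b" "length w < b" "\<forall>x\<in>set v \<union> set w. x < m"
    and "(\<Sum>i\<leftarrow>v. b ^ i) = (\<Sum>i\<leftarrow>w. b ^ i)"
  shows "mset v = mset w"
  using assms
proof (induction m arbitrary: v w)
  case 0
  then show ?case by (cases v; cases w) auto
next
  case (Suc m)
  define dec where "dec u = map (\<lambda>i. i - 1) (filter (\<lambda>i. i \<noteq> 0) u)" for u :: "nat list"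
  have split: "(\<Sum>i\<leftarrow>u. b ^ i) = count_list u 0 + b * (\<Sum>i\<leftarrow>dec u. b ^ i)" for u
  proof (induction u)
    case (Cons x u)
    then show ?case by (cases x) (auto simp: dec_def algebra_simps)
  qed (simp add: dec_def)
  have cnt: "count_list u (Suc i) = count_list (dec u) i" for u i
    by (induction u) (auto simp: dec_def)
  have len: "length (dec u) \<le> length u" for u by (simp add: dec_def)
  have le: "count_list u 0 \<le> length u" for u :: "nat list" by (rule count_le_length)
  have b: "count_list v 0 < b" "count_list w 0 < b"
    using le[of v] le[of w] Suc.prems(1,2) by linarith+
  have e: "count_list v 0 + b * (\<Sum>i\<leftarrow>dec v. b ^ i) = count_list w 0 + b * (\<Sum>i\<leftarrow>dec w. b ^ i)"
    unfolding split[symmetric] by (rule Suc.prems(4))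
  have z: "count_list v 0 = count_list w 0" using arg_cong[OF e, of "\<lambda>x. x mod b"] b by simp
  moreover have "mset (dec v) = mset (dec w)"
  proof (rule Suc.IH)
    show "length (dec v) < b" "length (dec w) < b"
      using Suc.prems(1,2) len[of v] len[of w] by linarith+
    show "\<forall>x\<in>set (dec v) \<union> set (dec w). x < m" using Suc.prems(3) by (auto simp: dec_def)
    show "(\<Sum>i\<leftarrow>dec v. b ^ i) = (\<Sum>i\<leftarrow>dec w. b ^ i)" using e z b by simp
  qed
  then have "count_list v (Suc i) = count_list w (Suc i)" for i
    by (metis cnt count_mset)
  ultimately have "count (mset v) i = count (mset w) i" for i
    by (cases i) (simp_all add: count_mset)
  then show ?case by (rule multiset_eqI)
qed

text \<open>Kronecker's substitution \<open>a\<^sub>i = z^(b^i)\<close> separates the contents of the words of length less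
  than \<open>b\<close>.\<close>

lemma content_sums_vanish:
  fixes \<phi> :: "nat list \<Rightarrow> complex"
  assumes "\<And>a k. (\<Sum>w | set w \<subseteq> {..n} \<and> length w = k. prod_list (map a w) * \<phi> w) = 0"
  shows "(\<Sum>w | set w \<subseteq> {..n} \<and> mset w = C. \<phi> w) = 0"
proof (cases "\<exists>v. set v \<subseteq> {..n} \<and> mset v = C")
  case False
  then have "{w. set w \<subseteq> {..n} \<and> mset w = C} = {}" by blast
  then show ?thesis by (simp only: sum.empty)
next
  case True
  then obtain v where v: "set v \<subseteq> {..n}" "mset v = C" by blast
  define k where "k = length v"
  \<comment> \<open>Only words of length \<open>k\<close> are compared, so this base exceeds every
    multiplicity.\<close>
  define b where "b = Suc k"
  define wt where "wt w = (\<Sum>i\<leftarrow>w. b ^ i)" for w :: "nat list"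
  have wt_mset: "wt w = sum_mset (image_mset (\<lambda>i. b ^ i) (mset w))" for w
    unfolding wt_def mset_map[symmetric] sum_mset_sum_list ..
  define W where "W = {w. set w \<subseteq> {..n} \<and> length w = k}"
  have fin: "finite W" unfolding W_def by (rule finite_lists_length_eq) simp
  \<comment> \<open>The assumption makes this polynomial vanish at every point, and its coefficient
    at \<open>wt v\<close> is the content sum in question.\<close>
  define p where "p = (\<Sum>w\<in>W. Polynomial.monom (\<phi> w) (wt w))"
  have "poly p z = 0" for z
  proof -
    have "prod_list (map (\<lambda>i. z ^ b ^ i) w) = z ^ wt w" for w
      unfolding wt_def by (induction w) (auto simp: power_add)
    then show ?thesis using assms[of "\<lambda>i. z ^ b ^ i" k]
      by (simp add: p_def poly_sum poly_monom W_def mult.commute)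
  qed
  then have "p = 0" using poly_eq_poly_eq_iff[of p 0] by auto
  then have "0 = Polynomial.coeff p (wt v)" by simp
  also have "\<dots> = (\<Sum>w\<in>W. if wt w = wt v then \<phi> w else 0)"
    by (simp add: p_def Polynomial.coeff_sum)
  also have "\<dots> = (\<Sum>w | w \<in> W \<and> wt w = wt v. \<phi> w)"
    using fin by (simp add: sum.inter_filter)
  also have "{w. w \<in> W \<and> wt w = wt v} = {w. set w \<subseteq> {..n} \<and> mset w = C}"
  proof (intro Collect_cong iffI)
    fix w assume w: "w \<in> W \<and> wt w = wt v"
    then have "mset w = mset v" using v
      by (intro base_weight_inj[of w b v "Suc n"]) (auto simp: W_def wt_def b_def k_def less_Suc_eq_le)
    then show "set w \<subseteq> {..n} \<and> mset w = C" using w v by (simp add: W_def)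
  next
    fix w assume w: "set w \<subseteq> {..n} \<and> mset w = C"
    then have m: "mset w = mset v" using v by simp
    then have "length w = k" unfolding k_def by (rule mset_eq_length)
    moreover have "wt w = wt v" using m by (simp add: wt_mset)
    ultimately show "w \<in> W \<and> wt w = wt v" using w by (simp add: W_def)
  qed
  finally show ?thesis by simp
qed

section \<open>Matrices of a representation\<close>

locale based_space = vector_space scale
  for scale :: "complex \<Rightarrow> 'v \<Rightarrow> 'v :: ab_group_add" +
  fixes bs :: "'v list"
  assumes basis: "ordered_basis scale bs"
begin

abbreviation "dm \<equiv> length bs"

definition coords :: "'v \<Rightarrow> complex vec" where
  "coords v = vec dm (\<lambda>i. representation (set bs) v (bs ! i))"

definition comb :: "complex vec \<Rightarrow> 'v" where
  "comb x = (\<Sum>i<dm. scale (x $ i) (bs ! i))"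

lemma basis_facts: "distinct bs" "independent (set bs)" "span (set bs) = UNIV"
  using basis by (auto simp: ordered_basis_def)

lemma span_bs [simp]: "v \<in> span (set bs)"
  by (simp add: basis_facts)

lemma coords_carrier [simp]: "coords v \<in> carrier_vec dm" "dim_vec (coords v) = dm"
  by (simp_all add: coords_def)

lemma coords_add: "coords (v + w) = coords v + coords w"
  by (rule eq_vecI) (simp_all add: coords_def representation_add[OF basis_facts(2)])

lemma coords_scale: "coords (scale c v) = c \<cdot>\<^sub>v coords v"
  by (rule eq_vecI) (simp_all add: coords_def representation_scale[OF basis_facts(2)])

lemma coords_basis: "i < dm \<Longrightarrow> j < dm \<Longrightarrow> coords (bs ! i) $ j = (if i = j then 1 else 0)"
  by (simp add: coords_def representation_basis[OF basis_facts(2)] nth_eq_iff_index_eq[OF basis_facts(1)])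

lemma comb_coords [simp]: "comb (coords v) = v"
proof -
  have "comb (coords v) = (\<Sum>i<dm. scale (representation (set bs) v (bs ! i)) (bs ! i))"
    by (simp add: comb_def coords_def)
  also have "\<dots> = (\<Sum>b\<in>set bs. scale (representation (set bs) v b) b)"
    by (rule sum.reindex_bij_betw[OF bij_betw_nth[OF basis_facts(1) HOL.refl HOL.refl]])
  also have "\<dots> = v" by (rule sum_representation_eq) (simp_all add: basis_facts)
  finally show ?thesis .
qed

lemma coords_sum: "finite S \<Longrightarrow> j < dm \<Longrightarrow> coords (\<Sum>i\<in>S. f i) $ j = (\<Sum>i\<in>S. coords (f i) $ j)"
proof (induction S rule: finite_induct)
  case empty
  then show ?case by (simp add: coords_def representation_zero)
next
  case (insert x S)
  then show ?case by (simp add: coords_add)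
qed

lemma coords_comb [simp]:
  assumes "x \<in> carrier_vec dm"
  shows "coords (comb x) = x"
proof (rule eq_vecI)
  fix j assume "j < dim_vec x"
  then have j: "j < dm" using assms by simp
  have "coords (comb x) $ j = (\<Sum>i<dm. if i = j then x $ i else 0)"
    unfolding comb_def using j
    by (subst coords_sum) (auto simp: coords_scale coords_basis if_distrib[of "\<lambda>y. z * y" for z] cong: if_cong)
  then show "coords (comb x) $ j = x $ j" using j by simp
qed (use assms in simp)

lemma coords_inject: "coords v = coords w \<Longrightarrow> v = w"
  by (metis comb_coords)

lemma coords_linear:
  assumes "Vector_Spaces.linear scale scale f"
  shows "coords (f v) = matrix_wrt scale bs f *\<^sub>v coords v"
proof (rule eq_vecI)
  interpret f: Vector_Spaces.linear scale scale f by fact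
  fix r assume "r < dim_vec (matrix_wrt scale bs f *\<^sub>v coords v)"
  then have r: "r < dm" by (simp add: matrix_wrt_def)
  have "f v = f (comb (coords v))" by simp
  also have "\<dots> = (\<Sum>i<dm. scale (coords v $ i) (f (bs ! i)))"
    unfolding comb_def by (simp add: f.sum f.scale)
  finally have "coords (f v) $ r = (\<Sum>i<dm. coords v $ i * coords (f (bs ! i)) $ r)"
    using r by (simp add: coords_sum coords_scale)
  also have "\<dots> = (\<Sum>i<dm. matrix_wrt scale bs f $$ (r, i) * coords v $ i)"
    using r by (intro sum.cong) (auto simp: matrix_wrt_def coords_def)
  also have "\<dots> = (matrix_wrt scale bs f *\<^sub>v coords v) $ r"
    using r by (auto simp: matrix_wrt_def scalar_prod_def coords_def lessThan_atLeast0 intro!: sum.cong)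
  finally show "coords (f v) $ r = (matrix_wrt scale bs f *\<^sub>v coords v) $ r" .
qed (simp add: matrix_wrt_def coords_def)

lemma matrix_wrt_carrier [simp]: "matrix_wrt scale bs f \<in> carrier_mat dm dm"
  by (simp add: matrix_wrt_def)

lemma matrix_wrt_coords: "r < dm \<Longrightarrow> c < dm \<Longrightarrow> matrix_wrt scale bs f $$ (r, c) = coords (f (bs ! c)) $ r"
  by (simp add: matrix_wrt_def coords_def)

lemma matrix_wrt_comp:
  assumes f: "Vector_Spaces.linear scale scale f"
  shows "matrix_wrt scale bs (f \<circ> g) = matrix_wrt scale bs f * matrix_wrt scale bs g"
proof (rule eq_matI)
  fix r c assume "r < dim_row (matrix_wrt scale bs f * matrix_wrt scale bs g)"
    "c < dim_col (matrix_wrt scale bs f * matrix_wrt scale bs g)"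
  then have rc: "r < dm" "c < dm" by (auto simp: matrix_wrt_def)
  have "coords (g (bs ! c)) = col (matrix_wrt scale bs g) c"
    using rc by (intro eq_vecI) (auto simp: matrix_wrt_def coords_def)
  then show "matrix_wrt scale bs (f \<circ> g) $$ (r, c) = (matrix_wrt scale bs f * matrix_wrt scale bs g) $$ (r, c)"
    using rc carrier_matD[OF matrix_wrt_carrier]
    by (simp add: matrix_wrt_coords[of r c "f \<circ> g"] coords_linear[OF f])
qed (simp_all add: matrix_wrt_def)

lemma matrix_wrt_id: "matrix_wrt scale bs id = 1\<^sub>m dm"
  by (rule eq_matI) (auto simp: matrix_wrt_coords coords_basis, simp_all add: matrix_wrt_def)

end

text \<open>The chosen list in the conclusion is the one chosen inside \<open>pencil_det\<close>, so
  matrices with respect to it are literally those of the pencil.\<close>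

lemma fin_dim_space_based:
  assumes "fin_dim_space s"
  shows "based_space s (SOME bs. ordered_basis s bs)"
proof -
  obtain B where "finite_dimensional_vector_space s B" using assms by (auto simp: fin_dim_space_def)
  then interpret finite_dimensional_vector_space s B .
  obtain bs where "set bs = B" "distinct bs" using finite_distinct_list[OF finite_Basis] by blast
  then have "ordered_basis s bs"
    using independent_Basis span_Basis by (simp add: ordered_basis_def)
  then have "ordered_basis s (SOME bs. ordered_basis s bs)" by (rule someI)
  then show ?thesis by unfold_locales
qed

lemma GL_hom_facts:
  fixes G (structure)
  assumes "group G" and "\<rho> \<in> hom G (GL s)"
  shows "\<And>g. g \<in> carrier G \<Longrightarrow> Vector_Spaces.linear s s (\<rho> g)" "\<And>g. g \<in> carrier G \<Longrightarrow> bij (\<rho> g)"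
    "\<And>g h. g \<in> carrier G \<Longrightarrow> h \<in> carrier G \<Longrightarrow> \<rho> (g \<otimes>\<^bsub>G\<^esub> h) = \<rho> g \<circ> \<rho> h" "\<rho> \<one>\<^bsub>G\<^esub> = id"
proof -
  interpret group G by fact
  have c: "\<rho> g \<in> carrier (GL s)" if "g \<in> carrier G" for g using assms(2) that by (auto simp: hom_def)
  show lin: "g \<in> carrier G \<Longrightarrow> Vector_Spaces.linear s s (\<rho> g)" and b: "g \<in> carrier G \<Longrightarrow> bij (\<rho> g)" for g
    using c[of g] by (auto simp: GL_def)
  show m: "g \<in> carrier G \<Longrightarrow> h \<in> carrier G \<Longrightarrow> \<rho> (g \<otimes> h) = \<rho> g \<circ> \<rho> h" for g h
    using assms(2) by (auto simp: hom_def GL_def)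
  show "\<rho> \<one> = id"
  proof
    fix x
    have "\<rho> \<one> (\<rho> \<one> x) = \<rho> \<one> x" using m[of \<one> \<one>] by (metis comp_apply one_closed r_one)
    then show "\<rho> \<one> x = id x" using b[OF one_closed] by (simp add: bij_is_inj inj_eq)
  qed
qed

lemma mat_rep_matrix_wrt:
  assumes G: "group G" and \<rho>: "\<rho> \<in> hom G (GL s)" and "based_space s bs"
  shows "mat_rep G (length bs) (\<lambda>g. matrix_wrt s bs (\<rho> g))"
proof -
  interpret based_space s bs by fact
  note r = GL_hom_facts[OF G \<rho>]
  show ?thesis unfolding mat_rep_def by (auto simp: r matrix_wrt_id intro: matrix_wrt_comp)
qed

lemma similar_matrices_equivalent_reps:
  assumes G: "group G" and \<rho>\<^sub>1: "\<rho>\<^sub>1 \<in> hom G (GL s\<^sub>1)" and \<rho>\<^sub>2: "\<rho>\<^sub>2 \<in> hom G (GL s\<^sub>2)"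
    and b: "based_space s\<^sub>1 bs\<^sub>1" "based_space s\<^sub>2 bs\<^sub>2" and len: "length bs\<^sub>1 = length bs\<^sub>2"
    and sim: "\<And>g. g \<in> carrier G \<Longrightarrow>
      similar_mat_wit (matrix_wrt s\<^sub>2 bs\<^sub>2 (\<rho>\<^sub>2 g)) (matrix_wrt s\<^sub>1 bs\<^sub>1 (\<rho>\<^sub>1 g)) P Q"
  shows "equivalent_reps G s\<^sub>1 \<rho>\<^sub>1 s\<^sub>2 \<rho>\<^sub>2"
proof -
  interpret V: based_space s\<^sub>1 bs\<^sub>1 by fact
  interpret W: based_space s\<^sub>2 bs\<^sub>2 by fact
  note r\<^sub>1 = GL_hom_facts[OF G \<rho>\<^sub>1] and r\<^sub>2 = GL_hom_facts[OF G \<rho>\<^sub>2]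
  define d where "d = length bs\<^sub>1"
  have one: "\<one>\<^bsub>G\<^esub> \<in> carrier G" using G by (simp add: group.is_monoid monoid.one_closed)
  have c: "matrix_wrt s\<^sub>1 bs\<^sub>1 f \<in> carrier_mat d d" "matrix_wrt s\<^sub>2 bs\<^sub>2 f' \<in> carrier_mat d d" for f f'
    using V.matrix_wrt_carrier W.matrix_wrt_carrier len by (auto simp: d_def)
  note w = similar_mat_witD2[OF c(2) sim]
  have PQ: "P \<in> carrier_mat d d" "Q \<in> carrier_mat d d" "P * Q = 1\<^sub>m d" "Q * P = 1\<^sub>m d"
    using w[OF one] by auto
  define C where "C v = W.comb (P *\<^sub>v V.coords v)" for v
  define C' where "C' v = V.comb (Q *\<^sub>v W.coords v)" for v
  have vc: "V.coords v \<in> carrier_vec d" "W.coords v' \<in> carrier_vec d" for v v'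
    using V.coords_carrier(1) W.coords_carrier(1) len by (auto simp: d_def)
  have coC: "W.coords (C v) = P *\<^sub>v V.coords v" for v
    unfolding C_def using PQ vc len by (intro W.coords_comb) (auto simp: d_def)
  have coC': "V.coords (C' v) = Q *\<^sub>v W.coords v" for v
    unfolding C'_def using PQ vc by (intro V.coords_comb) (auto simp: d_def)
  have CC': "C (C' v) = v" for v
    by (rule W.coords_inject)
      (simp add: coC coC' assoc_mult_mat_vec[OF PQ(1,2) vc(2), symmetric] PQ(3) one_mult_mat_vec[OF vc(2)])
  have C'C: "C' (C v) = v" for v
    by (rule V.coords_inject)
      (simp add: coC coC' assoc_mult_mat_vec[OF PQ(2,1) vc(1), symmetric] PQ(4) one_mult_mat_vec[OF vc(1)])
  have "bij C" by (rule o_bij[of C' C]) (auto simp: fun_eq_iff CC' C'C)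
  have inv: "inv_into UNIV C = C'"
    using \<open>bij C\<close> CC' by (metis bij_is_inj ext inv_f_eq)
  have add: "C (x + y) = C x + C y" for x y
    by (rule W.coords_inject)
      (simp add: coC W.coords_add V.coords_add mult_add_distrib_mat_vec[OF PQ(1) vc(1) vc(1)])
  have scale: "C (s\<^sub>1 a x) = s\<^sub>2 a (C x)" for a x
    by (rule W.coords_inject)
      (simp add: coC W.coords_scale V.coords_scale mult_mat_vec[OF PQ(1) vc(1)])
  have lin: "Vector_Spaces.linear s\<^sub>1 s\<^sub>2 C"
    unfolding module_hom_iff_linear[symmetric] module_hom_iff
    using V.module_axioms W.module_axioms add scale by simp
  have "\<rho>\<^sub>2 g = C \<circ> \<rho>\<^sub>1 g \<circ> C'" if g: "g \<in> carrier G" for g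
  proof
    fix v
    have "W.coords (\<rho>\<^sub>2 g v) = (P * matrix_wrt s\<^sub>1 bs\<^sub>1 (\<rho>\<^sub>1 g) * Q) *\<^sub>v W.coords v"
      unfolding W.coords_linear[OF r\<^sub>2(1)[OF g]] using w(3)[OF g] by simp
    also have "\<dots> = P *\<^sub>v (matrix_wrt s\<^sub>1 bs\<^sub>1 (\<rho>\<^sub>1 g) *\<^sub>v (Q *\<^sub>v W.coords v))"
      using PQ vc(2)[of v] c(1)[of "\<rho>\<^sub>1 g"]
      by (simp add: assoc_mult_mat_vec[of _ d d _ d])
    also have "\<dots> = W.coords (C (\<rho>\<^sub>1 g (C' v)))"
      by (simp add: coC coC' V.coords_linear[OF r\<^sub>1(1)[OF g]])
    finally show "\<rho>\<^sub>2 g v = (C \<circ> \<rho>\<^sub>1 g \<circ> C') v" using W.coords_inject by auto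
  qed
  then show ?thesis unfolding equivalent_reps_def using lin \<open>bij C\<close> inv by blast
qed

lemma cpoly_eval_D_poly:
  "cpoly_eval a (D_poly G n g s \<rho>) =
     det (lincomb_mat (length (SOME bs. ordered_basis s bs)) n
       (\<lambda>i. matrix_wrt s (SOME bs. ordered_basis s bs) (\<rho> (if i = 0 then \<one>\<^bsub>G\<^esub> else g i))) a)"
  unfolding D_poly_def pencil_det_def Let_def by (rule cpoly_eval_pencil)

section \<open>Class functions on Coxeter groups\<close>

definition word_prod :: "('g, 'x) monoid_scheme \<Rightarrow> ('i \<Rightarrow> 'g) \<Rightarrow> 'i list \<Rightarrow> 'g" where
  "word_prod G h w = foldr (\<lambda>i a. h i \<otimes>\<^bsub>G\<^esub> a) w \<one>\<^bsub>G\<^esub>"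

context group
begin

lemma word_prod_simps [simp]:
  "word_prod G h [] = \<one>" "word_prod G h (i # w) = h i \<otimes> word_prod G h w"
  by (simp_all add: word_prod_def)

lemma word_prod_closed: "(\<And>i. i \<in> set w \<Longrightarrow> h i \<in> carrier G) \<Longrightarrow> word_prod G h w \<in> carrier G"
  by (induction w) auto

lemma word_prod_append:
  assumes "\<And>i. h i \<in> carrier G"
  shows "word_prod G h (u @ v) = word_prod G h u \<otimes> word_prod G h v"
  by (induction u) (auto simp: assms m_assoc word_prod_closed)

lemma word_prod_map: "word_prod G h (map f w) = word_prod G (\<lambda>i. h (f i)) w"
  by (induction w) auto

lemma word_prod_cong: "(\<And>i. i \<in> set w \<Longrightarrow> h i = h' i) \<Longrightarrow> word_prod G h w = word_prod G h' w"
  by (induction w) auto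

lemma word_prod_transport:
  assumes "\<And>i. h i \<in> carrier G" "word_prod G h r = word_prod G h r'"
  shows "f (word_prod G h (u @ r @ v)) = f (word_prod G h (u @ r' @ v))"
  using assms by (simp add: word_prod_append)

lemma word_prod_cyclic:
  assumes "\<And>i. h i \<in> carrier G" "\<And>x y. x \<in> carrier G \<Longrightarrow> y \<in> carrier G \<Longrightarrow> f (x \<otimes> y) = f (y \<otimes> x)"
  shows "f (word_prod G h (u @ v)) = f (word_prod G h (v @ u))"
  using assms by (simp add: word_prod_append word_prod_closed)

lemma braid_trace_word_prod:
  assumes h: "\<And>i. h i \<in> carrier G"
    and f: "\<And>x y. x \<in> carrier G \<Longrightarrow> y \<in> carrier G \<Longrightarrow> f (x \<otimes> y) = f (y \<otimes> x)"
    and square: "\<And>i. i < n \<Longrightarrow> h i \<otimes> h i = \<one>"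
    and far: "\<And>i j. i + 2 \<le> j \<Longrightarrow> j < n \<Longrightarrow> h i \<otimes> h j = h j \<otimes> h i"
    and braid: "\<And>i. 1 \<le> i \<Longrightarrow> Suc i < n \<Longrightarrow> h i \<otimes> (h (Suc i) \<otimes> h i) = h (Suc i) \<otimes> (h i \<otimes> h (Suc i))"
    and braid4: "1 < n \<Longrightarrow> h 0 \<otimes> (h 1 \<otimes> (h 0 \<otimes> h 1)) = h 1 \<otimes> (h 0 \<otimes> (h 1 \<otimes> h 0))"
  shows "braid_trace n (\<lambda>w. f (word_prod G h w))"
proof
  fix u v :: "nat list" and i j
  show "f (word_prod G h (u @ [i, i] @ v)) = f (word_prod G h (u @ v))" if "i < n"
    using word_prod_transport[of h "[i, i]" "[]" f u v] square[OF that] h by simp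
  show "f (word_prod G h (u @ [i, j] @ v)) = f (word_prod G h (u @ [j, i] @ v))" if "i + 2 \<le> j" "j < n"
    by (rule word_prod_transport) (use far[OF that] h in auto)
  show "f (word_prod G h (u @ [i, Suc i, i] @ v)) = f (word_prod G h (u @ [Suc i, i, Suc i] @ v))"
    if "1 \<le> i" "Suc i < n"
    by (rule word_prod_transport) (use braid[OF that] h in auto)
  show "f (word_prod G h (u @ [0, 1, 0, 1] @ v)) = f (word_prod G h (u @ [1, 0, 1, 0] @ v))" if "1 < n"
    by (rule word_prod_transport) (use braid4[OF that] h in auto)
  show "f (word_prod G h (u @ v)) = f (word_prod G h (v @ u))"
    by (rule word_prod_cyclic) (use h f in auto)
qed

lemma fork_trace_word_prod:
  fixes f :: "'a \<Rightarrow> complex"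
  assumes h: "\<And>i. h i \<in> carrier G"
    and f: "\<And>x y. x \<in> carrier G \<Longrightarrow> y \<in> carrier G \<Longrightarrow> f (x \<otimes> y) = f (y \<otimes> x)"
    and n: "2 < n"
    and square: "\<And>i. i < n \<Longrightarrow> h i \<otimes> h i = \<one>"
    and far: "\<And>i j. 1 \<le> i \<Longrightarrow> i + 2 \<le> j \<Longrightarrow> j < n \<Longrightarrow> h i \<otimes> h j = h j \<otimes> h i"
    and braid: "\<And>i. 1 \<le> i \<Longrightarrow> Suc i < n \<Longrightarrow> h i \<otimes> (h (Suc i) \<otimes> h i) = h (Suc i) \<otimes> (h i \<otimes> h (Suc i))"
    and far0: "\<And>j. 3 \<le> j \<Longrightarrow> j < n \<Longrightarrow> h 0 \<otimes> h j = h j \<otimes> h 0"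
    and far01: "h 0 \<otimes> h 1 = h 1 \<otimes> h 0"
    and braid02: "h 0 \<otimes> (h 2 \<otimes> h 0) = h 2 \<otimes> (h 0 \<otimes> h 2)"
  shows "fork_trace n (\<lambda>w. f (word_prod G h w))"
proof
  fix u v :: "nat list" and i j
  show "2 < n" by fact
  show "f (word_prod G h (u @ [i, i] @ v)) = f (word_prod G h (u @ v))" if "i < n"
    using word_prod_transport[of h "[i, i]" "[]" f u v] square[OF that] h by simp
  show "f (word_prod G h (u @ [i, j] @ v)) = f (word_prod G h (u @ [j, i] @ v))"
    if "1 \<le> i" "i + 2 \<le> j" "j < n"
    by (rule word_prod_transport) (use far[OF that] h in auto)
  show "f (word_prod G h (u @ [i, Suc i, i] @ v)) = f (word_prod G h (u @ [Suc i, i, Suc i] @ v))"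
    if "1 \<le> i" "Suc i < n"
    by (rule word_prod_transport) (use braid[OF that] h in auto)
  show "f (word_prod G h (u @ [0, j] @ v)) = f (word_prod G h (u @ [j, 0] @ v))" if "3 \<le> j" "j < n"
    by (rule word_prod_transport) (use far0[OF that] h in auto)
  show "f (word_prod G h (u @ [0, 1] @ v)) = f (word_prod G h (u @ [1, 0] @ v))"
    by (rule word_prod_transport) (use far01 h in auto)
  show "f (word_prod G h (u @ [0, 2, 0] @ v)) = f (word_prod G h (u @ [2, 0, 2] @ v))"
    by (rule word_prod_transport) (use braid02 h in auto)
  show "f (word_prod G h (u @ v)) = f (word_prod G h (v @ u))"
    by (rule word_prod_cyclic) (use h f in auto)
qed

lemma involution_inv: "x \<in> carrier G \<Longrightarrow> x \<otimes> x = \<one> \<Longrightarrow> inv x = x"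
  by (rule inv_equality)

text \<open>A relation \<open>(x y)^k = 1\<close> is cut into two halves, one being the inverse of
  the other. Inverting a product of involutions just reverses it, which yields the braid
  relation.\<close>

lemma involutions_braid:
  assumes x: "x \<in> carrier G" "x \<otimes> x = \<one>" and y: "y \<in> carrier G" "y \<otimes> y = \<one>"
  shows "(x \<otimes> y) [^] (2::nat) = \<one> \<Longrightarrow> x \<otimes> y = y \<otimes> x"
    and "(x \<otimes> y) [^] (3::nat) = \<one> \<Longrightarrow> x \<otimes> (y \<otimes> x) = y \<otimes> (x \<otimes> y)"
    and "(x \<otimes> y) [^] (4::nat) = \<one> \<Longrightarrow> x \<otimes> (y \<otimes> (x \<otimes> y)) = y \<otimes> (x \<otimes> (y \<otimes> x))"
proof -
  note i = involution_inv[OF x] involution_inv[OF y]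
  have eq: "a = inv b" if "a \<otimes> b = \<one>" "a \<in> carrier G" "b \<in> carrier G" for a b
    using inv_equality[OF that(1) that(3) that(2)] by simp
  show "x \<otimes> y = y \<otimes> x" if "(x \<otimes> y) [^] (2::nat) = \<one>"
  proof -
    have "(x \<otimes> y) \<otimes> (x \<otimes> y) = \<one>" using that x y by (simp add: numeral_2_eq_2)
    from eq[OF this] show ?thesis using x y by (simp add: inv_mult_group i)
  qed
  show "x \<otimes> (y \<otimes> x) = y \<otimes> (x \<otimes> y)" if "(x \<otimes> y) [^] (3::nat) = \<one>"
  proof -
    have "(x \<otimes> (y \<otimes> x)) \<otimes> (y \<otimes> (x \<otimes> y)) = \<one>" using that x y by (simp add: numeral_3_eq_3 m_assoc)
    from eq[OF this] show ?thesis using x y by (simp add: inv_mult_group i m_assoc)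
  qed
  show "x \<otimes> (y \<otimes> (x \<otimes> y)) = y \<otimes> (x \<otimes> (y \<otimes> x))" if "(x \<otimes> y) [^] (4::nat) = \<one>"
  proof -
    have "(x \<otimes> (y \<otimes> (x \<otimes> y))) \<otimes> (x \<otimes> (y \<otimes> (x \<otimes> y))) = \<one>"
      using that x y by (simp add: numeral_eq_Suc m_assoc)
    from eq[OF this] show ?thesis using x y by (simp add: inv_mult_group i m_assoc)
  qed
qed

end

section \<open>Relabelling of letters and the individual types\<close>

lemma content_sums_reindex:
  assumes sum0: "\<And>C. (\<Sum>v | set v \<subseteq> {..n} \<and> mset v = C. \<psi> v) = (0 :: complex)"
    and inj: "inj_on \<sigma> {..<L}" and range: "\<sigma> ` {..<L} \<subseteq> {..n :: nat}"
  shows "(\<Sum>w | set w \<subseteq> {..<L} \<and> mset w = C. \<psi> (map \<sigma> w)) = 0"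
proof (cases "set_mset C \<subseteq> {..<L}")
  case False
  then have "{w. set w \<subseteq> {..<L} \<and> mset w = C} = {}" by auto
  then show ?thesis by (simp only: sum.empty)
next
  case True
  have "(\<Sum>w | set w \<subseteq> {..<L} \<and> mset w = C. \<psi> (map \<sigma> w)) =
      (\<Sum>v | set v \<subseteq> {..n} \<and> mset v = image_mset \<sigma> C. \<psi> v)"
  proof (rule sum.reindex_bij_witness[where j = "map \<sigma>" and i = "map (inv_into {..<L} \<sigma>)"])
    fix w assume "w \<in> {w. set w \<subseteq> {..<L} \<and> mset w = C}"
    then have w: "set w \<subseteq> {..<L}" "mset w = C" by auto
    show "map (inv_into {..<L} \<sigma>) (map \<sigma> w) = w"
      unfolding map_map by (rule map_idI) (use w inj in auto)
    show "map \<sigma> w \<in> {v. set v \<subseteq> {..n} \<and> mset v = image_mset \<sigma> C}"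
      using w range by auto
  next
    fix v assume "v \<in> {v. set v \<subseteq> {..n} \<and> mset v = image_mset \<sigma> C}"
    then have v: "mset v = image_mset \<sigma> C" by auto
    then have sv: "set v = \<sigma> ` set_mset C" by (metis set_image_mset set_mset_mset)
    show "map \<sigma> (map (inv_into {..<L} \<sigma>) v) = v"
      unfolding map_map by (rule map_idI) (use sv True in \<open>auto intro!: f_inv_into_f\<close>)
    have "mset (map (inv_into {..<L} \<sigma>) v) = image_mset (\<lambda>x. inv_into {..<L} \<sigma> (\<sigma> x)) C"
      by (simp add: v multiset.map_comp comp_def)
    also have "\<dots> = image_mset (\<lambda>x. x) C"
      by (rule image_mset_cong) (use inj True in auto)
    finally have m: "mset (map (inv_into {..<L} \<sigma>) v) = C" by simp
    then have "set (map (inv_into {..<L} \<sigma>) v) \<subseteq> {..<L}" using True by (metis set_mset_mset)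
    then show "map (inv_into {..<L} \<sigma>) v \<in> {w. set w \<subseteq> {..<L} \<and> mset w = C}" using m by simp
  qed simp
  then show ?thesis using sum0 by simp
qed

locale coxeter_class_function =
  fixes G (structure) and n :: nat and g :: "nat \<Rightarrow> 'g" and m :: "nat \<Rightarrow> nat \<Rightarrow> enat"
    and \<chi> :: "'g \<Rightarrow> complex"
  assumes cox: "coxeter_group G n g m"
    and class_fun: "\<And>x y. x \<in> carrier G \<Longrightarrow> y \<in> carrier G \<Longrightarrow> \<chi> (x \<otimes> y) = \<chi> (y \<otimes> x)"
    and content_sum: "\<And>C. (\<Sum>w | set w \<subseteq> {..n} \<and> mset w = C.
      \<chi> (word_prod G (\<lambda>i. if i = 0 then \<one> else g i) w)) = 0"
begin

sublocale group G
  using cox by (simp add: coxeter_group_def presented_by_def)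

text \<open>Indices outside the range, in particular \<open>0\<close>, stand for the identity. Index
  \<open>0\<close> is thereby the letter of the variable \<open>x\<^sub>0\<close>, and every value
  is an element of the group with trivial square.\<close>

definition gen :: "nat \<Rightarrow> 'g" where
  "gen i = (if i \<in> {1..n} then g i else \<one>)"

lemma gen_closed [simp]: "gen i \<in> carrier G"
  using cox by (auto simp: gen_def coxeter_group_def presented_by_def)

lemma word_val_relator:
  assumes "i \<in> {1..n}" "j \<in> {1..n}"
  shows "word_val G g (concat (replicate k [(i, True), (j, True)])) = (gen i \<otimes> gen j) [^] k"
proof (induction k)
  case 0
  then show ?case by (simp add: word_val_def)
next
  case (Suc k)
  have "word_val G g (concat (replicate (Suc k) [(i, True), (j, True)])) =
      gen i \<otimes> (gen j \<otimes> (gen i \<otimes> gen j) [^] k)"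
    using Suc assms by (simp add: word_val_def gen_def)
  also have "\<dots> = (gen i \<otimes> gen j) [^] Suc k"
    by (simp only: nat_pow_Suc2 m_closed gen_closed m_assoc nat_pow_closed)
  finally show ?case .
qed

lemma gen_relation:
  assumes "i \<in> {1..n}" "j \<in> {1..n}" "m i j = enat k"
  shows "(gen i \<otimes> gen j) [^] k = \<one>"
proof -
  let ?r = "concat (replicate k [(i, True), (j, True)])"
  have "?r \<in> coxeter_relators n m" unfolding coxeter_relators_def using assms by blast
  then have "pres_eq {1..n} (coxeter_relators n m) ([] @ ?r @ []) ([] @ [])" by (rule pres_eq.relator)
  moreover have "?r \<in> lists ({1..n} \<times> UNIV)" using assms by (auto simp: in_lists_conv_set)
  ultimately have "word_val G g ?r = \<one>" using cox by (simp add: coxeter_group_def presented_by_def)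
  then show ?thesis using word_val_relator[OF assms(1,2)] by simp
qed

lemma gen_square: "gen i \<otimes> gen i = \<one>"
proof (cases "i \<in> {1..n}")
  case True
  then have "m i i = enat 1" using cox by (simp add: coxeter_group_def coxeter_matrix_def one_enat_def)
  from gen_relation[OF True True this] show ?thesis by simp
next
  case False
  then have "gen i = \<one>" unfolding gen_def by (rule if_not_P)
  then show ?thesis by simp
qed

lemma gen_braid:
  assumes "i \<in> {1..n}" "j \<in> {1..n}"
  shows "m i j = 2 \<Longrightarrow> gen i \<otimes> gen j = gen j \<otimes> gen i"
    and "m i j = 3 \<Longrightarrow> gen i \<otimes> (gen j \<otimes> gen i) = gen j \<otimes> (gen i \<otimes> gen j)"
    and "m i j = 4 \<Longrightarrow> gen i \<otimes> (gen j \<otimes> (gen i \<otimes> gen j)) = gen j \<otimes> (gen i \<otimes> (gen j \<otimes> gen i))"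
  using involutions_braid[OF gen_closed gen_square gen_closed gen_square] gen_relation[OF assms]
  by (auto simp: numeral_eq_enat)

text \<open>The map \<open>\<sigma>\<close> sends the letters of the word calculus to indices in the
  pencil. Varying it lets the same class function be read as a function on words of different types,
  with the identity as an admissible letter.\<close>

definition F :: "(nat \<Rightarrow> nat) \<Rightarrow> nat list \<Rightarrow> complex" where
  "F \<sigma> w = \<chi> (word_prod G (\<lambda>i. gen (\<sigma> i)) w)"

lemma F_content_sum:
  assumes "inj_on \<sigma> {..<L}" "\<sigma> ` {..<L} \<subseteq> {..n}"
  shows "(\<Sum>w | set w \<subseteq> {..<L} \<and> mset w = C. F \<sigma> w) = 0"
proof -
  have "(\<Sum>w | set w \<subseteq> {..n} \<and> mset w = C. \<chi> (word_prod G gen w)) = 0" for C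
  proof -
    have "\<chi> (word_prod G gen w) = \<chi> (word_prod G (\<lambda>i. if i = 0 then \<one> else g i) w)"
      if "w \<in> {w. set w \<subseteq> {..n} \<and> mset w = C}" for w
      by (rule arg_cong[of _ _ \<chi>], rule word_prod_cong) (use that in \<open>auto simp: gen_def\<close>)
    then show ?thesis using content_sum[of C] by simp
  qed
  from content_sums_reindex[OF this assms] show ?thesis by (simp add: F_def word_prod_map)
qed

text \<open>The generators are involutions, so words without inverses already reach every
  element.\<close>

lemma vanish_generated:
  assumes F: "\<And>w. set w \<subseteq> {..<L} \<Longrightarrow> F \<sigma> w = 0" and \<sigma>: "{1..n} \<subseteq> \<sigma> ` {..<L}"
    and x: "x \<in> carrier G"
  shows "\<chi> x = 0"
proof -
  have "\<exists>w. set w \<subseteq> {..<L} \<and> word_prod G (\<lambda>i. gen (\<sigma> i)) w = y" if "y \<in> generate G (g ` {1..n})" for y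
    using that
  proof (induction rule: generate.induct)
    case one
    show ?case by (intro exI[of _ "[]"]) simp
  next
    case (incl y)
    then obtain i where i: "i \<in> {1..n}" "y = gen i" by (auto simp: gen_def)
    then obtain j where "j < L" "i = \<sigma> j" using \<sigma> by blast
    then show ?case using i by (intro exI[of _ "[j]"]) simp
  next
    case (inv y)
    then obtain i where i: "i \<in> {1..n}" "y = gen i" by (auto simp: gen_def)
    then obtain j where "j < L" "i = \<sigma> j" using \<sigma> by blast
    then show ?case using i involution_inv[OF gen_closed gen_square] by (intro exI[of _ "[j]"]) simp
  next
    case (eng y z)
    then obtain u v where "set u \<subseteq> {..<L}" "word_prod G (\<lambda>i. gen (\<sigma> i)) u = y"
      "set v \<subseteq> {..<L}" "word_prod G (\<lambda>i. gen (\<sigma> i)) v = z" by blast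
    then show ?case by (intro exI[of _ "u @ v"]) (simp add: word_prod_append)
  qed
  then show ?thesis using x F cox by (auto simp: F_def coxeter_group_def presented_by_def)
qed

text \<open>The generators become the letters from 1 to \<open>n\<close>, and letter
  \<open>0\<close> becomes the identity, which makes \<open>Suc n\<close> letters in all. The
  relations of type B that involve \<open>0\<close> then hold trivially, and the content sums stay
  available because the identity occurs in the pencil.\<close>

lemma vanish_type_A:
  assumes "type_A n m" and x: "x \<in> carrier G"
  shows "\<chi> x = 0"
proof -
  obtain \<pi> where \<pi>: "bij_betw \<pi> {1..n} {1..n}"
    and M: "\<And>i j. i \<in> {1..n} \<Longrightarrow> j \<in> {1..n} \<Longrightarrow> m (\<pi> i) (\<pi> j) = A_matrix i j"
    using assms(1) by (auto simp: type_A_def has_diagram_def)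
  define \<sigma> where "\<sigma> i = (if i = 0 then 0 else \<pi> i)" for i :: nat
  have \<pi>n: "\<pi> i \<in> {1..n}" if "i \<in> {1..n}" for i using bij_betwE[OF \<pi>] that by blast
  have \<sigma>0: "gen (\<sigma> 0) = \<one>" by (simp add: \<sigma>_def gen_def)
  have \<sigma>n: "\<sigma> i \<in> {1..n}" "\<sigma> i = \<pi> i" if "1 \<le> i" "i < Suc n" for i
    using \<pi>n[of i] that by (auto simp: \<sigma>_def)
  have "braid_trace (Suc n) (F \<sigma>)"
    unfolding F_def
  proof (rule braid_trace_word_prod)
    fix i j :: nat assume ij: "i + 2 \<le> j" "j < Suc n"
    show "gen (\<sigma> i) \<otimes> gen (\<sigma> j) = gen (\<sigma> j) \<otimes> gen (\<sigma> i)"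
    proof (cases "i = 0")
      case False
      show ?thesis
        by (rule gen_braid(1)) (use False ij \<sigma>n[of i] \<sigma>n[of j] M[of i j] in \<open>auto simp: A_matrix_def\<close>)
    qed (simp add: \<sigma>0)
  next
    fix i :: nat assume i: "1 \<le> i" "Suc i < Suc n"
    show "gen (\<sigma> i) \<otimes> (gen (\<sigma> (Suc i)) \<otimes> gen (\<sigma> i)) = gen (\<sigma> (Suc i)) \<otimes> (gen (\<sigma> i) \<otimes> gen (\<sigma> (Suc i)))"
      by (rule gen_braid(2)) (use i \<sigma>n[of i] \<sigma>n[of "Suc i"] M[of i "Suc i"] in \<open>auto simp: A_matrix_def\<close>)
  qed (simp_all add: \<sigma>0 gen_square class_fun)
  moreover have inj: "inj_on \<sigma> {..<Suc n}"
  proof (rule inj_onI)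
    fix a b assume ab: "a \<in> {..<Suc n}" "b \<in> {..<Suc n}" "\<sigma> a = \<sigma> b"
    show "a = b"
    proof (cases "a = 0 \<or> b = 0")
      case True
      then show ?thesis using ab \<sigma>n(1)[of a] \<sigma>n(1)[of b] by (cases a; cases b) (auto simp: \<sigma>_def)
    next
      case False
      then have "a \<in> {1..n}" "b \<in> {1..n}" "\<pi> a = \<pi> b" using ab by (auto simp: \<sigma>_def)
      then show ?thesis using \<pi> by (auto simp: bij_betw_def dest: inj_onD)
    qed
  qed
  moreover have "\<sigma> ` {..<Suc n} \<subseteq> {..n}" using \<pi>n by (auto simp: \<sigma>_def)
  ultimately have "F \<sigma> w = 0" if "set w \<subseteq> {..<Suc n}" for w
    using braid_trace_vanish that F_content_sum by blast
  moreover have "{1..n} \<subseteq> \<sigma> ` {..<Suc n}"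
  proof
    fix k assume "k \<in> {1..n}"
    then have "k \<in> \<pi> ` {1..n}" using bij_betw_imp_surj_on[OF \<pi>] by simp
    then obtain i where "i \<in> {1..n}" "k = \<pi> i" by blast
    then show "k \<in> \<sigma> ` {..<Suc n}" by (intro image_eqI[of _ _ i]) (auto simp: \<sigma>_def)
  qed
  ultimately show ?thesis using vanish_generated x by blast
qed

text \<open>The word calculus counts from the special end of the diagram, where the 4-bond or the
  fork is; the matrices of types B and D have this end at the largest indices.\<close>

lemma reversed_letters:
  assumes \<pi>: "bij_betw \<pi> {1..n} {1..n}"
  defines "\<sigma> \<equiv> \<lambda>i. \<pi> (n - i)"
  shows "inj_on \<sigma> {..<n}" "\<sigma> ` {..<n} = {1..n}"
proof -
  have "bij_betw (\<lambda>i. n - i) {..<n} {1..n}"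
    by (rule bij_betw_byWitness[where f' = "\<lambda>i. n - i"]) auto
  then have "bij_betw \<sigma> {..<n} {1..n}"
    using bij_betw_trans[OF _ \<pi>] unfolding \<sigma>_def comp_def by blast
  then show "inj_on \<sigma> {..<n}" "\<sigma> ` {..<n} = {1..n}" by (auto simp: bij_betw_def)
qed

lemma vanish_type_B:
  assumes "type_B n m" and x: "x \<in> carrier G"
  shows "\<chi> x = 0"
proof -
  obtain \<pi> where \<pi>: "bij_betw \<pi> {1..n} {1..n}"
    and M: "\<And>i j. i \<in> {1..n} \<Longrightarrow> j \<in> {1..n} \<Longrightarrow> m (\<pi> i) (\<pi> j) = B_matrix n i j"
    and n: "2 \<le> n"
    using assms(1) by (auto simp: type_B_def has_diagram_def)
  define \<sigma> where "\<sigma> i = \<pi> (n - i)" for i :: nat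
  note \<sigma> = reversed_letters[OF \<pi>, folded \<sigma>_def]
  have \<sigma>n: "\<sigma> i \<in> {1..n}" if "i < n" for i using \<sigma>(2) that by blast
  have M': "m (\<sigma> i) (\<sigma> j) = B_matrix n (n - i) (n - j)" if "i < n" "j < n" for i j
    unfolding \<sigma>_def using that by (intro M) auto
  have "braid_trace n (F \<sigma>)"
    unfolding F_def
  proof (rule braid_trace_word_prod)
    fix i j :: nat assume ij: "i + 2 \<le> j" "j < n"
    show "gen (\<sigma> i) \<otimes> gen (\<sigma> j) = gen (\<sigma> j) \<otimes> gen (\<sigma> i)"
      by (rule gen_braid(1)) (use ij \<sigma>n[of i] \<sigma>n[of j] M'[of i j] in \<open>auto simp: B_matrix_def doubleton_eq_iff\<close>)
  next
    fix i :: nat assume i: "1 \<le> i" "Suc i < n"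
    show "gen (\<sigma> i) \<otimes> (gen (\<sigma> (Suc i)) \<otimes> gen (\<sigma> i)) = gen (\<sigma> (Suc i)) \<otimes> (gen (\<sigma> i) \<otimes> gen (\<sigma> (Suc i)))"
      by (rule gen_braid(2)) (use i \<sigma>n[of i] \<sigma>n[of "Suc i"] M'[of i "Suc i"] in \<open>auto simp: B_matrix_def doubleton_eq_iff\<close>)
  next
    show "gen (\<sigma> 0) \<otimes> (gen (\<sigma> 1) \<otimes> (gen (\<sigma> 0) \<otimes> gen (\<sigma> 1))) =
        gen (\<sigma> 1) \<otimes> (gen (\<sigma> 0) \<otimes> (gen (\<sigma> 1) \<otimes> gen (\<sigma> 0)))"
      by (rule gen_braid(3)) (use n \<sigma>n[of 0] \<sigma>n[of 1] M'[of 0 1] in \<open>auto simp: B_matrix_def doubleton_eq_iff\<close>)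
  qed (simp_all add: gen_square class_fun)
  moreover have "\<sigma> ` {..<n} \<subseteq> {..n}" using \<sigma>(2) by auto
  ultimately have "F \<sigma> w = 0" if "set w \<subseteq> {..<n}" for w
    using braid_trace_vanish that F_content_sum \<sigma>(1) by blast
  then show ?thesis using vanish_generated[of n \<sigma>] \<sigma>(2) x by blast
qed

lemma vanish_type_D:
  assumes "type_D n m" and x: "x \<in> carrier G"
  shows "\<chi> x = 0"
proof -
  obtain k \<pi> where \<pi>: "bij_betw \<pi> {1..n} {1..n}"
    and M: "\<And>i j. i \<in> {1..n} \<Longrightarrow> j \<in> {1..n} \<Longrightarrow> m (\<pi> i) (\<pi> j) = D_matrix k i j"
    and n: "2 \<le> k" "n = k + 1"
    using assms(1) by (auto simp: type_D_def has_diagram_def)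
  define \<sigma> where "\<sigma> i = \<pi> (n - i)" for i :: nat
  note \<sigma> = reversed_letters[OF \<pi>, folded \<sigma>_def]
  have \<sigma>n: "\<sigma> i \<in> {1..n}" if "i < n" for i using \<sigma>(2) that by blast
  have M': "m (\<sigma> i) (\<sigma> j) = D_matrix k (n - i) (n - j)" if "i < n" "j < n" for i j
    unfolding \<sigma>_def using that by (intro M) auto
  have far: "gen (\<sigma> i) \<otimes> gen (\<sigma> j) = gen (\<sigma> j) \<otimes> gen (\<sigma> i)" if ij: "1 \<le> i" "i + 2 \<le> j" "j < n" for i j
    by (rule gen_braid(1)) (use ij n \<sigma>n[of i] \<sigma>n[of j] M'[of i j] in \<open>auto simp: D_matrix_def doubleton_eq_iff\<close>)
  have braid: "gen (\<sigma> i) \<otimes> (gen (\<sigma> (Suc i)) \<otimes> gen (\<sigma> i)) = gen (\<sigma> (Suc i)) \<otimes> (gen (\<sigma> i) \<otimes> gen (\<sigma> (Suc i)))"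
    if i: "1 \<le> i" "Suc i < n" for i
    by (rule gen_braid(2)) (use i n \<sigma>n[of i] \<sigma>n[of "Suc i"] M'[of i "Suc i"] in \<open>auto simp: D_matrix_def doubleton_eq_iff\<close>)
  have fork: "fork_trace n (F \<sigma>)"
    unfolding F_def
  proof (rule fork_trace_word_prod)
    show "2 < n" using n by simp
    show "gen (\<sigma> 0) \<otimes> gen (\<sigma> j) = gen (\<sigma> j) \<otimes> gen (\<sigma> 0)" if j: "3 \<le> j" "j < n" for j
      by (rule gen_braid(1)) (use j n \<sigma>n[of 0] \<sigma>n[of j] M'[of 0 j] in \<open>auto simp: D_matrix_def doubleton_eq_iff\<close>)
    show "gen (\<sigma> 0) \<otimes> gen (\<sigma> 1) = gen (\<sigma> 1) \<otimes> gen (\<sigma> 0)"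
      by (rule gen_braid(1)) (use n \<sigma>n[of 0] \<sigma>n[of 1] M'[of 0 1] in \<open>auto simp: D_matrix_def doubleton_eq_iff\<close>)
    show "gen (\<sigma> 0) \<otimes> (gen (\<sigma> 2) \<otimes> gen (\<sigma> 0)) = gen (\<sigma> 2) \<otimes> (gen (\<sigma> 0) \<otimes> gen (\<sigma> 2))"
      by (rule gen_braid(2)) (use n \<sigma>n[of 0] \<sigma>n[of 2] M'[of 0 2] in \<open>auto simp: D_matrix_def doubleton_eq_iff\<close>)
    show "gen (\<sigma> i) \<otimes> gen (\<sigma> j) = gen (\<sigma> j) \<otimes> gen (\<sigma> i)" if "1 \<le> i" "i + 2 \<le> j" "j < n" for i j
      by (rule far[OF that])
    show "gen (\<sigma> i) \<otimes> (gen (\<sigma> (Suc i)) \<otimes> gen (\<sigma> i)) = gen (\<sigma> (Suc i)) \<otimes> (gen (\<sigma> i) \<otimes> gen (\<sigma> (Suc i)))"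
      if "1 \<le> i" "Suc i < n" for i
      by (rule braid[OF that])
  qed (simp_all add: gen_square class_fun)
  have \<sigma>_sum: "(\<Sum>w | set w \<subseteq> {..<n} \<and> mset w = C. F \<sigma> w) = 0" for C
    using F_content_sum[OF \<sigma>(1)] \<sigma>(2) by auto
  \<comment> \<open>The identity is put in the place of the fork letter \<open>0\<close>. What
    remains is the chain of letters from 1 on, so the type-A argument applies and supplies
    \<open>tail\<close>.\<close>
  define \<tau> where "\<tau> = \<sigma>(0 := 0)"
  have \<tau>0: "gen (\<tau> 0) = \<one>" by (simp add: \<tau>_def gen_def)
  have \<tau>: "\<tau> i = \<sigma> i" if "1 \<le> i" for i using that by (simp add: \<tau>_def)
  have "braid_trace n (F \<tau>)"
    unfolding F_def
  proof (rule braid_trace_word_prod)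
    fix i j :: nat assume ij: "i + 2 \<le> j" "j < n"
    then show "gen (\<tau> i) \<otimes> gen (\<tau> j) = gen (\<tau> j) \<otimes> gen (\<tau> i)"
      using far[of i j] \<tau>[of i] \<tau>[of j] \<tau>0 by (cases "i = 0") auto
  next
    fix i :: nat assume i: "1 \<le> i" "Suc i < n"
    then show "gen (\<tau> i) \<otimes> (gen (\<tau> (Suc i)) \<otimes> gen (\<tau> i)) = gen (\<tau> (Suc i)) \<otimes> (gen (\<tau> i) \<otimes> gen (\<tau> (Suc i)))"
      using braid[OF i] \<tau>[of i] \<tau>[of "Suc i"] by simp
  qed (simp_all add: \<tau>0 gen_square class_fun)
  moreover have "inj_on \<tau> {..<n}"
  proof -
    have "\<sigma> i \<noteq> 0" if "i < n" for i using \<sigma>n[OF that] by simp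
    then show ?thesis using \<sigma>(1) by (auto simp: inj_on_def \<tau>_def)
  qed
  moreover have "\<tau> ` {..<n} \<subseteq> {..n}" using \<sigma>n by (auto simp: \<tau>_def)
  ultimately have F\<tau>: "F \<tau> w = 0" if "set w \<subseteq> {..<n}" for w
    using braid_trace_vanish that F_content_sum by blast
  have tail: "F \<sigma> w = 0" if w: "set w \<subseteq> {1..<n}" for w
  proof -
    have "F \<sigma> w = F \<tau> w"
      unfolding F_def by (rule arg_cong[of _ _ \<chi>], rule word_prod_cong) (use w \<tau> in auto)
    moreover have "set w \<subseteq> {..<n}" using w by auto
    ultimately show ?thesis using F\<tau>[of w] by simp
  qed
  have "F \<sigma> w = 0" if "set w \<subseteq> {..<n}" for w
    by (rule fork_trace.vanish[OF fork \<sigma>_sum tail that])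
  then show ?thesis using vanish_generated[of n \<sigma>] \<sigma>(2) x by blast
qed

lemma vanish_type_I:
  assumes "type_I n m" and x: "x \<in> carrier G"
  shows "\<chi> x = 0"
proof -
  have n: "n = 2" using assms(1) by (auto simp: type_I_def)
  have inj: "inj_on Suc {..<2}" and im: "Suc ` {..<2} = {1..2}" by (simp_all add: image_Suc_lessThan)
  have "F Suc w = 0" if w: "set w \<subseteq> {..<2}" for w
  proof (rule dihedral_vanish[OF _ _ _ w])
    show "F Suc (u @ v) = F Suc (v @ u)" for u v
      unfolding F_def by (rule word_prod_cyclic) (auto simp: class_fun)
    show "F Suc (u @ [i, i] @ v) = F Suc (u @ v)" for i u v
      unfolding F_def using word_prod_transport[of "\<lambda>i. gen (Suc i)" "[i, i]" "[]" \<chi> u v]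
      by (simp add: gen_square)
    show "(\<Sum>w | set w \<subseteq> {..<2} \<and> mset w = C. F Suc w) = 0" for C
      by (rule F_content_sum[OF inj]) (use im n in auto)
  qed
  then show ?thesis using vanish_generated[of 2 Suc] im n x by simp
qed

end

lemma word_mat_rep:
  fixes G (structure)
  assumes "group G" and M: "mat_rep G d M" and "\<And>i. i \<in> set w \<Longrightarrow> h i \<in> carrier G"
  shows "word_mat d (\<lambda>i. M (h i)) w = M (word_prod G h w)"
proof -
  interpret group G by fact
  show ?thesis
    using assms(3) by (induction w) (auto simp: mat_repD(2,3)[OF M] word_prod_closed)
qed

theorem theorem1p2:
  fixes G :: "('g, 'x) monoid_scheme"
    and n :: nat
    and g :: "nat \<Rightarrow> 'g"
    and m :: "nat \<Rightarrow> nat \<Rightarrow> enat"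
    and s\<^sub>1 :: "complex \<Rightarrow> 'v \<Rightarrow> 'v::ab_group_add"
    and s\<^sub>2 :: "complex \<Rightarrow> 'w \<Rightarrow> 'w::ab_group_add"
    and \<rho>\<^sub>1 :: "'g \<Rightarrow> 'v \<Rightarrow> 'v"
    and \<rho>\<^sub>2 :: "'g \<Rightarrow> 'w \<Rightarrow> 'w"
  assumes "coxeter_group G n g m"
    and "finite (carrier G)"
    and "type_I n m \<or> type_A n m \<or> type_B n m \<or> type_D n m"
    and "fin_dim_rep G s\<^sub>1 \<rho>\<^sub>1"
    and "fin_dim_rep G s\<^sub>2 \<rho>\<^sub>2"
    and "same_hypersurface (D_poly G n g s\<^sub>1 \<rho>\<^sub>1) (D_poly G n g s\<^sub>2 \<rho>\<^sub>2)"
  shows "equivalent_reps G s\<^sub>1 \<rho>\<^sub>1 s\<^sub>2 \<rho>\<^sub>2"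
proof -
  interpret group G using assms(1) by (simp add: coxeter_group_def presented_by_def)
  have G: "group G" by (rule is_group)
  have \<rho>: "\<rho>\<^sub>1 \<in> hom G (GL s\<^sub>1)" "\<rho>\<^sub>2 \<in> hom G (GL s\<^sub>2)"
    using assms(4,5) by (auto simp: fin_dim_rep_def)
  define bs\<^sub>1 where "bs\<^sub>1 = (SOME bs. ordered_basis s\<^sub>1 bs)"
  define bs\<^sub>2 where "bs\<^sub>2 = (SOME bs. ordered_basis s\<^sub>2 bs)"
  have bs: "based_space s\<^sub>1 bs\<^sub>1" "based_space s\<^sub>2 bs\<^sub>2"
    unfolding bs\<^sub>1_def bs\<^sub>2_def using assms(4,5) by (auto simp: fin_dim_rep_def intro: fin_dim_space_based)
  define M\<^sub>1 where "M\<^sub>1 x = matrix_wrt s\<^sub>1 bs\<^sub>1 (\<rho>\<^sub>1 x)" for x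
  define M\<^sub>2 where "M\<^sub>2 x = matrix_wrt s\<^sub>2 bs\<^sub>2 (\<rho>\<^sub>2 x)" for x
  define d where "d = length bs\<^sub>1"
  have rep\<^sub>1: "mat_rep G d M\<^sub>1"
    unfolding M\<^sub>1_def d_def by (rule mat_rep_matrix_wrt[OF G \<rho>(1) bs(1)])
  have rep\<^sub>2': "mat_rep G (length bs\<^sub>2) M\<^sub>2"
    unfolding M\<^sub>2_def by (rule mat_rep_matrix_wrt[OF G \<rho>(2) bs(2)])
  define e where "e i = (if i = 0 then \<one>\<^bsub>G\<^esub> else g i)" for i
  have e: "e i \<in> carrier G" if "i \<le> n" for i
    using that assms(1) by (auto simp: e_def coxeter_group_def presented_by_def)
  obtain c where c: "c \<noteq> 0" "D_poly G n g s\<^sub>1 \<rho>\<^sub>1 = const_poly c * D_poly G n g s\<^sub>2 \<rho>\<^sub>2"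
    using assms(6) by (auto simp: same_hypersurface_def)
  \<comment> \<open>Evaluation at numbers turns the identity of polynomials into one of determinants
    of complex matrices, for every point \<open>a\<close>.\<close>
  have dets: "det (lincomb_mat d n (\<lambda>i. M\<^sub>1 (e i)) a) = c * det (lincomb_mat (length bs\<^sub>2) n (\<lambda>i. M\<^sub>2 (e i)) a)" for a
    using arg_cong[OF c(2), of "cpoly_eval a"]
    by (simp add: cpoly_eval_mult cpoly_eval_D_poly M\<^sub>1_def M\<^sub>2_def e_def d_def bs\<^sub>1_def bs\<^sub>2_def)
  have one: "M\<^sub>1 (e 0) = 1\<^sub>m d" "M\<^sub>2 (e 0) = 1\<^sub>m (length bs\<^sub>2)"
    using mat_repD(2)[OF rep\<^sub>1] mat_repD(2)[OF rep\<^sub>2'] by (simp_all add: e_def)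
  have len: "d = length bs\<^sub>2"
    by (rule pencils_agree(1)[of "\<lambda>i. M\<^sub>1 (e i)" d "\<lambda>i. M\<^sub>2 (e i)", OF one c(1) dets])
  have traces: "mtrace (lincomb_mat d n (\<lambda>i. M\<^sub>1 (e i)) a ^\<^sub>m k) = mtrace (lincomb_mat d n (\<lambda>i. M\<^sub>2 (e i)) a ^\<^sub>m k)"
    for a k
    using pencils_agree(2)[of "\<lambda>i. M\<^sub>1 (e i)" d "\<lambda>i. M\<^sub>2 (e i)", OF one c(1) dets] len by simp
  have rep\<^sub>2: "mat_rep G d M\<^sub>2" using rep\<^sub>2' len by simp
  \<comment> \<open>The difference of the two characters: linear in the traces, so that equal traces
    of powers become vanishing sums over words.\<close>
  define \<chi> where "\<chi> x = mtrace (M\<^sub>1 x) - mtrace (M\<^sub>2 x)" for x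
  have "coxeter_class_function G n g m \<chi>"
  proof
    show "coxeter_group G n g m" by fact
    show "\<chi> (x \<otimes>\<^bsub>G\<^esub> y) = \<chi> (y \<otimes>\<^bsub>G\<^esub> x)" if "x \<in> carrier G" "y \<in> carrier G" for x y
      using that mtrace_mult_comm[OF mat_repD(1)[OF rep\<^sub>1] mat_repD(1)[OF rep\<^sub>1], of x y]
        mtrace_mult_comm[OF mat_repD(1)[OF rep\<^sub>2] mat_repD(1)[OF rep\<^sub>2], of x y]
      by (simp add: \<chi>_def mat_repD(3)[OF rep\<^sub>1] mat_repD(3)[OF rep\<^sub>2])
    fix C
    define \<phi> where "\<phi> w = mtrace (word_mat d (\<lambda>i. M\<^sub>1 (e i)) w) - mtrace (word_mat d (\<lambda>i. M\<^sub>2 (e i)) w)" for w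
    have "(\<Sum>w | set w \<subseteq> {..n} \<and> mset w = C. \<phi> w) = 0"
    proof (rule content_sums_vanish)
      fix a k
      have "mtrace (lincomb_mat d n (\<lambda>i. M\<^sub>1 (e i)) a ^\<^sub>m k) - mtrace (lincomb_mat d n (\<lambda>i. M\<^sub>2 (e i)) a ^\<^sub>m k) = 0"
        using traces by simp
      then show "(\<Sum>w | set w \<subseteq> {..n} \<and> length w = k. prod_list (map a w) * \<phi> w) = 0"
        using mtrace_lincomb_pow[of n "\<lambda>i. M\<^sub>1 (e i)" d a k] mtrace_lincomb_pow[of n "\<lambda>i. M\<^sub>2 (e i)" d a k]
          mat_repD(1)[OF rep\<^sub>1 e] mat_repD(1)[OF rep\<^sub>2 e]
        by (simp add: \<phi>_def right_diff_distrib sum_subtractf)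
    qed
    moreover have "\<phi> w = \<chi> (word_prod G (\<lambda>i. if i = 0 then \<one>\<^bsub>G\<^esub> else g i) w)"
      if "w \<in> {w. set w \<subseteq> {..n} \<and> mset w = C}" for w
    proof -
      have "e i \<in> carrier G" if "i \<in> set w" for i using e \<open>w \<in> _\<close> that by auto
      then have "\<phi> w = \<chi> (word_prod G e w)"
        by (simp add: \<phi>_def \<chi>_def word_mat_rep[OF G rep\<^sub>1] word_mat_rep[OF G rep\<^sub>2])
      then show ?thesis by (simp add: e_def[abs_def])
    qed
    ultimately show "(\<Sum>w | set w \<subseteq> {..n} \<and> mset w = C.
        \<chi> (word_prod G (\<lambda>i. if i = 0 then \<one>\<^bsub>G\<^esub> else g i) w)) = 0" by simp
  qed
  then interpret coxeter_class_function G n g m \<chi> .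
  have "\<chi> x = 0" if "x \<in> carrier G" for x
    using assms(3) that vanish_type_A vanish_type_B vanish_type_D vanish_type_I by blast
  then have "mtrace (M\<^sub>1 x) = mtrace (M\<^sub>2 x)" if "x \<in> carrier G" for x using that by (simp add: \<chi>_def)
  then obtain P Q where "\<And>x. x \<in> carrier G \<Longrightarrow> similar_mat_wit (M\<^sub>2 x) (M\<^sub>1 x) P Q"
    using equal_characters_similar[OF assms(2) rep\<^sub>1 rep\<^sub>2] by blast
  then show ?thesis
    unfolding M\<^sub>1_def M\<^sub>2_def
    by (intro similar_matrices_equivalent_reps[OF G \<rho> bs]) (use len in \<open>auto simp: d_def\<close>)
qed

end
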